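(* Let $P$ be an irreducible semi-isotropic transition matrix on $\mathbb T=\mathbb T_q$ satisfying case (A) or case (B), and let $G(x,y)=\sum_{n\ge0}p^{(n)}(x,y)$ and $K(x,y)=G(x,y)/G(o,y)$ be its Green and Martin kernels. Let $K(x,\xi)$, $\xi\in\partial^*\mathbb T$, be the continuous realization of $d\nu_x/d\nu_o$ defined via the harmonic measures. Then for every $x\in\mathbb T$, $$\lim_{n\to\infty}K(x,y_n)=K(x,\xi)$$ whenever $(y_n)$ is a sequence of vertices converging to $\xi\in\partial^*\mathbb T$ in the end compactification $\mathbb T\cup\partial\mathbb T$.
   Context: Tree notation: $\mathbb T=\mathbb T_q$ ($q\ge2$) is the homogeneous tree of degree $q+1$ with graph metric $d$, a fixed end $\omega$ and a root $o$. Each vertex $x$ has a unique neighbour $x^-$ (its predecessor) on the geodesic ray from $x$ to $\omega$. $\mathrm{hor}(o)=0$, $\mathrm{hor}(x)=\mathrm{hor}(x^-)+1$. Ancestors of $x$: $x,x^-,(x^-)^-,\dots$; $x\curlywedge y$ is the common ancestor of $x,y$ with maximal $\mathrm{hor}$; $\mathrm{up}(x,y)=\mathrm{hor}(x)-\mathrm{hor}(x\curlywedge y)$. $\partial\mathbb T$ is the space of ends with the end topology, $\partial^*\mathbb T=\partial\mathbb T\setminus\{\omega\}$. $P$ semi-isotropic: $p(x,y)$ depends only on $(\mathrm{up}(x,y),\mathrm{up}(y,x))$ (irreducible such $P$ is transient). $m_t(P)=\sum_x d(o,x)^tp(o,x)$, $m(P)=m_1(P)$; $\tilde\mu(n)=\sum_{y:\mathrm{hor}(y)-\mathrm{hor}(x)=n}p(x,y)$;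 $\alpha(P)=\sum_n n\tilde\mu(n)$; $\varphi(c)=\sum_m\tilde\mu(m)e^{cm}$. Case (A): $m(P)<\infty$ and $\alpha(P)>0$, or $m_{2+\epsilon}(P)<\infty$ for some $\epsilon>0$ and $\alpha(P)=0$. Case (B), condition (H): there is $c_0>0$ with $\varphi(c_0)=1$ and $\sum_x d(o,x)p(o,x)e^{c_0\mathrm{hor}(x)}<\infty$. Group: $\Gamma=\mathrm{Aff}(\mathbb T)$ = automorphisms of $\mathbb T$ fixing $\omega$; left Haar measure $dg$ with the stabilizer of $o$ of measure $1$; $\mu(dg)=p(o,go)dg$, $\mu^\sharp(dg)=e^{c_0\mathrm{hor}(go)}\mu(dg)$; $\lambda*\nu(E)=\int\nu(g^{-1}E)\lambda(dg)$, invariance means $\lambda*\nu=\nu$. Harmonic measures: in case (A), $\nu$ is the (up to scaling unique, nonzero) $\mu$-invariant Radon measure on $\partial^*\mathbb T$ and $\nu_x(E)=\nu(g^{-1}E)$ for $g\in\Gamma$ with $go=x$; in case (B), $\nu$ is the (up to scaling unique) $\mu^\sharp$-invariant finite measure on $\partial^*\mathbb T$ and $\nu_x(E)=e^{c_0\mathrm{hor}(x)}\nu(g^{-1}E)$ for $g$ with $go=x$. These measures are mutually absolutely continuous and $d\nu_x/d\nu_o$ has a unique continuous realization $K(x,\cdot)$ on $\partial^*\mathbb T$. *)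

theory Defs
  imports "HOL-Probability.Probability"
begin

text \<open>The vertex set is the whole type 'v. The map pr sends x to its predecessor x^-,
  the neighbour of x on the ray from x to the fixed end omega. The edges of the tree are
  the pairs {x, pr x}. The conditions below say that every vertex has exactly q
  successors (so every vertex has degree q+1), that there are no cycles and that the graph
  is connected; such a structure is the homogeneous tree T_q together with a fixed end.\<close>

definition tree_with_end :: "nat \<Rightarrow> ('v \<Rightarrow> 'v) \<Rightarrow> bool" where
  "tree_with_end q pr \<longleftrightarrow>
     (\<forall>x. finite {y. pr y = x} \<and> card {y. pr y = x} = q) \<and>
     (\<forall>x n. n > 0 \<longrightarrow> (pr ^^ n) x \<noteq> x) \<and>
     (\<forall>x y. \<exists>m n. (pr ^^ m) x = (pr ^^ n) y)"

text \<open>Horocycle index with hor(rt) = 0 and hor(x) = hor(x^-) + 1.\<close>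
definition hor :: "('v \<Rightarrow> 'v) \<Rightarrow> 'v \<Rightarrow> 'v \<Rightarrow> int" where
  "hor pr rt x = (THE k. \<exists>m n. (pr ^^ m) x = (pr ^^ n) rt \<and> k = int m - int n)"

text \<open>up(x,y) = hor(x) - hor(x meet y): the number of predecessor steps from x to the
  maximal common ancestor of x and y.\<close>
definition up :: "('v \<Rightarrow> 'v) \<Rightarrow> 'v \<Rightarrow> 'v \<Rightarrow> nat" where
  "up pr x y = (LEAST m. \<exists>n. (pr ^^ m) x = (pr ^^ n) y)"

definition tdist :: "('v \<Rightarrow> 'v) \<Rightarrow> 'v \<Rightarrow> 'v \<Rightarrow> nat" where
  "tdist pr x y = up pr x y + up pr y x"

definition stochastic :: "('v \<Rightarrow> 'v \<Rightarrow> real) \<Rightarrow> bool" where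
  "stochastic p \<longleftrightarrow> (\<forall>x y. p x y \<ge> 0) \<and>
     (\<forall>x. p x summable_on UNIV \<and> (\<Sum>\<^sub>\<infinity>y. p x y) = 1)"

fun mpow :: "('v \<Rightarrow> 'v \<Rightarrow> real) \<Rightarrow> nat \<Rightarrow> 'v \<Rightarrow> 'v \<Rightarrow> real" where
  "mpow p 0 x y = (if x = y then 1 else 0)"
| "mpow p (Suc n) x y = (\<Sum>\<^sub>\<infinity>z. p x z * mpow p n z y)"

definition irreducible_tm :: "('v \<Rightarrow> 'v \<Rightarrow> real) \<Rightarrow> bool" where
  "irreducible_tm p \<longleftrightarrow> (\<forall>x y. \<exists>n. mpow p n x y > 0)"

definition semi_isotropic :: "('v \<Rightarrow> 'v) \<Rightarrow> ('v \<Rightarrow> 'v \<Rightarrow> real) \<Rightarrow> bool" where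
  "semi_isotropic pr p \<longleftrightarrow>
     (\<forall>x y x' y'. up pr x y = up pr x' y' \<and> up pr y x = up pr y' x' \<longrightarrow> p x y = p x' y')"

definition green :: "('v \<Rightarrow> 'v \<Rightarrow> real) \<Rightarrow> 'v \<Rightarrow> 'v \<Rightarrow> real" where
  "green p x y = (\<Sum>n. mpow p n x y)"

definition martinK :: "('v \<Rightarrow> 'v \<Rightarrow> real) \<Rightarrow> 'v \<Rightarrow> 'v \<Rightarrow> 'v \<Rightarrow> real" where
  "martinK p rt x y = green p x y / green p rt y"

definition moment :: "('v \<Rightarrow> 'v) \<Rightarrow> 'v \<Rightarrow> ('v \<Rightarrow> 'v \<Rightarrow> real) \<Rightarrow> real \<Rightarrow> bool" where
  "moment pr rt p t \<longleftrightarrow> (\<lambda>x. real (tdist pr rt x) powr t * p rt x) summable_on UNIV"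

definition mutilde :: "('v \<Rightarrow> 'v) \<Rightarrow> 'v \<Rightarrow> ('v \<Rightarrow> 'v \<Rightarrow> real) \<Rightarrow> int \<Rightarrow> real" where
  "mutilde pr rt p n = (\<Sum>\<^sub>\<infinity>y\<in>{y. hor pr rt y - hor pr rt rt = n}. p rt y)"

definition drift :: "('v \<Rightarrow> 'v) \<Rightarrow> 'v \<Rightarrow> ('v \<Rightarrow> 'v \<Rightarrow> real) \<Rightarrow> real" where
  "drift pr rt p = (\<Sum>\<^sub>\<infinity>n::int. real_of_int n * mutilde pr rt p n)"

definition phi :: "('v \<Rightarrow> 'v) \<Rightarrow> 'v \<Rightarrow> ('v \<Rightarrow> 'v \<Rightarrow> real) \<Rightarrow> real \<Rightarrow> real" where
  "phi pr rt p c = (\<Sum>\<^sub>\<infinity>m::int. mutilde pr rt p m * exp (c * real_of_int m))"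

definition case_A :: "('v \<Rightarrow> 'v) \<Rightarrow> 'v \<Rightarrow> ('v \<Rightarrow> 'v \<Rightarrow> real) \<Rightarrow> bool" where
  "case_A pr rt p \<longleftrightarrow>
     (moment pr rt p 1 \<and> drift pr rt p > 0) \<or>
     ((\<exists>\<epsilon>>0. moment pr rt p (2 + \<epsilon>)) \<and> drift pr rt p = 0)"

definition case_B :: "('v \<Rightarrow> 'v) \<Rightarrow> 'v \<Rightarrow> ('v \<Rightarrow> 'v \<Rightarrow> real) \<Rightarrow> real \<Rightarrow> bool" where
  "case_B pr rt p c0 \<longleftrightarrow> c0 > 0 \<and> phi pr rt p c0 = 1 \<and>
     (\<lambda>x. real (tdist pr rt x) * p rt x * exp (c0 * real_of_int (hor pr rt x))) summable_on UNIV"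

definition Aff :: "('v \<Rightarrow> 'v) \<Rightarrow> ('v \<Rightarrow> 'v) set" where
  "Aff pr = {g. bij g \<and> (\<forall>x. g (pr x) = pr (g x))}"

text \<open>Borel sets of Aff(T) for the topology of pointwise convergence: generated by the
  cylinder sets {g. g a = b}.\<close>
definition aff_cylinders :: "('v \<Rightarrow> 'v) \<Rightarrow> ('v \<Rightarrow> 'v) set set" where
  "aff_cylinders pr = {{g \<in> Aff pr. g a = b} | a b. True}"

definition haar_measure :: "('v \<Rightarrow> 'v) \<Rightarrow> 'v \<Rightarrow> ('v \<Rightarrow> 'v) measure \<Rightarrow> bool" where
  "haar_measure pr rt m \<longleftrightarrow>
     space m = Aff pr \<and> sets m = sigma_sets (Aff pr) (aff_cylinders pr) \<and>
     (\<forall>g \<in> Aff pr. \<forall>A \<in> sets m. emeasure m ((\<lambda>h. g \<circ> h) ` A) = emeasure m A) \<and>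
     emeasure m {g \<in> Aff pr. g rt = rt} = 1"

text \<open>An end xi different from omega is represented by the unique bi-infinite geodesic
  from omega to xi, parametrised by horocycle index: xi k is the vertex of the geodesic
  in horocycle k.\<close>
definition ends :: "('v \<Rightarrow> 'v) \<Rightarrow> 'v \<Rightarrow> (int \<Rightarrow> 'v) set" where
  "ends pr rt = {\<xi>. \<forall>k. pr (\<xi> (k + 1)) = \<xi> k \<and> hor pr rt (\<xi> k) = k}"

text \<open>Basic (compact open) neighbourhoods in the end topology: boundary part of the cone
  (branch) below a vertex v.\<close>
definition ends_cones :: "('v \<Rightarrow> 'v) \<Rightarrow> 'v \<Rightarrow> (int \<Rightarrow> 'v) set set" where
  "ends_cones pr rt = {{\<xi> \<in> ends pr rt. \<xi> k = v} | k v. True}"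

definition ends_measurable :: "('v \<Rightarrow> 'v) \<Rightarrow> 'v \<Rightarrow> (int \<Rightarrow> 'v) measure \<Rightarrow> bool" where
  "ends_measurable pr rt \<nu> \<longleftrightarrow>
     space \<nu> = ends pr rt \<and> sets \<nu> = sigma_sets (ends pr rt) (ends_cones pr rt)"

definition radon_ends :: "('v \<Rightarrow> 'v) \<Rightarrow> 'v \<Rightarrow> (int \<Rightarrow> 'v) measure \<Rightarrow> bool" where
  "radon_ends pr rt \<nu> \<longleftrightarrow> (\<forall>C \<in> ends_cones pr rt. emeasure \<nu> C < \<infinity>)"

definition end_act :: "('v \<Rightarrow> 'v) \<Rightarrow> 'v \<Rightarrow> ('v \<Rightarrow> 'v) \<Rightarrow> (int \<Rightarrow> 'v) \<Rightarrow> (int \<Rightarrow> 'v)" where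
  "end_act pr rt g \<xi> = (\<lambda>k. g (\<xi> (k - hor pr rt (g rt))))"

definition end_preimage ::
  "('v \<Rightarrow> 'v) \<Rightarrow> 'v \<Rightarrow> ('v \<Rightarrow> 'v) \<Rightarrow> (int \<Rightarrow> 'v) set \<Rightarrow> (int \<Rightarrow> 'v) set" where
  "end_preimage pr rt g E = {\<xi> \<in> ends pr rt. end_act pr rt g \<xi> \<in> E}"

definition conv_ends ::
  "('v \<Rightarrow> 'v) \<Rightarrow> 'v \<Rightarrow> ('v \<Rightarrow> 'v) measure \<Rightarrow> (int \<Rightarrow> 'v) measure \<Rightarrow> (int \<Rightarrow> 'v) set \<Rightarrow> ennreal" where
  "conv_ends pr rt lam \<nu> E = (\<integral>\<^sup>+ g. emeasure \<nu> (end_preimage pr rt g E) \<partial>lam)"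

definition invariant_ends ::
  "('v \<Rightarrow> 'v) \<Rightarrow> 'v \<Rightarrow> ('v \<Rightarrow> 'v) measure \<Rightarrow> (int \<Rightarrow> 'v) measure \<Rightarrow> bool" where
  "invariant_ends pr rt lam \<nu> \<longleftrightarrow> (\<forall>E \<in> sets \<nu>. conv_ends pr rt lam \<nu> E = emeasure \<nu> E)"

definition mu_meas :: "('v \<Rightarrow> 'v \<Rightarrow> real) \<Rightarrow> 'v \<Rightarrow> ('v \<Rightarrow> 'v) measure \<Rightarrow> ('v \<Rightarrow> 'v) measure" where
  "mu_meas p rt m = density m (\<lambda>g. ennreal (p rt (g rt)))"

definition mu_sharp :: "('v \<Rightarrow> 'v) \<Rightarrow> ('v \<Rightarrow> 'v \<Rightarrow> real) \<Rightarrow> 'v \<Rightarrow> real \<Rightarrow> ('v \<Rightarrow> 'v) measure \<Rightarrow> ('v \<Rightarrow> 'v) measure" where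
  "mu_sharp pr p rt c0 m =
     density (mu_meas p rt m) (\<lambda>g. ennreal (exp (c0 * real_of_int (hor pr rt (g rt)))))"

definition continuous_ends :: "('v \<Rightarrow> 'v) \<Rightarrow> 'v \<Rightarrow> ((int \<Rightarrow> 'v) \<Rightarrow> real) \<Rightarrow> bool" where
  "continuous_ends pr rt f \<longleftrightarrow>
     (\<forall>\<xi> \<in> ends pr rt. \<forall>\<epsilon>>0. \<exists>k. \<forall>\<eta> \<in> ends pr rt. \<eta> k = \<xi> k \<longrightarrow> \<bar>f \<eta> - f \<xi>\<bar> < \<epsilon>)"

definition conv_to_end :: "('v \<Rightarrow> 'v) \<Rightarrow> (nat \<Rightarrow> 'v) \<Rightarrow> (int \<Rightarrow> 'v) \<Rightarrow> bool" where
  "conv_to_end pr ys \<xi> \<longleftrightarrow>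
     (\<forall>k. eventually (\<lambda>n. \<exists>j. (pr ^^ j) (ys n) = \<xi> k) sequentially)"

text \<open>Case (A): nu is a nonzero mu-invariant Radon measure, nu_x(E) = nu(g^{-1}E) with g o = x,
  and K(x,.) is a nonnegative continuous version of d nu_x / d nu_o (nu_o = nu).\<close>
definition boundary_kernel_A ::
  "('v \<Rightarrow> 'v) \<Rightarrow> 'v \<Rightarrow> ('v \<Rightarrow> 'v \<Rightarrow> real) \<Rightarrow> ('v \<Rightarrow> 'v) measure \<Rightarrow> (int \<Rightarrow> 'v) measure
   \<Rightarrow> ('v \<Rightarrow> (int \<Rightarrow> 'v) \<Rightarrow> real) \<Rightarrow> bool" where
  "boundary_kernel_A pr rt p m \<nu> K \<longleftrightarrow>
     ends_measurable pr rt \<nu> \<and> radon_ends pr rt \<nu> \<and> emeasure \<nu> (ends pr rt) \<noteq> 0 \<and>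
     invariant_ends pr rt (mu_meas p rt m) \<nu> \<and>
     (\<forall>x. continuous_ends pr rt (K x) \<and> (\<forall>\<xi> \<in> ends pr rt. K x \<xi> \<ge> 0)) \<and>
     (\<forall>g \<in> Aff pr. \<forall>E \<in> sets \<nu>.
        emeasure \<nu> (end_preimage pr rt g E) = (\<integral>\<^sup>+\<xi>\<in>E. ennreal (K (g rt) \<xi>) \<partial>\<nu>))"

text \<open>Case (B): nu is a nonzero finite mu#-invariant measure,
  nu_x(E) = exp(c0 hor x) nu(g^{-1}E) with g o = x.\<close>
definition boundary_kernel_B ::
  "('v \<Rightarrow> 'v) \<Rightarrow> 'v \<Rightarrow> ('v \<Rightarrow> 'v \<Rightarrow> real) \<Rightarrow> real \<Rightarrow> ('v \<Rightarrow> 'v) measure \<Rightarrow> (int \<Rightarrow> 'v) measure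
   \<Rightarrow> ('v \<Rightarrow> (int \<Rightarrow> 'v) \<Rightarrow> real) \<Rightarrow> bool" where
  "boundary_kernel_B pr rt p c0 m \<nu> K \<longleftrightarrow>
     ends_measurable pr rt \<nu> \<and> emeasure \<nu> (ends pr rt) < \<infinity> \<and> emeasure \<nu> (ends pr rt) \<noteq> 0 \<and>
     invariant_ends pr rt (mu_sharp pr p rt c0 m) \<nu> \<and>
     (\<forall>x. continuous_ends pr rt (K x) \<and> (\<forall>\<xi> \<in> ends pr rt. K x \<xi> \<ge> 0)) \<and>
     (\<forall>g \<in> Aff pr. \<forall>E \<in> sets \<nu>.
        ennreal (exp (c0 * real_of_int (hor pr rt (g rt)))) * emeasure \<nu> (end_preimage pr rt g E)
          = (\<integral>\<^sup>+\<xi>\<in>E. ennreal (K (g rt) \<xi>) \<partial>\<nu>))"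

end

theory Submission
  imports Defs "HOL-Library.Diagonal_Subsequence"
begin

text \<open>Fix an end \<open>\<xi>\<close> and its axis, the geodesic from \<open>\<omega>\<close> to \<open>\<xi>\<close>. Reversing the walk with respect to
  the measure \<open>q powi (- hor x)\<close> gives a semi-isotropic walk whose step law is that of \<open>P\<close> with up and down exchanged;
  in case (A), its distance to the axis is a reflected random walk with nonpositive drift, and the
  moment conditions provide a Lyapunov function: the distance itself, or a power of it with exponent
  slightly below 1 when the drift vanishes. Hence the axis is recurrent modulo the shift along it, so
  a function \<open>F\<close> that is superharmonic for \<open>P\<close> and multiplied by \<open>q\<close> under the shift is harmonic.

  The harmonic measures are uniform on small cones, so \<open>K(\<cdot>, \<xi>)\<close> is proportional to such a function
  \<open>u\<close>. The functions \<open>q\<^sup>h G(\<cdot>, \<xi> h)\<close> are dominated by a multiple of \<open>u\<close>. Two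
  harmonic functions dominated by \<open>u\<close> can be compared on the axis alone; a Choquet-Deny argument
  then shows that all their limits as \<open>h\<close> tends to infinity are multiples of \<open>u\<close>. The multiple is not
  zero: the reversed walk leaves the cone below \<open>\<xi> 0\<close> almost surely, and the Lyapunov inequality
  shows that the flux out of this cone is uniformly summable. Case (B) reduces to case (A) with
  positive drift by the change of measure \<open>exp (c\<^sub>0 hor)\<close>.\<close>

section \<open>Nonnegative kernels\<close>

text \<open>The weight \<open>q powi (- hor x)\<close> is forced by the tree: seen from a vertex,
  the points reached by i steps up and j down are q^(j - i) times as many as those reached by j up
  and i down, so counting measure is in general not invariant under P. The obstacle is zero drift,
  where nothing decays at a known rate. Apart from one Taylor estimate, only minimum principles,
  minimality of potentials and limit theorems are used. With the distance itself as
  \<open>V\<close>, reflection at the axis produces a positive overshoot that zero drift cannot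
  absorb. The power 1 - \<beta> gains a multiple of h^(-1-\<beta>) from its second-order term, while
  the moment of order 2 + 2\<beta> pushes the overshoot down to order h^(-1-2\<beta>). The overshoot
  stays a separate term of the Lyapunov inequality because it is used again: summed against the
  invariant measure of the reversed walk modulo the shift, it bounds the flux that keeps the limit
  from vanishing. Values are taken in \<open>ennreal\<close>, so a superharmonic function is split
  additively into its excess and its image, and terms are cancelled only once they are known to be
  finite.\<close>

abbreviation nsum :: "('a \<Rightarrow> ennreal) \<Rightarrow> ennreal" (binder "\<Sum>\<^sup>+" 10) where
  "nsum f \<equiv> integral\<^sup>N (count_space UNIV) f"

definition kop :: "('v \<Rightarrow> 'v \<Rightarrow> ennreal) \<Rightarrow> ('v \<Rightarrow> ennreal) \<Rightarrow> 'v \<Rightarrow> ennreal" where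
  "kop k f x = (\<Sum>\<^sup>+y. k x y * f y)"

text \<open>The Green operator; on the indicator of a point it is the Green function. It may be
  infinite, so transience is a later result and not a precondition.\<close>

definition pot :: "('v \<Rightarrow> 'v \<Rightarrow> ennreal) \<Rightarrow> ('v \<Rightarrow> ennreal) \<Rightarrow> 'v \<Rightarrow> ennreal" where
  "pot k f x = (\<Sum>n. (kop k ^^ n) f x)"

definition irr_kernel :: "('v \<Rightarrow> 'v \<Rightarrow> ennreal) \<Rightarrow> bool" where
  "irr_kernel k \<longleftrightarrow> (\<forall>x y. \<exists>n. (kop k ^^ n) (indicator {y}) x > 0)"

lemma kop_mono: "(\<And>y. f y \<le> g y) \<Longrightarrow> kop k f x \<le> kop k g x"
  unfolding kop_def by (intro nn_integral_mono mult_left_mono) auto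

lemma kop_add: "kop k (\<lambda>y. f y + g y) x = kop k f x + kop k g x"
  unfolding kop_def by (simp add: distrib_left nn_integral_add)

lemma kop_cmult: "kop k (\<lambda>y. c * f y) x = c * kop k f x"
  unfolding kop_def by (simp add: mult.left_commute nn_integral_cmult)

lemma kop_suminf: "kop k (\<lambda>y. \<Sum>n. f n y) x = (\<Sum>n. kop k (f n) x)"
proof -
  have "kop k (\<lambda>y. \<Sum>n. f n y) x = (\<Sum>\<^sup>+y. (\<Sum>n. k x y * f n y))"
    unfolding kop_def by (intro nn_integral_cong ennreal_suminf_cmult[symmetric])
  also have "\<dots> = (\<Sum>n. kop k (f n) x)"
    unfolding kop_def by (intro nn_integral_suminf) simp
  finally show ?thesis .
qed

lemma kop_point_le: "k x y * f y \<le> kop k f x"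
proof -
  have "k x y * f y = (\<Sum>\<^sup>+z. (k x z * f z) * indicator {y} z)" by simp
  also have "\<dots> \<le> kop k f x" unfolding kop_def
    by (intro nn_integral_mono) (auto simp: indicator_def)
  finally show ?thesis .
qed

lemma kpow_mono: "(\<And>y. f y \<le> g y) \<Longrightarrow> (kop k ^^ n) f x \<le> (kop k ^^ n) g x"
proof (induction n arbitrary: x)
  case (Suc n)
  then show ?case by (auto intro: kop_mono)
qed auto

lemma kpow_cmult: "(kop k ^^ n) (\<lambda>y. c * f y) x = c * (kop k ^^ n) f x"
proof (induction n arbitrary: x)
  case (Suc n)
  then have "(kop k ^^ n) (\<lambda>y. c * f y) = (\<lambda>x. c * (kop k ^^ n) f x)" by auto
  then show ?case by (simp add: kop_cmult)
qed auto

lemma kpow_superharmonic: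
  assumes "\<And>x. kop k f x \<le> f x" shows "(kop k ^^ n) f x \<le> f x"
proof (induction n arbitrary: x)
  case (Suc n)
  then have "(kop k ^^ Suc n) f x \<le> kop k f x" by (auto intro: kop_mono)
  then show ?case using assms order.trans by blast
qed auto

lemma kpow_subharmonic:
  assumes "\<And>x. f x \<le> kop k f x" shows "f x \<le> (kop k ^^ n) f x"
proof (induction n arbitrary: x)
  case (Suc n)
  then have "kop k f x \<le> (kop k ^^ Suc n) f x" by (auto intro: kop_mono)
  then show ?case using assms order.trans by blast
qed auto

lemma kpow_add: "(kop k ^^ n) (\<lambda>y. f y + g y) x = (kop k ^^ n) f x + (kop k ^^ n) g x"
proof (induction n arbitrary: x)
  case (Suc n)
  then have "(kop k ^^ n) (\<lambda>y. f y + g y) = (\<lambda>x. (kop k ^^ n) f x + (kop k ^^ n) g x)" by auto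
  then show ?case by (simp add: kop_add)
qed auto

text \<open>Telescoping, with e the excess of f over \<open>kop k f\<close>. The hypothesis is
  additive because subtraction in \<open>ennreal\<close> truncates.\<close>

lemma kpow_decompose:
  assumes "\<And>x. f x = e x + kop k f x"
  shows "f x = (\<Sum>i<n. (kop k ^^ i) e x) + (kop k ^^ n) f x"
proof (induction n arbitrary: x)
  case (Suc n)
  have "f = (\<lambda>x. e x + kop k f x)" using assms by auto
  then have "(kop k ^^ n) f x = (kop k ^^ n) e x + (kop k ^^ Suc n) f x"
    using kpow_add[of n k e "kop k f" x] by (simp add: funpow_swap1)
  then show ?case using Suc[of x] by (simp add: add.assoc)
qed auto

text \<open>Minimality of potentials: iterating the inequality leaves the nonnegative remainder
  \<open>(kop k ^^ n) f\<close>, which is dropped before n grows.\<close>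

lemma pot_le_excessive:
  assumes "\<And>x. e x + kop k f x \<le> f x"
  shows "pot k e x \<le> f x"
proof -
  have "(\<Sum>i<n. (kop k ^^ i) e x) + (kop k ^^ n) f x \<le> f x" for n
  proof (induction n arbitrary: x)
    case (Suc n)
    have "(kop k ^^ n) e x + (kop k ^^ Suc n) f x = (kop k ^^ n) (\<lambda>x. e x + kop k f x) x"
      by (simp add: kpow_add funpow_swap1)
    also have "\<dots> \<le> (kop k ^^ n) f x" using assms by (rule kpow_mono)
    finally have "(\<Sum>i<Suc n. (kop k ^^ i) e x) + (kop k ^^ Suc n) f x
        \<le> (\<Sum>i<n. (kop k ^^ i) e x) + (kop k ^^ n) f x"
      by (simp add: add.assoc add_left_mono)
    also have "\<dots> \<le> f x" by (rule Suc)
    finally show ?case .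
  qed auto
  then have "(\<Sum>i<n. (kop k ^^ i) e x) \<le> f x" for n
    by (meson le_iff_add order.trans)
  then show ?thesis unfolding pot_def by (intro suminf_le_const) auto
qed

lemma kop_pot: "kop k (pot k f) x = (\<Sum>n. (kop k ^^ Suc n) f x)"
proof -
  have "pot k f = (\<lambda>y. \<Sum>n. (kop k ^^ n) f y)" by (auto simp: pot_def)
  then show ?thesis by (simp add: kop_suminf)
qed

lemma pot_unfold: "pot k f x = f x + kop k (pot k f) x"
  unfolding kop_pot unfolding pot_def
  using suminf_offset[of "\<lambda>n. (kop k ^^ n) f x" 1] by simp

lemma pot_cmult: "pot k (\<lambda>y. c * f y) x = c * pot k f x"
  unfolding pot_def by (simp add: kpow_cmult)

lemma kop_le_pot: "kop k (pot k f) x \<le> pot k f x"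
  by (subst pot_unfold[of k f x]) (simp add: add_increasing)

lemma kop_adjoint:
  "(\<Sum>\<^sup>+x. f x * kop k g x) = (\<Sum>\<^sup>+y. g y * kop (\<lambda>y x. k x y) f y)"
proof -
  have "(\<Sum>\<^sup>+x. f x * kop k g x)
     = (\<Sum>\<^sup>+x. \<Sum>\<^sup>+y. f x * (k x y * g y))"
    unfolding kop_def by (simp add: nn_integral_cmult)
  also have "\<dots> = (\<Sum>\<^sup>+y. \<Sum>\<^sup>+x. f x * (k x y * g y))"
    using nn_integral_fst_count_space[of "\<lambda>(x, y). f x * (k x y * g y)"]
      nn_integral_snd_count_space[of "\<lambda>(x, y). f x * (k x y * g y)"] by simp
  also have "\<dots> = (\<Sum>\<^sup>+y. g y * kop (\<lambda>y x. k x y) f y)"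
    unfolding kop_def
    by (intro nn_integral_cong) (subst nn_integral_cmult[symmetric], simp_all add: ac_simps)
  finally show ?thesis .
qed

lemma kpow_adjoint:
  "(\<Sum>\<^sup>+x. f x * (kop k ^^ n) g x)
     = (\<Sum>\<^sup>+y. g y * (kop (\<lambda>y x. k x y) ^^ n) f y)"
proof (induction n arbitrary: f)
  case (Suc n)
  have "(\<Sum>\<^sup>+x. f x * (kop k ^^ Suc n) g x)
      = (\<Sum>\<^sup>+y. (kop k ^^ n) g y * kop (\<lambda>y x. k x y) f y)"
    using kop_adjoint[of f k "(kop k ^^ n) g"] by simp
  also have "\<dots> = (\<Sum>\<^sup>+y. kop (\<lambda>y x. k x y) f y * (kop k ^^ n) g y)"
    by (simp add: mult.commute)
  also have "\<dots> = (\<Sum>\<^sup>+y. g y * (kop (\<lambda>y x. k x y) ^^ n) (kop (\<lambda>y x. k x y) f) y)"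
    by (rule Suc)
  finally show ?case by (simp only: funpow_Suc_right o_def)
qed (simp add: mult.commute)

lemma kpow_transpose:
  "(kop (\<lambda>y x. k x y) ^^ n) (indicator {x}) y = (kop k ^^ n) (indicator {y}) x"
  using kpow_adjoint[of "indicator {x}" n k "indicator {y}"]
  by (simp add: mult.commute[of "indicator _ _ :: ennreal"])

lemma kpow_eq_nn_integral:
  "(kop k ^^ n) f x = (\<Sum>\<^sup>+y. (kop k ^^ n) (indicator {y}) x * f y)"
proof -
  have "(kop k ^^ n) f x = (\<Sum>\<^sup>+y. f y * (kop (\<lambda>y x. k x y) ^^ n) (indicator {x}) y)"
    using kpow_adjoint[of "indicator {x}" n k f] by (simp add: mult.commute[of "indicator _ _ :: ennreal"])
  then show ?thesis by (simp only: kpow_transpose[of n k] mult.commute)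
qed

lemma pot_eq_nn_integral:
  "pot k f x = (\<Sum>\<^sup>+y. pot k (indicator {y}) x * f y)"
proof -
  have "pot k f x = (\<Sum>n. \<Sum>\<^sup>+y. (kop k ^^ n) (indicator {y}) x * f y)"
    unfolding pot_def by (intro suminf_cong kpow_eq_nn_integral)
  also have "\<dots> = (\<Sum>\<^sup>+y. (\<Sum>n. (kop k ^^ n) (indicator {y}) x * f y))"
    by (intro nn_integral_suminf[symmetric]) simp
  also have "\<dots> = (\<Sum>\<^sup>+y. pot k (indicator {y}) x * f y)"
    unfolding pot_def by (intro nn_integral_cong ennreal_suminf_multc)
  finally show ?thesis .
qed

lemma kpow_point_le: "(kop k ^^ n) (indicator {y}) x * f y \<le> (kop k ^^ n) f x"
  using kop_point_le[of "\<lambda>x y. (kop k ^^ n) (indicator {y}) x" x y f]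
  by (subst kpow_eq_nn_integral[of n k f x]) (simp only: kop_def)

lemma kpow_Suc_right: "(kop k ^^ Suc n) f x = (kop k ^^ n) (kop k f) x"
  by (simp add: funpow_swap1)

text \<open>Minimum principle at the value zero: some n-step weight from \<open>x0\<close> to
  \<open>y\<close> is positive, and this weight times \<open>f y\<close> stays below
  \<open>f x0\<close>.\<close>

lemma superharmonic_zero:
  assumes irr: "irr_kernel k" and sup: "\<And>x. kop k f x \<le> f x" and z: "f x0 = 0"
  shows "f y = 0"
proof -
  obtain n where n: "(kop k ^^ n) (indicator {y}) x0 > 0" using irr unfolding irr_kernel_def by blast
  have "(kop k ^^ n) (indicator {y}) x0 * f y \<le> f x0"
    using kpow_point_le[of n k y x0 f] kpow_superharmonic[of k f, OF sup, of n x0] by order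
  then show ?thesis using n z by auto
qed

text \<open>The gap to the maximum is nonnegative, superharmonic and zero at \<open>x0\<close>, so
  the minimum principle applies to it.\<close>

lemma subharmonic_max_constant:
  assumes irr: "irr_kernel k" and one: "\<And>x. kop k (\<lambda>_. 1) x = 1"
    and sub: "\<And>x. f x \<le> kop k f x" and max: "\<And>x. f x \<le> f x0" and fin: "f x0 < \<infinity>"
  shows "f y = f x0"
proof -
  define r where "r x = f x0 - f x" for x
  have fr: "f x0 = f x + r x" for x using max[of x] unfolding r_def by (simp add: add_diff_self_ennreal)
  have "kop k r x \<le> r x" for x
  proof -
    have "f x0 = kop k (\<lambda>y. f x0 * 1) x" by (simp only: kop_cmult one) simp
    also have "\<dots> = kop k (\<lambda>y. f y + r y) x" using fr by simp
    finally have "f x + r x = kop k f x + kop k r x" using fr[of x] by (simp add: kop_add)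
    then have "f x + kop k r x \<le> f x + r x" using sub[of x] by (metis add_right_mono)
    moreover have "f x \<noteq> \<top>" using max[of x] fin by (auto simp: top_unique)
    ultimately show ?thesis by (simp add: ennreal_add_left_cancel_le)
  qed
  moreover have "r x0 = 0" unfolding r_def using fin by simp
  ultimately have "r y = 0" using superharmonic_zero[OF irr] by blast
  then show ?thesis using fr[of y] by simp
qed

lemma kop_dominated_convergence:
  assumes lim: "\<And>x. (\<lambda>n. f n x) \<longlonglongrightarrow> g x" and dom: "\<And>n x. f n x \<le> w x"
    and fin: "kop k w x < \<infinity>" and kfin: "\<And>x y. k x y < \<infinity>"
  shows "(\<lambda>n. kop k (f n) x) \<longlonglongrightarrow> kop k g x"
  unfolding kop_def
proof (rule nn_integral_dominated_convergence[where w = "\<lambda>y. k x y * w y"])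
  show "AE y in count_space UNIV. (\<lambda>n. k x y * f n y) \<longlonglongrightarrow> k x y * g y"
    using lim kfin by (auto intro!: ennreal_tendsto_cmult)
qed (use fin dom in \<open>auto simp: kop_def intro!: AE_I2 mult_left_mono\<close>)

section \<open>The tree with a fixed end\<close>

text \<open>Used on sets of children, which all have q elements, to extend partial automorphisms
  level by level.\<close>

lemma bij_betw_extend:
  assumes "finite A" "finite B" "card A = card B" "C \<subseteq> A" "inj_on f C" "f ` C \<subseteq> B"
  shows "\<exists>g. bij_betw g A B \<and> (\<forall>x\<in>C. g x = f x)"
proof -
  have fC: "finite C" using assms finite_subset by blast
  have "card (A - C) = card (B - f ` C)"
    using assms fC by (simp add: card_Diff_subset card_image)
  then obtain h where h: "bij_betw h (A - C) (B - f ` C)"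
    using finite_same_card_bij assms by (metis finite_Diff)
  define g where "g x = (if x \<in> C then f x else h x)" for x
  have "bij_betw g C (f ` C)" using assms(5) unfolding g_def by (auto simp: bij_betw_def inj_on_def)
  moreover have "bij_betw g (A - C) (B - f ` C)"
    using h by (rule bij_betw_cong[THEN iffD1, rotated]) (auto simp: g_def)
  ultimately have "bij_betw g (C \<union> (A - C)) (f ` C \<union> (B - f ` C))"
    by (rule bij_betw_combine) auto
  then show ?thesis using assms(4,6) by (intro exI[of _ g]) (auto simp: g_def Un_absorb1)
qed

locale end_tree =
  fixes q :: nat and pr :: "'v \<Rightarrow> 'v" and rt :: 'v
  assumes q2: "2 \<le> q" and tr: "tree_with_end q pr"
begin

abbreviation anc :: "nat \<Rightarrow> 'v \<Rightarrow> 'v" where "anc n x \<equiv> (pr ^^ n) x"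
abbreviation ht :: "'v \<Rightarrow> int" where "ht x \<equiv> hor pr rt x"
abbreviation ch :: "'v \<Rightarrow> 'v set" where "ch v \<equiv> {y. pr y = v}"

lemma finite_ch: "finite (ch x)" and card_ch: "card (ch x) = q"
  using tr unfolding tree_with_end_def by auto

lemma acyclic: "n > 0 \<Longrightarrow> anc n x \<noteq> x"
  using tr unfolding tree_with_end_def by auto

lemma connected: "\<exists>m n. anc m x = anc n y"
  using tr unfolding tree_with_end_def by auto

lemma anc_add: "anc (m + n) x = anc m (anc n x)"
  by (simp add: funpow_add)

lemma anc_pr: "anc n (pr x) = pr (anc n x)"
  by (simp add: funpow_swap1)

lemma anc_inj: assumes "anc m x = anc n x" shows "m = n"
proof -
  have *: "m = n" if "anc m x = anc n x" "m \<le> n" for m n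
  proof (rule ccontr)
    assume "m \<noteq> n"
    then have "n - m > 0" using that by simp
    moreover have "anc (n - m) (anc m x) = anc m x"
      using that anc_add[of "n - m" m x] by simp
    ultimately show False using acyclic by blast
  qed
  show ?thesis using *[of m n] *[of n m] assms by (cases "m \<le> n") auto
qed

lemma anc_shift: "anc m x = anc n y \<Longrightarrow> anc (m + k) x = anc (n + k) y"
  by (metis add.commute anc_add)

lemma hor_eqI: assumes "anc m x = anc n rt" shows "ht x = int m - int n"
  unfolding hor_def
proof (rule the_equality)
  show "\<exists>m' n'. anc m' x = anc n' rt \<and> int m - int n = int m' - int n'" using assms by blast
  fix k assume "\<exists>m' n'. anc m' x = anc n' rt \<and> k = int m' - int n'"
  then obtain m' n' where a: "anc m' x = anc n' rt" "k = int m' - int n'" by blast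
  have "anc (m + m') x = anc (n + m') rt" using assms anc_shift by blast
  moreover have "anc (m' + m) x = anc (n' + m) rt" using a anc_shift by blast
  ultimately have "n + m' = n' + m" using anc_inj by (metis add.commute)
  then show "k = int m - int n" using a by simp
qed

lemma hor_root [simp]: "ht rt = 0"
  using hor_eqI[of 0 rt 0] by simp

lemma hor_anc: "ht (anc k x) = ht x - int k"
proof -
  obtain m n where a: "anc m x = anc n rt" using connected by blast
  have "anc m (anc k x) = anc (n + k) rt"
    using anc_shift[OF a, of k] anc_add[of m k x] by (simp add: add.commute)
  then have "ht (anc k x) = int m - int (n + k)" by (rule hor_eqI)
  then show ?thesis using hor_eqI[OF a] by simp
qed

lemma hor_pr: "ht (pr x) = ht x - 1"
  using hor_anc[of 1 x] by simp

lemma anc_eq_hor: "anc m x = anc n y \<Longrightarrow> ht x - int m = ht y - int n"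
  by (metis hor_anc)

lemma up_exists: "\<exists>n. anc (up pr x y) x = anc n y"
  unfolding up_def by (rule LeastI_ex) (rule connected)

lemma up_le: "anc m x = anc n y \<Longrightarrow> up pr x y \<le> m"
  unfolding up_def by (rule Least_le) blast

text \<open>Each number is minimal separately; they belong to one meeting point because the heights
  of x and y tie the two step counts together.\<close>

lemma up_meet: "anc (up pr x y) x = anc (up pr y x) y"
proof -
  obtain n where n: "anc (up pr x y) x = anc n y" using up_exists by blast
  obtain m where m: "anc (up pr y x) y = anc m x" using up_exists by blast
  have "up pr x y \<le> m" using up_le m by metis
  moreover have "up pr y x \<le> n" using up_le n by metis
  moreover have "ht x - int (up pr x y) = ht y - int n" "ht y - int (up pr y x) = ht x - int m"
    using anc_eq_hor n m by blast+
  ultimately have "up pr y x = n" by linarith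
  then show ?thesis using n by simp
qed

lemma hor_up: "ht x - int (up pr x y) = ht y - int (up pr y x)"
  using anc_eq_hor[OF up_meet] .

text \<open>The two up-numbers, which also fix the height difference, determine every coincidence
  between the rays from x and y to \<omega>. This makes them a complete invariant in
  \<open>Aff_two_point_transitive\<close>.\<close>

lemma anc_eq_iff:
  "anc m x = anc n y \<longleftrightarrow> up pr x y \<le> m \<and> up pr y x \<le> n \<and> ht x - int m = ht y - int n"
proof
  assume "anc m x = anc n y"
  then show "up pr x y \<le> m \<and> up pr y x \<le> n \<and> ht x - int m = ht y - int n"
    using up_le anc_eq_hor by metis
next
  assume a: "up pr x y \<le> m \<and> up pr y x \<le> n \<and> ht x - int m = ht y - int n"
  define k where "k = m - up pr x y"
  have "m = up pr x y + k" "n = up pr y x + k"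
    using a hor_up[of x y] unfolding k_def by linarith+
  then show "anc m x = anc n y" using anc_shift[OF up_meet] by metis
qed

lemma up_eqI:
  assumes "anc m x = anc n y" "m = 0 \<or> n = 0 \<or> anc (m - 1) x \<noteq> anc (n - 1) y"
  shows "up pr x y = m" "up pr y x = n"
proof -
  have a: "up pr x y \<le> m \<and> up pr y x \<le> n \<and> ht x - int m = ht y - int n"
    using assms(1) anc_eq_iff by blast
  have "\<not> (up pr x y \<le> m - 1 \<and> up pr y x \<le> n - 1 \<and> m > 0 \<and> n > 0)"
  proof
    assume b: "up pr x y \<le> m - 1 \<and> up pr y x \<le> n - 1 \<and> m > 0 \<and> n > 0"
    then have "ht x - int (m - 1) = ht y - int (n - 1)" using a by auto
    then have "anc (m - 1) x = anc (n - 1) y" using b anc_eq_iff by blast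
    then show False using assms(2) b by auto
  qed
  then show "up pr x y = m" "up pr y x = n" using a hor_up[of x y] by linarith+
qed

lemma up_self [simp]: "up pr x x = 0"
  using up_eqI(1)[of 0 x 0 x] by simp

lemma finite_card_desc: "finite {y. anc n y = x} \<and> card {y. anc n y = x} = q ^ n"
proof (induction n arbitrary: x)
  case (Suc n)
  have eq: "{y. anc (Suc n) y = x} = (\<Union>z\<in>ch x. {y. anc n y = z})" by auto
  have "card (\<Union>z\<in>ch x. {y. anc n y = z}) = (\<Sum>z\<in>ch x. card {y. anc n y = z})"
    by (intro card_UN_disjoint) (use finite_ch Suc in auto)
  also have "\<dots> = q * q ^ n" using Suc by (simp add: card_ch)
  finally show ?case unfolding eq using finite_ch Suc by auto
qed auto

lemma finite_desc: "finite {y. anc n y = x}" and card_desc: "card {y. anc n y = x} = q ^ n"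
  using finite_card_desc by auto

lemma countable_vertices: "countable (UNIV :: 'v set)"
proof -
  have "(UNIV :: 'v set) = (\<Union>m. \<Union>n. {y. anc n y = anc m rt})"
    using connected by fastforce
  moreover have "countable (\<Union>m. \<Union>n. {y. anc n y = anc m rt})"
    by (intro countable_UN countableI_type countable_finite finite_desc)
  ultimately show ?thesis by simp
qed

lemma sphere_eq:
  "{y. up pr x y = i \<and> up pr y x = j} =
    (if i = 0 \<or> j = 0 then {y. anc j y = anc i x}
     else {y. anc j y = anc i x} - {y. anc (j - 1) y = anc (i - 1) x})"
proof (cases "i = 0 \<or> j = 0")
  case True
  then have "up pr x y = i \<and> up pr y x = j \<longleftrightarrow> anc j y = anc i x" for y
    using up_eqI[of i x j y] up_meet[of x y] by auto
  then show ?thesis using True by auto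
next
  case False
  have "up pr x y = i \<and> up pr y x = j \<longleftrightarrow> anc j y = anc i x \<and> anc (j - 1) y \<noteq> anc (i - 1) x" for y
  proof
    assume a: "up pr x y = i \<and> up pr y x = j"
    have "anc (i - 1) x \<noteq> anc (j - 1) y" using up_le[of "i-1" x "j-1" y] a False by linarith
    then show "anc j y = anc i x \<and> anc (j - 1) y \<noteq> anc (i - 1) x" using a up_meet[of x y] by auto
  next
    assume "anc j y = anc i x \<and> anc (j - 1) y \<noteq> anc (i - 1) x"
    then show "up pr x y = i \<and> up pr y x = j" using up_eqI[of i x j y] by auto
  qed
  then show ?thesis using False by auto
qed

lemma finite_sphere: "finite {y. up pr x y = i \<and> up pr y x = j}"
  unfolding sphere_eq using finite_desc by auto

lemma card_sphere:
  "card {y. up pr x y = i \<and> up pr y x = j} = (if i = 0 \<or> j = 0 then q ^ j else q ^ j - q ^ (j - 1))"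
proof (cases "i = 0 \<or> j = 0")
  case False
  have "{y. anc (j - 1) y = anc (i - 1) x} \<subseteq> {y. anc j y = anc i x}"
    using False anc_shift[of "j-1" _ "i-1" x 1] by auto
  then have "card ({y. anc j y = anc i x} - {y. anc (j - 1) y = anc (i - 1) x}) = q ^ j - q ^ (j - 1)"
    using finite_desc card_desc by (simp add: card_Diff_subset)
  then show ?thesis unfolding sphere_eq using False by simp
next
  case True
  then show ?thesis unfolding sphere_eq by (simp add: card_desc)
qed

text \<open>The source of the weight in the reversed kernel: this quotient of orbit sizes is the one
  that defines the modular function of \<open>Aff\<close>.\<close>

lemma card_sphere_swap:
  "real (card {y. up pr x y = i \<and> up pr y x = j}) * real q ^ i
     = real (card {y. up pr z y = j \<and> up pr y z = i}) * real q ^ j"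
proof -
  have "(q ^ j - q ^ (j - 1)) * q ^ i = (q ^ i - q ^ (i - 1)) * q ^ j" if "i \<noteq> 0" "j \<noteq> 0"
    using that by (cases i; cases j) (auto simp: algebra_simps)
  then have "(q ^ j - q ^ (j - 1)) * q ^ i = (q ^ i - q ^ (i - 1)) * q ^ j \<or> i = 0 \<or> j = 0" by blast
  then have "card {y. up pr x y = i \<and> up pr y x = j} * q ^ i
      = card {y. up pr z y = j \<and> up pr y z = i} * q ^ j"
    unfolding card_sphere by auto
  then have "real (card {y. up pr x y = i \<and> up pr y x = j} * q ^ i)
      = real (card {y. up pr z y = j \<and> up pr y z = i} * q ^ j)" by (rule arg_cong)
  then show ?thesis by (simp only: of_nat_mult of_nat_power)
qed

section \<open>Automorphisms fixing the end \<omega>\<close>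

lemma Aff_bij: "g \<in> Aff pr \<Longrightarrow> bij g" and Aff_pr: "g \<in> Aff pr \<Longrightarrow> g (pr x) = pr (g x)"
  unfolding Aff_def by auto

lemma Aff_anc: "g \<in> Aff pr \<Longrightarrow> g (anc n x) = anc n (g x)"
  by (induction n) (auto simp: Aff_pr)

lemma Aff_up: assumes "g \<in> Aff pr" shows "up pr (g x) (g y) = up pr x y"
proof -
  have "anc m (g x) = anc n (g y) \<longleftrightarrow> anc m x = anc n y" for m n
    using assms by (metis Aff_anc Aff_bij bij_pointE)
  then show ?thesis unfolding up_def by simp
qed

lemma Aff_hor: assumes "g \<in> Aff pr" shows "ht (g x) - ht (g y) = ht x - ht y"
  using hor_up[of x y] hor_up[of "g x" "g y"] Aff_up[OF assms] by simp

lemma Aff_hor_root: "g \<in> Aff pr \<Longrightarrow> ht (g x) = ht x + ht (g rt)"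
  using Aff_hor[of g x rt] by simp

lemma Aff_inv: assumes "g \<in> Aff pr" shows "inv g \<in> Aff pr"
proof -
  have b: "bij g" using assms Aff_bij by blast
  have "inv g (pr x) = pr (inv g x)" for x
    using Aff_pr[OF assms, of "inv g x"] b by (metis bij_inv_eq_iff)
  then show ?thesis using bij_imp_bij_inv[OF b] unfolding Aff_def by auto
qed

lemma Aff_comp: "g \<in> Aff pr \<Longrightarrow> h \<in> Aff pr \<Longrightarrow> g \<circ> h \<in> Aff pr"
  unfolding Aff_def by (auto intro: bij_comp)

lemma Aff_id: "id \<in> Aff pr"
  unfolding Aff_def by auto

text \<open>A nonempty set closed under predecessors meets the ray of every vertex, so \<tau> can be
  extended downwards: a vertex outside S goes to a child of the image of its predecessor, by a
  bijection of children that agrees with \<tau> where \<tau> is prescribed.\<close>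

lemma Aff_extend:
  assumes ne: "s \<in> S" and cl: "\<And>x. x \<in> S \<Longrightarrow> pr x \<in> S"
    and com: "\<And>x. x \<in> S \<Longrightarrow> \<tau> (pr x) = pr (\<tau> x)" and inj: "inj_on \<tau> S"
  shows "\<exists>g\<in>Aff pr. \<forall>x\<in>S. g x = \<tau> x"
proof -
  have "\<exists>\<sigma>. bij_betw \<sigma> (ch v) (ch v') \<and> (v \<in> S \<and> v' = \<tau> v \<longrightarrow> (\<forall>x\<in>ch v \<inter> S. \<sigma> x = \<tau> x))" for v v'
  proof (cases "v \<in> S \<and> v' = \<tau> v")
    case True
    have "\<exists>\<sigma>. bij_betw \<sigma> (ch v) (ch v') \<and> (\<forall>x\<in>ch v \<inter> S. \<sigma> x = \<tau> x)"
      by (rule bij_betw_extend)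
        (use finite_ch card_ch True com inj in \<open>auto simp: inj_on_def\<close>)
    then show ?thesis by blast
  next
    case False
    then show ?thesis using finite_same_card_bij[OF finite_ch finite_ch] card_ch by metis
  qed
  then obtain \<sigma> where \<sigma>b: "\<And>v v'. bij_betw (\<sigma> v v') (ch v) (ch v')"
    and \<sigma>S: "\<And>v x. v \<in> S \<Longrightarrow> x \<in> ch v \<inter> S \<Longrightarrow> \<sigma> v (\<tau> v) x = \<tau> x" by metis
  have ancS: "x \<in> S \<Longrightarrow> anc n x \<in> S" for n x by (induction n) (auto simp: cl)
  have ex: "\<exists>n. anc n z \<in> S" for z using connected[of z s] ancS[OF ne] by metis
  define depth where "depth z = (LEAST n. anc n z \<in> S)" for z
  have depth_S: "anc (depth z) z \<in> S" for z unfolding depth_def by (rule LeastI_ex[OF ex])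
  have depth0: "z \<in> S \<Longrightarrow> depth z = 0" for z unfolding depth_def by (intro Least_equality) auto
  have depth_Suc: "depth z = Suc (depth (pr z))" if zS: "z \<notin> S" for z
  proof -
    obtain k where k: "depth z = Suc k" using depth_S[of z] zS by (cases "depth z") auto
    then have "anc k (pr z) \<in> S" using depth_S[of z] by (simp add: anc_pr)
    moreover have "k \<le> n" if "anc n (pr z) \<in> S" for n
    proof -
      have "anc (Suc n) z \<in> S" using that by (simp add: anc_pr)
      then have "depth z \<le> Suc n" unfolding depth_def by (rule Least_le)
      then show ?thesis using k by simp
    qed
    ultimately have "depth (pr z) = k" unfolding depth_def by (intro Least_equality) auto
    then show ?thesis using k by simp
  qed
  \<comment> \<open>Recursion on the number of steps needed to reach S; the value at z is read off
    from the value at \<open>pr z\<close>.\<close>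
  define G where "G = rec_nat \<tau> (\<lambda>n h z. \<sigma> (pr z) (h (pr z)) z)"
  define g where "g z = G (depth z) z" for z
  have gS: "g z = \<tau> z" if "z \<in> S" for z using depth0[OF that] unfolding g_def G_def by simp
  have gstep: "g z = \<sigma> (pr z) (g (pr z)) z" for z
  proof (cases "z \<in> S")
    case True
    then show ?thesis using gS cl \<sigma>S[of "pr z" z] by auto
  next
    case False
    then show ?thesis using depth_Suc[OF False] unfolding g_def G_def by simp
  qed
  have gch: "bij_betw g (ch v) (ch (g v))" for v
    using \<sigma>b[of v "g v"] by (rule bij_betw_cong[THEN iffD1, rotated]) (auto simp: gstep[symmetric])
  have gpr: "g (pr z) = pr (g z)" for z
    using gch[of "pr z"] by (auto dest: bij_betwE)
  have ganc: "g (anc n z) = anc n (g z)" for n z by (induction n) (auto simp: gpr)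
  have inj': "x = y" if "anc m x = anc m y" "g x = g y" for m x y
    using that
  proof (induction m arbitrary: x y)
    case (Suc m)
    have "anc m (pr x) = anc m (pr y)" using Suc.prems(1) by (simp add: anc_pr)
    moreover have "g (pr x) = g (pr y)" using Suc.prems(2) by (simp add: gpr)
    ultimately have "pr x = pr y" by (rule Suc.IH)
    then have "x \<in> ch (pr x)" "y \<in> ch (pr x)" by auto
    then show ?case using bij_betw_imp_inj_on[OF gch] Suc.prems(2) by (metis inj_onD)
  qed simp
  have "inj g"
  proof (rule injI)
    fix x y assume xy: "g x = g y"
    obtain m n where mn: "anc m x = anc n y" using connected by blast
    then have "anc m (g x) = anc n (g x)" using xy ganc by metis
    then have "m = n" using anc_inj by blast
    then show "x = y" using inj' mn xy by blast
  qed
  moreover have surj': "y \<in> range g" if "anc m y \<in> range g" for m y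
    using that
  proof (induction m arbitrary: y)
    case (Suc m)
    have "anc m (pr y) \<in> range g" using Suc.prems by (simp add: anc_pr)
    then have "pr y \<in> range g" by (rule Suc.IH)
    then obtain v where "pr y = g v" by blast
    then have "y \<in> g ` ch v" using gch[of v] unfolding bij_betw_def by auto
    then show ?case by blast
  qed simp
  have "y \<in> range g" for y
  proof -
    obtain m n where "anc m y = anc n (g s)" using connected by blast
    then have "anc m y \<in> range g" by (simp flip: ganc)
    then show ?thesis by (rule surj')
  qed
  then have "surj g" by auto
  ultimately have "g \<in> Aff pr" unfolding Aff_def bij_def using gpr by auto
  then show ?thesis using gS by blast
qed

text \<open>The two rays to \<omega> form a set closed under predecessors. Equal up-numbers mean
  that the rays from x' and y' merge exactly as those from x and y do, so sending ray to ray is well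
  defined and injective.\<close>

lemma Aff_two_point_transitive:
  assumes "up pr x y = up pr x' y'" "up pr y x = up pr y' x'"
  shows "\<exists>g\<in>Aff pr. g x = x' \<and> g y = y'"
proof -
  have eqv: "anc m x = anc n y \<longleftrightarrow> anc m x' = anc n y'" for m n
    using assms anc_eq_iff[of m x n y] anc_eq_iff[of m x' n y'] hor_up[of x y] hor_up[of x' y'] by auto
  define S where "S = range (\<lambda>n. anc n x) \<union> range (\<lambda>n. anc n y)"
  define \<tau> where "\<tau> z = (if z \<in> range (\<lambda>n. anc n x) then anc (THE n. z = anc n x) x'
      else anc (THE n. z = anc n y) y')" for z
  have the: "(THE k. anc n z = anc k z) = n" for n z using anc_inj by blast
  have tx: "\<tau> (anc n x) = anc n x'" for n unfolding \<tau>_def by (auto simp: the)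
  have ty: "\<tau> (anc n y) = anc n y'" for n
  proof (cases "anc n y \<in> range (\<lambda>n. anc n x)")
    case True
    then obtain m where m: "anc n y = anc m x" by blast
    then have "anc n y' = anc m x'" using eqv[of m n] by simp
    then show ?thesis using m tx by simp
  qed (auto simp: \<tau>_def the)
  have "\<exists>g\<in>Aff pr. \<forall>z\<in>S. g z = \<tau> z"
  proof (rule Aff_extend)
    show "x \<in> S" unfolding S_def by (auto intro: range_eqI[of _ _ 0])
    show "pr z \<in> S" if "z \<in> S" for z
    proof -
      have "(\<exists>n. z = anc n x) \<or> (\<exists>n. z = anc n y)" using that unfolding S_def by auto
      then have "(\<exists>n. pr z = anc (Suc n) x) \<or> (\<exists>n. pr z = anc (Suc n) y)" by auto
      then show ?thesis unfolding S_def by blast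
    qed
    show "\<tau> (pr z) = pr (\<tau> z)" if "z \<in> S" for z
    proof -
      have "(\<exists>n. z = anc n x) \<or> (\<exists>n. z = anc n y)" using that unfolding S_def by auto
      moreover have "\<tau> (pr (anc n x)) = pr (\<tau> (anc n x))" for n using tx[of "Suc n"] tx[of n] by simp
      moreover have "\<tau> (pr (anc n y)) = pr (\<tau> (anc n y))" for n using ty[of "Suc n"] ty[of n] by simp
      ultimately show ?thesis by blast
    qed
    show "inj_on \<tau> S"
    proof (rule inj_onI)
      fix z w assume zw: "z \<in> S" "w \<in> S" and e: "\<tau> z = \<tau> w"
      have "(\<exists>n. z = anc n x) \<or> (\<exists>n. z = anc n y)" "(\<exists>n. w = anc n x) \<or> (\<exists>n. w = anc n y)"
        using zw unfolding S_def by auto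
      then consider (xx) m n where "z = anc m x" "w = anc n x" | (xy) m n where "z = anc m x" "w = anc n y"
        | (yx) m n where "z = anc m y" "w = anc n x" | (yy) m n where "z = anc m y" "w = anc n y"
        by blast
      then show "z = w"
      proof cases
        case xx
        then have "anc m x' = anc n x'" using e tx by simp
        then show ?thesis using xx anc_inj by blast
      next
        case xy
        then have "anc m x' = anc n y'" using e tx ty by simp
        then show ?thesis using xy eqv[of m n] by simp
      next
        case yx
        then have "anc n x' = anc m y'" using e tx ty by simp
        then show ?thesis using yx eqv[of n m] by simp
      next
        case yy
        then have "anc m y' = anc n y'" using e ty by simp
        then show ?thesis using yy anc_inj by blast
      qed
    qed
  qed
  then obtain g where g: "g \<in> Aff pr" "\<forall>z\<in>S. g z = \<tau> z" by blast
  have "x \<in> S" "y \<in> S" unfolding S_def by (auto intro: range_eqI[of _ _ 0])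
  then show ?thesis using g tx[of 0] ty[of 0] by auto
qed

lemma Aff_transitive: "\<exists>g\<in>Aff pr. g x = y"
  using Aff_two_point_transitive[of x x y y] by auto

end

section \<open>Semi-isotropic kernels and their reversal\<close>

lemma nonneg_summable_on_iff:
  fixes f :: "'a \<Rightarrow> real"
  assumes "\<And>x. f x \<ge> 0"
  shows "f summable_on A \<longleftrightarrow> (\<integral>\<^sup>+x. ennreal (f x) \<partial>count_space A) < \<infinity>"
proof -
  have "f summable_on A \<longleftrightarrow> Infinite_Set_Sum.abs_summable_on f A"
    unfolding abs_summable_equivalent[symmetric] using assms by simp
  also have "\<dots> \<longleftrightarrow> (\<integral>\<^sup>+x. ennreal (f x) \<partial>count_space A) < \<infinity>"
    unfolding abs_summable_on_def integrable_iff_bounded using assms by simp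
  finally show ?thesis .
qed

lemma ennreal_infsum_eq:
  fixes f :: "'a \<Rightarrow> real"
  assumes "\<And>x. f x \<ge> 0" "f summable_on A"
  shows "ennreal (infsum f A) = (\<integral>\<^sup>+x. ennreal (f x) \<partial>count_space A)"
proof -
  have "Infinite_Set_Sum.abs_summable_on f A"
    unfolding abs_summable_equivalent[symmetric] using assms by simp
  then have "infsum f A = infsetsum f A" "integrable (count_space A) f"
    by (simp_all add: infsetsum_infsum abs_summable_on_def)
  then show ?thesis using assms by (simp add: infsetsum_def nn_integral_eq_integral)
qed

lemma nn_integral_fibers:
  fixes h :: "'a \<Rightarrow> ennreal" and \<phi> :: "'a \<Rightarrow> 'b"
  shows "(\<Sum>\<^sup>+x. h x) =
    (\<Sum>\<^sup>+t. (\<Sum>\<^sup>+x. h x * indicator {x. \<phi> x = t} x))"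
proof -
  have "(\<Sum>\<^sup>+t. (\<Sum>\<^sup>+x. h x * indicator {x. \<phi> x = t} x))
     = (\<Sum>\<^sup>+x. (\<Sum>\<^sup>+t. h x * indicator {x. \<phi> x = t} x))"
    using nn_integral_fst_count_space[of "\<lambda>(x, t). h x * indicator {x. \<phi> x = t} x"]
      nn_integral_snd_count_space[of "\<lambda>(x, t). h x * indicator {x. \<phi> x = t} x"] by simp
  also have "\<dots> = (\<Sum>\<^sup>+x. h x)"
  proof (rule nn_integral_cong)
    fix x
    have "(\<Sum>\<^sup>+t. h x * indicator {x. \<phi> x = t} x)
        = (\<Sum>\<^sup>+t. h x * indicator {\<phi> x} t)"
      by (intro nn_integral_cong) (auto simp: indicator_def)
    then show "(\<Sum>\<^sup>+t. h x * indicator {x. \<phi> x = t} x) = h x" by simp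
  qed
  finally show ?thesis by simp
qed

lemma nn_integral_const_on_finite:
  fixes h :: "'a \<Rightarrow> ennreal"
  assumes "finite A" "\<And>x. x \<in> A \<Longrightarrow> h x = c"
  shows "(\<Sum>\<^sup>+x. h x * indicator A x) = of_nat (card A) * c"
proof -
  have "(\<Sum>\<^sup>+x. h x * indicator A x) = (\<Sum>\<^sup>+x. c * indicator A x)"
    by (intro nn_integral_cong) (use assms in \<open>auto simp: indicator_def\<close>)
  also have "\<dots> = c * of_nat (card A)" using assms(1) by (subst nn_integral_cmult_indicator) auto
  finally show ?thesis by (simp add: mult.commute)
qed

lemma kop_bij_equivariant:
  assumes "bij g" "\<And>x y. k (g x) (g y) = k x y"
  shows "kop k f (g x) = kop k (\<lambda>y. f (g y)) x"
proof -
  have "kop k f (g x) = (\<Sum>\<^sup>+y. k (g x) (g y) * f (g y))"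
    unfolding kop_def using nn_integral_bij_count_space[of g UNIV UNIV "\<lambda>y. k (g x) y * f y"] assms(1)
    by simp
  then show ?thesis unfolding kop_def assms(2) .
qed

lemma kpow_bij_equivariant:
  assumes "bij g" "\<And>x y. k (g x) (g y) = k x y"
  shows "(kop k ^^ n) f (g x) = (kop k ^^ n) (\<lambda>y. f (g y)) x"
proof (induction n arbitrary: x)
  case (Suc n)
  then have "(\<lambda>y. (kop k ^^ n) f (g y)) = (kop k ^^ n) (\<lambda>y. f (g y))" by auto
  then show ?case using kop_bij_equivariant[of g k "(kop k ^^ n) f" x] assms by simp
qed simp

lemma pot_bij_equivariant:
  assumes "bij g" "\<And>x y. k (g x) (g y) = k x y"
  shows "pot k f (g x) = pot k (\<lambda>y. f (g y)) x"
  unfolding pot_def using kpow_bij_equivariant[of g k] assms by simp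

lemma pot_indicator_equivariant:
  assumes "bij g" "\<And>x y. k (g x) (g y) = k x y"
  shows "pot k (indicator {g y}) (g x) = pot k (indicator {y}) x"
proof -
  have "(\<lambda>z. indicator {g y} (g z) :: ennreal) = indicator {y}"
    using assms(1) by (auto simp: indicator_def bij_def inj_eq fun_eq_iff)
  then show ?thesis using pot_bij_equivariant[of g k "indicator {g y}" x] assms by simp
qed

section \<open>The reversed kernel and the law of its steps\<close>

locale walk = end_tree q pr rt for q :: nat and pr :: "'v \<Rightarrow> 'v" and rt :: 'v +
  fixes p :: "'v \<Rightarrow> 'v \<Rightarrow> real"
  assumes stoch: "stochastic p" and irred: "irreducible_tm p" and semi: "semi_isotropic pr p"
begin

definition Q :: "int \<Rightarrow> ennreal" where "Q k = ennreal (real q powi k)"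

abbreviation kp :: "'v \<Rightarrow> 'v \<Rightarrow> ennreal" where "kp x y \<equiv> ennreal (p x y)"

text \<open>The first argument is the start of the reversed step, hence the transposed
  \<open>kp\<close>.\<close>

definition kh :: "'v \<Rightarrow> 'v \<Rightarrow> ennreal" where "kh y x = Q (ht y - ht x) * kp x y"

lemma q_pos: "real q > 0" using q2 by simp

lemma Q_0 [simp]: "Q 0 = 1" by (simp add: Q_def)

lemma Q_add: "Q (a + b) = Q a * Q b"
  using q_pos by (simp add: Q_def power_int_add ennreal_mult)

lemma Q_pos [simp]: "Q k > 0" using q_pos by (simp add: Q_def)

lemma Q_neq0 [simp]: "Q k \<noteq> 0" using Q_pos[of k] by (metis less_irrefl)

lemma Q_less_top [simp]: "Q k < \<top>" by (simp add: Q_def)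

lemma Q_neq_top [simp]: "Q k \<noteq> \<top>" by (simp add: Q_def)

lemma Q_cancel [simp]: "Q k * Q (- k) = 1" "Q (- k) * Q k = 1"
  using Q_add[of k "- k"] Q_add[of "- k" k] by auto

lemma Q_cancel' [simp]: "Q k * (Q (- k) * a) = a" "Q (- k) * (Q k * a) = a"
  by (simp_all flip: mult.assoc)

lemma p_nonneg: "p x y \<ge> 0" using stoch unfolding stochastic_def by blast

lemma kp_sum1: "kop kp (\<lambda>_. 1) x = 1"
proof -
  have "p x summable_on UNIV" "(\<Sum>\<^sub>\<infinity>y. p x y) = 1" using stoch unfolding stochastic_def by auto
  then show ?thesis using ennreal_infsum_eq[of "p x" UNIV] p_nonneg by (simp add: kop_def)
qed

lemma mpow_kop: "mpow p n x y \<ge> 0 \<and> ennreal (mpow p n x y) = (kop kp ^^ n) (indicator {y}) x"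
proof (induction n arbitrary: x)
  case 0
  show ?case by simp
next
  case (Suc n)
  have le1: "(kop kp ^^ n) (indicator {y}) z \<le> 1" for z
  proof -
    have "(kop kp ^^ n) (indicator {y}) z \<le> (kop kp ^^ n) (\<lambda>_. 1) z"
      by (intro kpow_mono) (auto simp: indicator_def)
    also have "\<dots> \<le> 1" by (intro kpow_superharmonic) (simp add: kp_sum1)
    finally show ?thesis .
  qed
  have eq: "(\<Sum>\<^sup>+z. ennreal (p x z * mpow p n z y)) = (kop kp ^^ Suc n) (indicator {y}) x"
  proof -
    have "(\<Sum>\<^sup>+z. ennreal (p x z * mpow p n z y))
        = (\<Sum>\<^sup>+z. kp x z * (kop kp ^^ n) (indicator {y}) z)"
      using Suc by (simp add: ennreal_mult p_nonneg)
    then show ?thesis by (simp add: kop_def[of kp "(kop kp ^^ n) (indicator {y})"])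
  qed
  have "(kop kp ^^ Suc n) (indicator {y}) x \<le> kop kp (\<lambda>_. 1) x"
    using le1 by (auto intro!: kop_mono)
  then have fin: "(\<Sum>\<^sup>+z. ennreal (p x z * mpow p n z y)) < \<infinity>"
    unfolding eq kp_sum1 by (simp add: order_le_less_trans)
  have nn: "0 \<le> p x z * mpow p n z y" for z using Suc p_nonneg by simp
  have "(\<lambda>z. p x z * mpow p n z y) summable_on UNIV"
    using nonneg_summable_on_iff[of "\<lambda>z. p x z * mpow p n z y", OF nn] fin by blast
  then show ?case using ennreal_infsum_eq[of "\<lambda>z. p x z * mpow p n z y", OF nn] eq
    by (simp add: infsum_nonneg nn)
qed

lemma kp_irr: "irr_kernel kp"
  unfolding irr_kernel_def
proof (intro allI)
  fix x y
  obtain n where "mpow p n x y > 0" using irred unfolding irreducible_tm_def by blast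
  then have "(kop kp ^^ n) (indicator {y}) x > 0" using mpow_kop[of n x y] by (metis ennreal_less_zero_iff)
  then show "\<exists>n. (kop kp ^^ n) (indicator {y}) x > 0" by blast
qed

lemma pot_kp_mpow: "pot kp (indicator {y}) x = (\<Sum>n. ennreal (mpow p n x y))"
  unfolding pot_def using mpow_kop by simp

lemma ennreal_green:
  assumes "pot kp (indicator {y}) x < \<top>"
  shows "ennreal (green p x y) = pot kp (indicator {y}) x" "green p x y \<ge> 0"
proof -
  have s: "summable (\<lambda>n. mpow p n x y)"
    using assms mpow_kop unfolding pot_kp_mpow by (intro summable_suminf_not_top) auto
  show "ennreal (green p x y) = pot kp (indicator {y}) x"
    unfolding green_def pot_kp_mpow using s mpow_kop by (intro suminf_ennreal2[symmetric]) auto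
  show "green p x y \<ge> 0" unfolding green_def using s mpow_kop by (intro suminf_nonneg) auto
qed

lemma p_Aff: "g \<in> Aff pr \<Longrightarrow> p (g x) (g y) = p x y"
  using semi Aff_up unfolding semi_isotropic_def by blast

lemma kp_Aff: "g \<in> Aff pr \<Longrightarrow> kp (g x) (g y) = kp x y"
  by (simp add: p_Aff)

lemma kh_Aff: "g \<in> Aff pr \<Longrightarrow> kh (g x) (g y) = kh x y"
  using Aff_hor[of g x y] unfolding kh_def by (simp add: p_Aff)

lemma kh_less_top: "kh x y < \<infinity>"
  unfolding kh_def by (simp add: ennreal_mult_less_top)

lemma kh_weighted: "kop kh f y = Q (ht y) * kop (\<lambda>y x. kp x y) (\<lambda>x. Q (- ht x) * f x) y"
  unfolding kop_def kh_def diff_conv_add_uminus Q_add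
  by (subst nn_integral_cmult[symmetric]) (simp_all add: ac_simps)

lemma kh_pow_weighted:
  "(kop kh ^^ n) f y = Q (ht y) * (kop (\<lambda>y x. kp x y) ^^ n) (\<lambda>x. Q (- ht x) * f x) y"
proof (induction n arbitrary: y)
  case (Suc n)
  have "(\<lambda>x. Q (- ht x) * (kop kh ^^ n) f x) = (kop (\<lambda>y x. kp x y) ^^ n) (\<lambda>x. Q (- ht x) * f x)"
    unfolding Suc by simp
  then show ?case using kh_weighted[of "(kop kh ^^ n) f" y] by simp
qed simp

lemma kh_pow: "(kop kh ^^ n) (indicator {x}) y = Q (ht y - ht x) * (kop kp ^^ n) (indicator {y}) x"
proof -
  have "(\<lambda>z. Q (- ht z) * indicator {x} z) = (\<lambda>z. Q (- ht x) * indicator {x} z)"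
    by (auto simp: indicator_def)
  then show ?thesis unfolding kh_pow_weighted kpow_cmult[of n _ "Q _"] kpow_transpose[of n kp]
    diff_conv_add_uminus Q_add
    by (simp only: kpow_cmult[of n _ "Q _"] kpow_transpose[of n kp] mult.assoc)
qed

text \<open>The link between the two walks: axis recurrence and exit flux are statements about the
  reversed walk, and they reach the Green function of P through this identity.\<close>

lemma kh_pot: "pot kh (indicator {x}) y = Q (ht y - ht x) * pot kp (indicator {y}) x"
  unfolding pot_def kh_pow by simp

lemma kh_irr: "irr_kernel kh"
  using kp_irr unfolding irr_kernel_def kh_pow by (simp add: ennreal_zero_less_mult_iff)

text \<open>By semi-isotropy both sums group by the pair of up-numbers, and the weight in
  \<open>kh\<close> together with \<open>card_sphere_swap\<close> matches class (i, j) at z with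
  class (j, i) at the root. So a reversed step climbs as much as a step of P descends.\<close>

lemma kh_step_law:
  "(\<Sum>\<^sup>+x. kh z x * F (up pr z x) (up pr x z))
     = (\<Sum>\<^sup>+x. kp rt x * F (up pr x rt) (up pr rt x))"
proof -
  \<comment> \<open>The value of p on a class of pairs; semi-isotropy makes the choice by
    \<open>SOME\<close> immaterial.\<close>
  define c where "c i j = (SOME r. \<exists>x y. up pr x y = i \<and> up pr y x = j \<and> p x y = r)" for i j
  have pc: "p x y = c (up pr x y) (up pr y x)" for x y
  proof -
    have "\<exists>x' y'. up pr x' y' = up pr x y \<and> up pr y' x' = up pr y x
        \<and> p x' y' = c (up pr x y) (up pr y x)"
      unfolding c_def by (rule someI_ex) blast
    then show ?thesis using semi unfolding semi_isotropic_def by metis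
  qed
  have eq: "(\<Sum>\<^sup>+x. kh z x * F (up pr z x) (up pr x z) * indicator {x. (up pr z x, up pr x z) = t} x)
      = (\<Sum>\<^sup>+x. kp rt x * F (up pr x rt) (up pr rt x) * indicator {x. (up pr x rt, up pr rt x) = t} x)"
    for t
  proof -
    obtain i j where t: "t = (i, j)" by (cases t)
    have s1: "{x. (up pr z x, up pr x z) = t} = {x. up pr z x = i \<and> up pr x z = j}"
      and s2: "{x. (up pr x rt, up pr rt x) = t} = {x. up pr rt x = j \<and> up pr x rt = i}" using t by auto
    have "ht z - ht x = int i - int j" if "up pr z x = i" "up pr x z = j" for x
      using hor_up[of z x] that by simp
    then have l: "(\<Sum>\<^sup>+x. kh z x * F (up pr z x) (up pr x z) * indicator {x. (up pr z x, up pr x z) = t} x)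
       = of_nat (card {x. up pr z x = i \<and> up pr x z = j}) * (Q (int i - int j) * ennreal (c j i) * F i j)"
      unfolding s1 by (intro nn_integral_const_on_finite finite_sphere) (auto simp: kh_def pc)
    have r: "(\<Sum>\<^sup>+x. kp rt x * F (up pr x rt) (up pr rt x) * indicator {x. (up pr x rt, up pr rt x) = t} x)
       = of_nat (card {x. up pr rt x = j \<and> up pr x rt = i}) * (ennreal (c j i) * F i j)"
      unfolding s2 by (intro nn_integral_const_on_finite finite_sphere) (auto simp: pc)
    have "real (card {x. up pr z x = i \<and> up pr x z = j}) * real q powi (int i - int j)
        = real (card {x. up pr rt x = j \<and> up pr x rt = i})"
      using card_sphere_swap[of z i j rt] q_pos by (simp add: power_int_diff field_simps)
    then have "of_nat (card {x. up pr z x = i \<and> up pr x z = j}) * Q (int i - int j)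
        = of_nat (card {x. up pr rt x = j \<and> up pr x rt = i})"
      unfolding Q_def ennreal_of_nat_eq_real_of_nat by (simp flip: ennreal_mult'')
    then have "of_nat (card {x. up pr z x = i \<and> up pr x z = j}) * Q (int i - int j) * (ennreal (c j i) * F i j)
        = of_nat (card {x. up pr rt x = j \<and> up pr x rt = i}) * (ennreal (c j i) * F i j)" by (rule arg_cong)
    then show ?thesis unfolding l r by (simp only: mult.assoc)
  qed
  have "(\<Sum>\<^sup>+x. kh z x * F (up pr z x) (up pr x z))
      = (\<Sum>\<^sup>+t. (\<Sum>\<^sup>+x. kh z x * F (up pr z x) (up pr x z) * indicator {x. (up pr z x, up pr x z) = t} x))"
    by (rule nn_integral_fibers)
  also have "\<dots> = (\<Sum>\<^sup>+t. (\<Sum>\<^sup>+x. kp rt x * F (up pr x rt) (up pr rt x) * indicator {x. (up pr x rt, up pr rt x) = t} x))"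
    by (intro nn_integral_cong eq)
  also have "\<dots> = (\<Sum>\<^sup>+x. kp rt x * F (up pr x rt) (up pr rt x))"
    by (rule nn_integral_fibers[symmetric])
  finally show ?thesis .
qed

lemma kh_sum1: "kop kh (\<lambda>_. 1) x = 1"
  using kh_step_law[of x "\<lambda>_ _. 1"] kp_sum1[of rt] by (simp add: kop_def)

end

section \<open>The geodesic from the fixed end to a boundary point\<close>

lemma nn_integral_inj_range:
  assumes "inj \<phi>"
  shows "(\<Sum>\<^sup>+y. f y * indicator (range \<phi>) y) = (\<Sum>\<^sup>+k. f (\<phi> k))"
proof -
  have "(\<Sum>\<^sup>+y. f y * indicator (range \<phi>) y) = (\<integral>\<^sup>+y. f y \<partial>count_space (range \<phi>))"
    by (simp add: nn_integral_count_space_indicator)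
  also have "\<dots> = (\<Sum>\<^sup>+k. f (\<phi> k))"
    using nn_integral_bij_count_space[of \<phi> UNIV "range \<phi>" f] assms by (simp add: bij_betw_def)
  finally show ?thesis .
qed

locale walk_axis = walk q pr rt p for q :: nat and pr :: "'v \<Rightarrow> 'v" and rt :: 'v and p :: "'v \<Rightarrow> 'v \<Rightarrow> real" +
  fixes \<xi> :: "int \<Rightarrow> 'v"
  assumes xi: "\<xi> \<in> ends pr rt"
begin

lemma xi_pr: "pr (\<xi> k) = \<xi> (k - 1)"
  using xi unfolding ends_def by (metis (mono_tags, lifting) diff_add_cancel mem_Collect_eq)

lemma xi_ht [simp]: "ht (\<xi> k) = k"
  using xi unfolding ends_def by auto

lemma xi_anc: "anc n (\<xi> k) = \<xi> (k - int n)"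
  by (induction n) (auto simp: xi_pr algebra_simps)

lemma xi_inj: "inj \<xi>"
  by (metis injI xi_ht)

lemma anc_in_axis: "\<exists>n. anc n x \<in> range \<xi>"
  using connected[of x "\<xi> 0"] xi_anc by (metis rangeI)

text \<open>The distance from x to the axis; the next definition is the height of the foot of x on
  the axis.\<close>

definition ax :: "'v \<Rightarrow> nat" where "ax x = (LEAST n. anc n x \<in> range \<xi>)"
definition cx :: "'v \<Rightarrow> int" where "cx x = ht x - int (ax x)"
definition cone0 :: "'v set" where "cone0 = {x. \<exists>n. anc n x = \<xi> 0}"

lemma axis_anc_eq: "anc n x \<in> range \<xi> \<Longrightarrow> anc n x = \<xi> (ht x - int n)"
  using hor_anc[of n x] by (metis rangeE xi_ht)

lemma anc_ax: "anc (ax x) x = \<xi> (cx x)"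
  unfolding cx_def using LeastI_ex[OF anc_in_axis[of x]] axis_anc_eq unfolding ax_def by blast

lemma ax_le: "anc n x \<in> range \<xi> \<Longrightarrow> ax x \<le> n"
  unfolding ax_def by (rule Least_le)

lemma ax_xi [simp]: "ax (\<xi> k) = 0"
  using ax_le[of 0 "\<xi> k"] by simp

lemma cx_xi [simp]: "cx (\<xi> k) = k"
  by (simp add: cx_def)

lemma anc_ge_ax: "ax x \<le> n \<Longrightarrow> anc n x = \<xi> (ht x - int n)"
proof -
  assume "ax x \<le> n"
  then have "anc n x = anc (n - ax x) (\<xi> (cx x))" using anc_add[of "n - ax x" "ax x" x] anc_ax by simp
  then show ?thesis using \<open>ax x \<le> n\<close> by (simp add: xi_anc cx_def algebra_simps)
qed

lemma cone0_iff: "x \<in> cone0 \<longleftrightarrow> 0 \<le> cx x"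
proof
  assume "x \<in> cone0"
  then obtain n where n: "anc n x = \<xi> 0" unfolding cone0_def by blast
  then have "ax x \<le> n" "ht x - int n = 0" using ax_le hor_anc[of n x] by auto
  then show "0 \<le> cx x" unfolding cx_def by simp
next
  assume "0 \<le> cx x"
  then have "anc (nat (ht x)) x = \<xi> (ht x - int (nat (ht x)))" unfolding cx_def by (intro anc_ge_ax) auto
  then show "x \<in> cone0" unfolding cone0_def using \<open>0 \<le> cx x\<close> unfolding cx_def by auto
qed

lemma cone0_anc: "x \<in> cone0 \<longleftrightarrow> (0 \<le> ht x \<and> anc (nat (ht x)) x = \<xi> 0)"
proof
  assume "x \<in> cone0"
  then obtain n where n: "anc n x = \<xi> 0" unfolding cone0_def by blast
  then have "ht x = int n" using hor_anc[of n x] by simp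
  then show "0 \<le> ht x \<and> anc (nat (ht x)) x = \<xi> 0" using n by simp
qed (auto simp: cone0_def)

text \<open>Reflection at the axis: climbing beyond the foot adds no distance, which is the
  truncated subtraction. Equality can fail because the descent may follow the axis.\<close>

lemma ax_step: "ax x \<le> (ax z - up pr z x) + up pr x z"
proof (cases "up pr z x \<le> ax z")
  case True
  have "anc ((ax z - up pr z x) + up pr x z) x = anc (ax z - up pr z x) (anc (up pr z x) z)"
    by (simp add: anc_add up_meet[of x z])
  also have "\<dots> = \<xi> (cx z)" using True anc_ax by (simp flip: anc_add)
  finally show ?thesis by (intro ax_le) auto
next
  case False
  then have "anc (up pr x z) x \<in> range \<xi>" using anc_ge_ax[of z "up pr z x"] up_meet[of x z] by auto
  then show ?thesis using ax_le[of "up pr x z" x] by simp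
qed

lemma cone0_leave:
  assumes "z \<in> cone0" "x \<notin> cone0" shows "ht z < int (up pr z x)"
proof (rule ccontr)
  assume n: "\<not> ht z < int (up pr z x)"
  define d where "d = nat (ht z) - up pr z x"
  have z: "0 \<le> ht z" "anc (nat (ht z)) z = \<xi> 0" using assms(1) cone0_anc by auto
  have "anc (d + up pr x z) x = anc d (anc (up pr z x) z)" by (simp add: anc_add up_meet[of x z])
  also have "\<dots> = anc (nat (ht z)) z" using n z unfolding d_def by (simp flip: anc_add)
  finally show False using assms z unfolding cone0_def by auto
qed

lemma finite_axis_slice: "finite {x. cx x = k \<and> ax x \<le> n}"
proof -
  have "{x. cx x = k \<and> ax x \<le> n} \<subseteq> (\<Union>i\<in>{..n}. {x. anc i x = \<xi> k})"
    using anc_ax by fastforce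
  then show ?thesis by (rule finite_subset) (auto intro: finite_desc)
qed

lemma finite_cone_slice: "finite {x \<in> cone0. ht x \<le> int n}"
proof -
  have "{x \<in> cone0. ht x \<le> int n} \<subseteq> (\<Union>i\<in>{..n}. {x. anc i x = \<xi> 0})"
    using cone0_anc by (auto intro!: bexI[of _ "nat (ht _)"])
  then show ?thesis by (rule finite_subset) (auto intro: finite_desc)
qed

section \<open>Translations along the axis\<close>

definition shift1 :: "'v \<Rightarrow> 'v" where
  "shift1 = (SOME g. g \<in> Aff pr \<and> (\<forall>k. g (\<xi> k) = \<xi> (k + 1)))"

text \<open>Integer powers of one automorphism instead of a separate choice for each k, so that
  \<open>shift_add\<close> makes this a group action.\<close>

definition shift :: "int \<Rightarrow> 'v \<Rightarrow> 'v" where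
  "shift k = (if 0 \<le> k then shift1 ^^ nat k else inv shift1 ^^ nat (- k))"

lemma shift1: "shift1 \<in> Aff pr" "shift1 (\<xi> k) = \<xi> (k + 1)"
proof -
  have "\<exists>g\<in>Aff pr. \<forall>x\<in>range \<xi>. g x = \<xi> (ht x + 1)"
  proof (rule Aff_extend)
    show "inj_on (\<lambda>x. \<xi> (ht x + 1)) (range \<xi>)"
      by (rule inj_onI) (metis add_right_cancel rangeE xi_ht)
  qed (auto simp: xi_pr)
  then obtain g where "g \<in> Aff pr \<and> (\<forall>k. g (\<xi> k) = \<xi> (k + 1))" by auto
  then have "shift1 \<in> Aff pr \<and> (\<forall>k. shift1 (\<xi> k) = \<xi> (k + 1))" unfolding shift1_def
    by (rule someI[of "\<lambda>g. g \<in> Aff pr \<and> (\<forall>k. g (\<xi> k) = \<xi> (k + 1))"])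
  then show "shift1 \<in> Aff pr" "shift1 (\<xi> k) = \<xi> (k + 1)" by auto
qed

lemma shift_0 [simp]: "shift 0 x = x" by (simp add: shift_def)

lemma shift_Suc: "shift (k + 1) x = shift1 (shift k x)"
proof (cases "0 \<le> k")
  case True
  then have "nat (k + 1) = Suc (nat k)" by simp
  then show ?thesis using True by (simp add: shift_def)
next
  case False
  then have e: "nat (- k) = Suc (nat (- (k + 1)))" by simp
  have "shift1 (inv shift1 y) = y" for y
    using shift1(1) Aff_bij by (metis bij_inv_eq_iff)
  then have "shift1 (shift k x) = (inv shift1 ^^ nat (- (k + 1))) x"
    using False by (simp add: shift_def e del: nat_minus_as_int)
  then show ?thesis using False by (cases "k = -1") (auto simp: shift_def)
qed

lemma shift_add: "shift (k + l) x = shift k (shift l x)"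
proof (induction k rule: int_induct[where k = 0])
  case (step1 i)
  then show ?case using shift_Suc[of "i + l" x] shift_Suc[of i "shift l x"] by (simp add: algebra_simps)
next
  case (step2 i)
  have "shift1 (shift (i - 1 + l) x) = shift1 (shift (i - 1) (shift l x))"
    using step2 shift_Suc[of "i - 1 + l" x] shift_Suc[of "i - 1" "shift l x"] by (simp add: algebra_simps)
  then show ?case using shift1(1) Aff_bij by (metis bij_pointE)
qed simp

lemma shift_Aff: "shift k \<in> Aff pr"
proof -
  have *: "g ^^ n \<in> Aff pr" if "g \<in> Aff pr" for g n
    using that by (induction n) (auto simp: Aff_id Aff_comp simp flip: id_def)
  show ?thesis unfolding shift_def using *[OF shift1(1)] *[OF Aff_inv[OF shift1(1)]] by auto
qed

lemma shift_xi [simp]: "shift k (\<xi> i) = \<xi> (i + k)"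
proof (induction k rule: int_induct[where k = 0])
  case (step1 j)
  then show ?case by (simp only: shift_Suc shift1 add.assoc)
next
  case (step2 j)
  have "shift1 (shift (j - 1) (\<xi> i)) = shift1 (\<xi> (i + (j - 1)))"
    using step2 shift_Suc[of "j - 1" "\<xi> i"] by (simp add: shift1 algebra_simps)
  then show ?case using shift1(1) Aff_bij by (metis bij_pointE)
qed simp

lemma shift_cancel [simp]: "shift k (shift (- k) x) = x" "shift (- k) (shift k x) = x"
  by (simp_all flip: shift_add)

lemma shift_bij: "bij (shift k)" by (rule Aff_bij[OF shift_Aff])

lemma shift_ht [simp]: "ht (shift k x) = ht x + k"
  using Aff_hor[OF shift_Aff, of k x "\<xi> 0"] by simp

lemma shift_in_axis: "shift k x \<in> range \<xi> \<longleftrightarrow> x \<in> range \<xi>"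
proof
  assume "shift k x \<in> range \<xi>"
  then obtain i where "shift k x = \<xi> i" by auto
  then have "x = \<xi> (i + - k)" using shift_cancel(2)[of k x] shift_xi[of "- k" i] by simp
  then show "x \<in> range \<xi>" by simp
qed auto

lemma shift_ax [simp]: "ax (shift k x) = ax x"
proof -
  have "anc n (shift k x) \<in> range \<xi> \<longleftrightarrow> anc n x \<in> range \<xi>" for n
    using shift_in_axis[of k "anc n x"] by (simp only: Aff_anc[OF shift_Aff])
  then show ?thesis unfolding ax_def by simp
qed

lemma shift_cx [simp]: "cx (shift k x) = cx x + k"
  unfolding cx_def by simp

lemma kop_kp_shift: "kop kp f (shift k x) = kop kp (\<lambda>y. f (shift k y)) x"
  by (rule kop_bij_equivariant[OF shift_bij]) (rule kp_Aff[OF shift_Aff])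

lemma kpow_kp_shift: "(kop kp ^^ n) f (shift k x) = (kop kp ^^ n) (\<lambda>y. f (shift k y)) x"
  by (rule kpow_bij_equivariant[OF shift_bij]) (rule kp_Aff[OF shift_Aff])

lemma pot_kp_shift: "pot kp (indicator {shift k y}) (shift k x) = pot kp (indicator {y}) x"
  by (rule pot_indicator_equivariant[OF shift_bij]) (rule kp_Aff[OF shift_Aff])

lemma pot_kh_shift: "pot kh f (shift k x) = pot kh (\<lambda>y. f (shift k y)) x"
  by (rule pot_bij_equivariant[OF shift_bij]) (rule kh_Aff[OF shift_Aff])

text \<open>Reversal and translation turn the expected number of visits of the reversed walk to the
  whole axis into a weighted Green sum of P. Recurrence of the axis is exploited in this
  form.\<close>

lemma axis_green_sum:
  "pot kh (indicator (range \<xi>)) (\<xi> 0) = (\<Sum>\<^sup>+k. Q k * pot kp (indicator {\<xi> k}) (\<xi> 0))"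
proof -
  have "pot kh (indicator (range \<xi>)) (\<xi> 0) = (\<Sum>\<^sup>+k. pot kh (indicator {\<xi> k}) (\<xi> 0))"
    by (subst pot_eq_nn_integral) (rule nn_integral_inj_range[OF xi_inj])
  also have "\<dots> = (\<Sum>\<^sup>+k. Q (- k) * pot kp (indicator {\<xi> (- k)}) (\<xi> 0))"
  proof (rule nn_integral_cong)
    fix k
    show "pot kh (indicator {\<xi> k}) (\<xi> 0) = Q (- k) * pot kp (indicator {\<xi> (- k)}) (\<xi> 0)"
      unfolding kh_pot using pot_kp_shift[of k "\<xi> (-k)" "\<xi> 0"] by simp
  qed
  also have "\<dots> = (\<Sum>\<^sup>+k. Q k * pot kp (indicator {\<xi> k}) (\<xi> 0))"
  proof -
    have "bij_betw (uminus :: int \<Rightarrow> int) UNIV UNIV" by (rule bij_uminus)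
    then show ?thesis
      using nn_integral_bij_count_space[of uminus UNIV UNIV "\<lambda>k::int. Q k * pot kp (indicator {\<xi> k}) (\<xi> 0)"]
      by simp
  qed
  finally show ?thesis .
qed

end

lemma ennreal_le_eps:
  fixes a b :: ennreal
  assumes "\<And>e::real. e > 0 \<Longrightarrow> a \<le> b + ennreal e * c" "c < \<top>"
  shows "a \<le> b"
proof (rule ennreal_le_epsilon)
  fix e :: real assume e: "0 < e"
  define r where "r = e / (enn2real c + 1)"
  have r: "r > 0" unfolding r_def using e by (simp add: add_nonneg_pos)
  have "ennreal r * c = ennreal (r * enn2real c)" using assms(2) r by (simp add: ennreal_mult' ennreal_enn2real)
  also have "\<dots> \<le> ennreal e"
  proof (intro ennreal_leI)
    have "enn2real c / (enn2real c + 1) \<le> 1" by (simp add: add_nonneg_pos)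
    then have "e * (enn2real c / (enn2real c + 1)) \<le> e * 1" using e by (intro mult_left_mono) auto
    then show "r * enn2real c \<le> e" unfolding r_def by simp
  qed
  finally show "a \<le> b + ennreal e" using assms(1)[OF r] by (meson add_left_mono order.trans)
qed

section \<open>Recurrence modulo translations and its consequence for covariant functions\<close>

context walk begin

text \<open>Expectation over one step. The first argument of F is how far the step of P descends,
  that is how far the reversed step climbs; the second is how far the reversed step then
  descends.\<close>

definition stepE :: "(nat \<Rightarrow> nat \<Rightarrow> ennreal) \<Rightarrow> ennreal" where
  "stepE F = (\<Sum>\<^sup>+x. kp rt x * F (up pr x rt) (up pr rt x))"

lemma kh_stepE: "(\<Sum>\<^sup>+x. kh z x * F (up pr z x) (up pr x z)) = stepE F"
  unfolding stepE_def by (rule kh_step_law)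

text \<open>An excess anywhere spreads to an excess at y, whose potential at x would be infinite
  although it is bounded by \<open>f x\<close>.\<close>

lemma superharmonic_harmonic_if_recurrent:
  assumes inf: "pot kp (indicator {y}) x = \<top>" and sup: "\<And>z. kop kp f z \<le> f z" and fin: "\<And>z. f z < \<top>"
  shows "kop kp f z = f z"
proof (rule ccontr)
  assume ne: "kop kp f z \<noteq> f z"
  define e where "e z = f z - kop kp f z" for z
  have fe: "f z = e z + kop kp f z" for z using sup unfolding e_def by (simp add: diff_add_cancel_ennreal)
  have ez: "e z > 0" using ne fe[of z] by (metis add.left_neutral not_gr_zero)
  obtain n where n: "(kop kp ^^ n) (indicator {z}) y > 0" (is "?d > 0")
    using kp_irr unfolding irr_kernel_def by blast
  \<comment> \<open>Running the walk for n steps carries the excess from z to y; \<open>e'\<close>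
    is the excess of the n-th iterate of f.\<close>
  define e' where "e' = (kop kp ^^ n) e"
  have e'y: "e' y \<ge> ?d * e z" unfolding e'_def by (rule kpow_point_le)
  have "e' x + kop kp ((kop kp ^^ n) f) x \<le> (kop kp ^^ n) f x" for x
  proof -
    have "kop kp ((kop kp ^^ n) f) x = (kop kp ^^ n) (kop kp f) x" by (simp add: funpow_swap1)
    then have "e' x + kop kp ((kop kp ^^ n) f) x = (kop kp ^^ n) (\<lambda>z. e z + kop kp f z) x"
      unfolding e'_def kpow_add by simp
    moreover have "(\<lambda>z. e z + kop kp f z) = f" by (rule ext) (rule fe[symmetric])
    ultimately show ?thesis by simp
  qed
  then have "pot kp e' x \<le> (kop kp ^^ n) f x" by (rule pot_le_excessive)
  also have "\<dots> \<le> f x" by (rule kpow_superharmonic[OF sup])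
  finally have "pot kp e' x < \<top>" using fin[of x] by order
  moreover have "pot kp e' x \<ge> pot kp (indicator {y}) x * e' y"
    using kop_point_le[of "\<lambda>x y. pot kp (indicator {y}) x" x y e']
    by (subst pot_eq_nn_integral) (simp only: kop_def)
  moreover have "e' y \<noteq> 0" using e'y n ez
    by (metis ennreal_zero_less_mult_iff order_less_le_trans less_irrefl)
  ultimately show False using inf by (auto simp: ennreal_top_mult top_unique)
qed

end

text \<open>\<open>V\<close> is a Foster-Lyapunov function of the height above a reflecting level.
  The first term of \<open>V_step\<close> is the mean overshoot, kept so that it can be summed in
  \<open>slice_sum_Ef_fin\<close>.\<close>

locale walk_lyapunov = walk_axis q pr rt p \<xi>
  for q :: nat and pr :: "'v \<Rightarrow> 'v" and rt :: 'v and p :: "'v \<Rightarrow> 'v \<Rightarrow> real" and \<xi> :: "int \<Rightarrow> 'v" +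
  fixes V :: "nat \<Rightarrow> ennreal" and h0 :: nat
  assumes V_fin: "V h < \<top>" and V_mono: "mono V"
    and V_unbounded: "M < \<top> \<Longrightarrow> \<exists>h. M < V h"
    and V_step_fin: "stepE (\<lambda>j d. V ((h - j) + d)) < \<top>"
    and j_fin: "stepE (\<lambda>j d. of_nat j) < \<top>"
    and V_step: "h0 < h \<Longrightarrow> stepE (\<lambda>j d. of_nat (j - h)) + stepE (\<lambda>j d. V ((h - j) + d)) \<le> V h"
begin

lemma kh_V: "kop kh (\<lambda>x. V (ax x)) z \<le> stepE (\<lambda>j d. V ((ax z - j) + d))"
  unfolding kop_def kh_stepE[of z, symmetric]
  by (intro nn_integral_mono mult_left_mono monoD[OF V_mono] ax_step) auto

lemma kh_V_super: "h0 < ax z \<Longrightarrow> stepE (\<lambda>j d. of_nat (j - ax z)) + kop kh (\<lambda>x. V (ax x)) z \<le> V (ax z)"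
  using kh_V[of z] V_step[of "ax z"] by (meson add_left_mono order.trans)

text \<open>Foster's criterion: a potential that stays bounded below near the axis would, by the
  minimum principle, be bounded below everywhere, which no finite potential is.\<close>

lemma axis_recurrent: "pot kh (indicator (range \<xi>)) (\<xi> 0) = \<top>"
proof (rule ccontr)
  define \<phi> where "\<phi> = pot kh (indicator (range \<xi>))"
  assume "pot kh (indicator (range \<xi>)) (\<xi> 0) \<noteq> \<top>"
  then have fin0: "\<phi> (\<xi> 0) < \<top>" unfolding \<phi>_def by (simp add: less_top)
  have shift\<phi>: "\<phi> (shift k x) = \<phi> x" for k x
  proof -
    have "(\<lambda>y. indicator (range \<xi>) (shift k y) :: ennreal) = indicator (range \<xi>)"
      unfolding indicator_def shift_in_axis ..
    then show ?thesis unfolding \<phi>_def pot_kh_shift by simp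
  qed
  have sup: "kop kh \<phi> x \<le> \<phi> x" for x unfolding \<phi>_def by (rule kop_le_pot)
  have pos: "\<phi> x > 0" for x
  proof -
    have "0 < \<phi> (\<xi> 0)"
      unfolding \<phi>_def by (subst pot_unfold) (simp add: add_pos_nonneg)
    then show ?thesis using superharmonic_zero[OF kh_irr sup, of x "\<xi> 0"]
      by (metis not_gr_zero less_irrefl)
  qed
  \<comment> \<open>The points near the axis are finitely many modulo \<open>shift\<close>, and
    \<phi> is invariant under \<open>shift\<close>, so its minimum over all of them is
    positive.\<close>
  define F0 where "F0 = {x. cx x = 0 \<and> ax x \<le> h0}"
  have F0: "finite F0" "\<xi> 0 \<in> F0" unfolding F0_def using finite_axis_slice by auto
  define m0 where "m0 = Min (\<phi> ` F0)"
  have m0: "0 < m0" "m0 \<le> \<phi> (\<xi> 0)"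
  proof -
    have "Min (\<phi> ` F0) \<in> \<phi> ` F0" using F0 by (intro Min_in) auto
    then show "0 < m0" unfolding m0_def using pos by fastforce
    show "m0 \<le> \<phi> (\<xi> 0)" unfolding m0_def using F0 by (intro Min_le) auto
  qed
  have m0fin: "m0 < \<top>" using m0 fin0 by order
  have low: "m0 \<le> \<phi> x" if "ax x \<le> h0" for x
  proof -
    have "shift (- cx x) x \<in> F0" unfolding F0_def using that by simp
    then have "m0 \<le> \<phi> (shift (- cx x) x)" unfolding m0_def using F0 by (intro Min_le) auto
    then show ?thesis by (simp add: shift\<phi>)
  qed
  have "m0 \<le> \<phi> x + ennreal e * V (ax x)" if e: "e > 0" for x and e :: real
  proof -
    \<comment> \<open>The truncated difference vanishes near the axis by the choice of
      \<open>m0\<close>, and far away because \<open>ennreal e * V (ax x)\<close> exceeds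
      \<open>m0\<close>. Its maximum is therefore attained on a finite set modulo
      \<open>shift\<close>, and the maximum principle makes it zero.\<close>
    define w where "w x = m0 - (\<phi> x + ennreal e * V (ax x))" for x
    have w0: "w x = 0" if "ax x \<le> h0" for x
      using low[OF that] unfolding w_def by (simp add: diff_eq_0_iff_ennreal add_increasing2 m0fin)
    have sub: "w x \<le> kop kh w x" for x
    proof (cases "ax x \<le> h0")
      case False
      have "kop kh (\<lambda>x. V (ax x)) x \<le> V (ax x)"
        by (rule order.trans[OF _ kh_V_super[of x]]) (use False in \<open>auto simp: add_increasing\<close>)
      then have "kop kh \<phi> x + ennreal e * kop kh (\<lambda>x. V (ax x)) x \<le> \<phi> x + ennreal e * V (ax x)"
        by (intro add_mono sup mult_left_mono) auto
      moreover have "m0 \<le> kop kh w x + (kop kh \<phi> x + ennreal e * kop kh (\<lambda>x. V (ax x)) x)"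
      proof -
        have "m0 = kop kh (\<lambda>y. m0 * 1) x" by (simp only: kop_cmult kh_sum1) simp
        also have "\<dots> \<le> kop kh (\<lambda>y. w y + (\<phi> y + ennreal e * V (ax y))) x"
          unfolding w_def by (intro kop_mono) (auto simp: add_diff_self_ennreal add.commute[of "m0 - _"])
        also have "\<dots> = kop kh w x + (kop kh \<phi> x + ennreal e * kop kh (\<lambda>x. V (ax x)) x)"
          by (simp only: kop_add kop_cmult)
        finally show ?thesis .
      qed
      ultimately have "m0 \<le> kop kh w x + (\<phi> x + ennreal e * V (ax x))"
        by (elim order.trans) (rule add_left_mono)
      then show ?thesis unfolding w_def[of x] ennreal_minus_le_iff using m0fin by (auto simp: add.commute)
    qed (simp add: w0)
    obtain H where H: "ennreal (enn2real m0 / e) < V H"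
      using V_unbounded[of "ennreal (enn2real m0 / e)"] by auto
    define F1 where "F1 = {x. cx x = 0 \<and> ax x \<le> H}"
    have F1: "finite F1" "\<xi> 0 \<in> F1" unfolding F1_def using finite_axis_slice by auto
    obtain x0 where x0: "x0 \<in> F1" "\<And>x. x \<in> F1 \<Longrightarrow> w x \<le> w x0"
    proof -
      have "Max (w ` F1) \<in> w ` F1" using F1 by (intro Max_in) auto
      then obtain x0 where "x0 \<in> F1" "Max (w ` F1) = w x0" by auto
      moreover have "w x \<le> Max (w ` F1)" if "x \<in> F1" for x using F1 that by (intro Max_ge) auto
      ultimately show ?thesis using that by auto
    qed
    have "w x \<le> w x0" for x
    proof (cases "ax x \<le> H")
      case True
      then have "shift (- cx x) x \<in> F1" unfolding F1_def by simp
      then show ?thesis using x0(2)[of "shift (- cx x) x"] unfolding w_def by (simp add: shift\<phi>)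
    next
      case False
      have "m0 = ennreal e * ennreal (enn2real m0 / e)" using e m0fin
        by (simp flip: ennreal_mult' add: ennreal_enn2real)
      also have "\<dots> \<le> ennreal e * V (ax x)"
        using H monoD[OF V_mono, of H "ax x"] False by (intro mult_left_mono) auto
      finally have "w x = 0" unfolding w_def by (simp add: diff_eq_0_iff_ennreal add_increasing m0fin)
      then show ?thesis by simp
    qed
    moreover have "w x0 < \<infinity>"
      unfolding w_def using m0fin by (auto intro: order.strict_trans1[OF diff_le_self_ennreal])
    ultimately have "w x = w x0" "w (\<xi> 0) = w x0" for x
      using subharmonic_max_constant[OF kh_irr kh_sum1 sub] by blast+
    then have "w x = 0" using w0[of "\<xi> 0"] by simp
    then show ?thesis unfolding w_def using m0fin by (simp add: diff_eq_0_iff_ennreal)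
  qed
  then have m0le: "m0 \<le> \<phi> x" for x using ennreal_le_eps V_fin by blast
  \<comment> \<open>The remainder after n terms is at least \<open>m0\<close>, so all partial sums
    of the series for \<phi> stay \<open>m0\<close> below their own limit.\<close>
  have "(\<Sum>i<n. (kop kh ^^ i) (indicator (range \<xi>)) (\<xi> 0)) \<le> \<phi> (\<xi> 0) - m0" for n
  proof -
    have "m0 \<le> (kop kh ^^ n) (\<lambda>_. m0) (\<xi> 0)"
      by (rule kpow_subharmonic) (use kop_cmult[of kh m0 "\<lambda>_. 1"] in \<open>simp add: kh_sum1\<close>)
    also have "\<dots> \<le> (kop kh ^^ n) \<phi> (\<xi> 0)" using m0le by (rule kpow_mono)
    finally have "(\<Sum>i<n. (kop kh ^^ i) (indicator (range \<xi>)) (\<xi> 0)) + m0 \<le> \<phi> (\<xi> 0)"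
      using kpow_decompose[of \<phi> "indicator (range \<xi>)" kh "\<xi> 0" n] pot_unfold[of kh "indicator (range \<xi>)"]
      unfolding \<phi>_def by (simp add: add_left_mono)
    then show ?thesis using m0fin by (simp add: ennreal_le_minus_iff)
  qed
  then have "\<phi> (\<xi> 0) \<le> \<phi> (\<xi> 0) - m0"
    unfolding \<phi>_def pot_def by (intro suminf_le_const) auto
  then have "\<phi> (\<xi> 0) + m0 \<le> \<phi> (\<xi> 0) - m0 + m0" by (rule add_right_mono)
  also have "\<dots> = \<phi> (\<xi> 0) + 0" using m0(2) by (simp add: diff_add_cancel_ennreal)
  finally have "m0 \<le> 0" using fin0 by (subst (asm) ennreal_add_left_cancel_le) auto
  then show False using m0(1) by simp
qed

text \<open>The excess of F inherits the covariance. Once carried onto the axis, its potential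
  contains a positive multiple of the divergent sum of \<open>axis_green_sum\<close>, while
  minimality bounds this potential by F.\<close>

lemma excessive_covariant_harmonic:
  assumes fin: "\<And>x. F x < \<top>" and sup: "\<And>x. kop kp F x \<le> F x" and cov: "\<And>k x. F (shift k x) = Q k * F x"
  shows "kop kp F x0 = F x0"
proof (rule ccontr)
  assume ne: "kop kp F x0 \<noteq> F x0"
  define e where "e z = F z - kop kp F z" for z
  have fe: "F z = e z + kop kp F z" for z using sup unfolding e_def by (simp add: diff_add_cancel_ennreal)
  have ecov: "e (shift k x) = Q k * e x" for k x
    unfolding e_def kop_kp_shift cov kop_cmult by (simp add: ennreal_right_diff_distrib)
  have ez: "e x0 > 0" using ne fe[of x0] by (metis add.left_neutral not_gr_zero)
  obtain n where n: "(kop kp ^^ n) (indicator {x0}) (\<xi> 0) > 0"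
    using kp_irr unfolding irr_kernel_def by blast
  define e' where "e' = (kop kp ^^ n) e"
  define \<delta> where "\<delta> = e' (\<xi> 0)"
  have "0 < (kop kp ^^ n) (indicator {x0}) (\<xi> 0) * e x0" using n ez by (simp add: ennreal_zero_less_mult_iff)
  then have \<delta>: "\<delta> > 0" unfolding \<delta>_def e'_def using kpow_point_le[of n kp x0 "\<xi> 0" e] by order
  have e'xi: "e' (\<xi> k) = Q k * \<delta>" for k
  proof -
    have "e' (\<xi> k) = e' (shift k (\<xi> 0))" by simp
    also have "\<dots> = Q k * \<delta>" unfolding e'_def \<delta>_def kpow_kp_shift ecov kpow_cmult ..
    finally show ?thesis .
  qed
  have "e' x + kop kp ((kop kp ^^ n) F) x \<le> (kop kp ^^ n) F x" for x
  proof -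
    have "kop kp ((kop kp ^^ n) F) x = (kop kp ^^ n) (kop kp F) x" by (simp add: funpow_swap1)
    then have "e' x + kop kp ((kop kp ^^ n) F) x = (kop kp ^^ n) (\<lambda>z. e z + kop kp F z) x"
      unfolding e'_def kpow_add by simp
    moreover have "(\<lambda>z. e z + kop kp F z) = F" by (rule ext) (rule fe[symmetric])
    ultimately show ?thesis by simp
  qed
  then have "pot kp e' (\<xi> 0) \<le> (kop kp ^^ n) F (\<xi> 0)" by (rule pot_le_excessive)
  also have "\<dots> \<le> F (\<xi> 0)" by (rule kpow_superharmonic[OF sup])
  finally have "pot kp e' (\<xi> 0) < \<top>" using fin[of "\<xi> 0"] by order
  moreover have "pot kp e' (\<xi> 0) = \<top>"
  proof -
    have "\<top> = \<delta> * (\<Sum>\<^sup>+k. Q k * pot kp (indicator {\<xi> k}) (\<xi> 0))"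
      using axis_recurrent unfolding axis_green_sum using \<delta> by (simp add: ennreal_mult_top)
    also have "\<dots> = (\<Sum>\<^sup>+k. pot kp (indicator {\<xi> k}) (\<xi> 0) * e' (\<xi> k))"
      by (subst nn_integral_cmult[symmetric]) (simp_all add: e'xi ac_simps)
    also have "\<dots> = (\<Sum>\<^sup>+y. pot kp (indicator {y}) (\<xi> 0) * e' y * indicator (range \<xi>) y)"
      by (rule nn_integral_inj_range[OF xi_inj, symmetric])
    also have "\<dots> \<le> pot kp e' (\<xi> 0)"
      by (subst pot_eq_nn_integral[of kp e']) (intro nn_integral_mono, auto simp: indicator_def)
    finally show ?thesis by (simp add: top_unique)
  qed
  ultimately show False by simp
qed

end

lemma ennreal_add_left_le_imp:
  fixes a b c :: ennreal
  assumes "a + b \<le> a + c" "a < \<top>" shows "b \<le> c"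
  using assms by (auto simp: ennreal_add_left_cancel_le)

section \<open>Harmonic functions dominated by a covariant function\<close>

locale walk_excessive = walk_lyapunov q pr rt p \<xi> V h0
  for q :: nat and pr :: "'v \<Rightarrow> 'v" and rt :: 'v and p :: "'v \<Rightarrow> 'v \<Rightarrow> real" and \<xi> :: "int \<Rightarrow> 'v"
    and V :: "nat \<Rightarrow> ennreal" and h0 :: nat +
  fixes u :: "'v \<Rightarrow> ennreal"
  assumes u_fin: "u x < \<top>" and u_pos: "u x > 0" and u_sup: "kop kp u x \<le> u x"
    and u_cov: "u (shift k x) = Q k * u x"
begin

lemma u_harm: "kop kp u x = u x"
  by (rule excessive_covariant_harmonic[OF u_fin u_sup u_cov])

lemma u_xi: "u (\<xi> k) = Q k * u (\<xi> 0)"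
  using u_cov[of k "\<xi> 0"] by simp

text \<open>The gap between the two functions is nonnegative and superharmonic, so one zero of it
  forces all others.\<close>

lemma harmonic_touch:
  assumes h: "\<And>x. kop kp f x = f x" "\<And>x. kop kp g x = g x" and le: "\<And>x. f x \<le> g x"
    and fin: "\<And>x. g x < \<top>" and eq: "f x0 = g x0"
  shows "f x = g x"
proof -
  define r where "r x = g x - f x" for x
  have gr: "g x = f x + r x" for x using le unfolding r_def by (simp add: add_diff_self_ennreal)
  have ffin: "f x < \<top>" for x using le[of x] fin[of x] by order
  have "kop kp r x \<le> r x" for x
  proof -
    have "f x + r x = kop kp (\<lambda>y. f y + r y) x" using h(2)[of x] by (simp flip: gr)
    then have "f x + r x = f x + kop kp r x" by (simp add: kop_add h(1))
    then show ?thesis using ffin[of x] ennreal_add_left_le_imp by (metis order_refl)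
  qed
  moreover have "r x0 = 0" unfolding r_def eq using fin[of x0] by simp
  ultimately have "r x = 0" using superharmonic_zero[OF kp_irr] by blast
  then show ?thesis using gr[of x] by simp
qed

text \<open>If the walk were recurrent, truncating \<open>u\<close> at the level \<open>u (\<xi> 0)\<close> would again give a harmonic
  function, so \<open>u\<close> would be constant along the axis.\<close>

lemma transient: "pot kp (indicator {y}) x < \<top>"
proof (rule ccontr)
  assume "\<not> pot kp (indicator {y}) x < \<top>"
  then have inf: "pot kp (indicator {y}) x = \<top>" by (simp add: not_less top_unique)
  define f where "f z = min (u z) (u (\<xi> 0))" for z
  have sup: "kop kp f z \<le> f z" for z
  proof -
    have "kop kp f z \<le> kop kp u z" unfolding f_def by (intro kop_mono) auto
    moreover have "kop kp f z \<le> kop kp (\<lambda>_. u (\<xi> 0) * 1) z" unfolding f_def by (intro kop_mono) auto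
    ultimately show ?thesis using u_sup[of z] by (simp only: kop_cmult kp_sum1 f_def) auto
  qed
  have ffin: "f z < \<top>" for z unfolding f_def using u_fin[of z] by (simp add: min_less_iff_disj)
  have harm: "kop kp f z = f z" for z
    by (rule superharmonic_harmonic_if_recurrent[OF inf sup ffin])
  have "f z = u (\<xi> 0)" for z
  proof (rule harmonic_touch[where f = f and g = "\<lambda>_. u (\<xi> 0)"])
    show "kop kp (\<lambda>_. u (\<xi> 0)) x = u (\<xi> 0)" for x
      using kop_cmult[of kp "u (\<xi> 0)" "\<lambda>_. 1" x] by (simp add: kp_sum1)
    show "f (\<xi> 0) = u (\<xi> 0)" by (simp add: f_def)
  qed (auto simp: harm f_def u_fin)
  then have "u (\<xi> 0) \<le> u (\<xi> (-1))" unfolding f_def by (metis min.cobounded1)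
  \<comment> \<open>One shift backwards divides \<open>u\<close> by q, which is at least 2, against
    constancy along the axis.\<close>
  then have "u (\<xi> 0) \<le> Q (-1) * u (\<xi> 0)" by (simp only: u_xi[of "-1"])
  then have "Q 1 * u (\<xi> 0) \<le> Q 1 * (Q (-1) * u (\<xi> 0))" by (intro mult_left_mono) auto
  then have "Q 1 * u (\<xi> 0) \<le> 1 * u (\<xi> 0)" by simp
  then have "Q 1 \<le> 1" using u_pos[of "\<xi> 0"] u_fin[of "\<xi> 0"]
    by (subst (asm) (1 2) mult.commute, subst (asm) ennreal_mult_le_mult_iff) auto
  then show False using q2 unfolding Q_def by simp
qed

text \<open>Domination principle: the two sides agree at y, so their minimum has the full excess of
  \<open>u y\<close> times the Green function at y and is superharmonic elsewhere. Minimality of the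
  potential does the rest.\<close>

lemma green_domination:
  "pot kp (indicator {y}) x * u y \<le> pot kp (indicator {y}) y * u x"
proof -
  define g where "g = pot kp (indicator {y})"
  define w where "w x = min (g y * u x) (u y * g x)" for x
  have gu: "g x = indicator {y} x + kop kp g x" for x unfolding g_def by (rule pot_unfold)
  have "u y * indicator {y} x + kop kp w x \<le> w x" for x
  proof -
    have a: "kop kp w x \<le> g y * u x"
    proof -
      have "kop kp w x \<le> kop kp (\<lambda>x. g y * u x) x" unfolding w_def by (intro kop_mono) auto
      then show ?thesis by (simp add: kop_cmult u_harm)
    qed
    have b: "kop kp w x \<le> u y * kop kp g x"
    proof -
      have "kop kp w x \<le> kop kp (\<lambda>x. u y * g x) x" unfolding w_def by (intro kop_mono) auto
      then show ?thesis by (simp add: kop_cmult)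
    qed
    have c: "u y * indicator {y} x + kop kp w x \<le> u y * g x"
      using b by (subst gu) (simp add: distrib_left add_left_mono)
    show ?thesis
    proof (cases "x = y")
      case True
      then show ?thesis using c unfolding w_def by (simp add: mult.commute)
    next
      case False
      then show ?thesis using a c unfolding w_def by simp
    qed
  qed
  then have "pot kp (\<lambda>x. u y * indicator {y} x) x \<le> w x" by (rule pot_le_excessive)
  then show ?thesis unfolding pot_cmult w_def g_def by (simp add: mult.commute)
qed

text \<open>The negative part of the difference, made covariant under the shift by taking a supremum,
  is dominated by \<open>u\<close>, hence harmonic, and it vanishes on the axis.\<close>

lemma axis_comparison:
  assumes h: "\<And>x. kop kp f x = f x" "\<And>x. kop kp g x = g x"
    and dom: "\<And>x. f x \<le> C * u x" "C < \<top>" and gfin: "\<And>x. g x < \<top>"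
    and axis: "\<And>k. f (\<xi> k) \<le> g (\<xi> k)"
  shows "f x \<le> g x"
proof -
  define t where "t x = f x - g x" for x
  \<comment> \<open>The least covariant majorant of t: each translate is rescaled by the factor that
    leaves \<open>u\<close> unchanged.\<close>
  define T where "T x = (SUP k. Q (- k) * t (shift k x))" for x
  have Cu: "C * u x < \<top>" for x using dom(2) u_fin[of x] by (simp add: ennreal_mult_less_top)
  have ffin: "f x < \<top>" for x using dom(1)[of x] Cu[of x] by order
  have t_sub: "t x \<le> kop kp t x" for x
  proof -
    have "f x = kop kp f x" by (simp add: h)
    also have "\<dots> \<le> kop kp (\<lambda>y. g y + t y) x"
      unfolding t_def by (intro kop_mono) (auto simp: add_diff_self_ennreal)
    also have "\<dots> = g x + kop kp t x" by (simp add: kop_add h)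
    finally show ?thesis unfolding t_def[of x] ennreal_minus_le_iff using ffin[of x] by auto
  qed
  have t_le: "t x \<le> C * u x" for x
    using dom(1)[of x] unfolding t_def by (meson diff_le_self_ennreal order.trans)
  have T_le: "T x \<le> C * u x" for x
    unfolding T_def
  proof (rule SUP_least)
    fix k
    have "Q (- k) * t (shift k x) \<le> Q (- k) * (C * u (shift k x))" by (intro mult_left_mono t_le) auto
    also have "\<dots> = C * u x" unfolding u_cov by (simp add: mult.left_commute[of C])
    finally show "Q (- k) * t (shift k x) \<le> C * u x" .
  qed
  have T_upper: "Q (- k) * t (shift k x) \<le> T x" for k x unfolding T_def by (rule SUP_upper) simp
  have T_cov_le: "T (shift l x) \<le> Q l * T x" for l x
    unfolding T_def[of "shift l x"]
  proof (rule SUP_least)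
    fix k
    have "Q (- k) = Q l * Q (- (k + l))" by (simp flip: Q_add)
    then have "Q (- k) * t (shift k (shift l x)) = Q l * (Q (- (k + l)) * t (shift (k + l) x))"
      by (simp only: shift_add mult.assoc)
    also have "\<dots> \<le> Q l * T x" by (intro mult_left_mono T_upper) auto
    finally show "Q (- k) * t (shift k (shift l x)) \<le> Q l * T x" .
  qed
  have T_cov: "T (shift l x) = Q l * T x" for l x
  proof (rule antisym[OF T_cov_le])
    have "T x \<le> Q (- l) * T (shift l x)" using T_cov_le[of "- l" "shift l x"] by simp
    then have "Q l * T x \<le> Q l * (Q (- l) * T (shift l x))" by (intro mult_left_mono) auto
    then show "Q l * T x \<le> T (shift l x)" by simp
  qed
  have T_sub: "T x \<le> kop kp T x" for x
    unfolding T_def[of x]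
  proof (rule SUP_least)
    fix k
    have "Q (- k) * t (shift k x) \<le> Q (- k) * kop kp t (shift k x)" by (intro mult_left_mono t_sub) auto
    also have "\<dots> = kop kp (\<lambda>y. Q (- k) * t (shift k y)) x" by (simp add: kop_kp_shift kop_cmult)
    also have "\<dots> \<le> kop kp T x" by (intro kop_mono T_upper)
    finally show "Q (- k) * t (shift k x) \<le> kop kp T x" .
  qed
  \<comment> \<open>So far T is only subharmonic. Its complement in C u is superharmonic and
    covariant, hence harmonic, and this forces T to be harmonic.\<close>
  define F where "F x = C * u x - T x" for x
  have FT: "C * u x = F x + T x" for x using T_le[of x] unfolding F_def by (simp add: diff_add_cancel_ennreal)
  have Ffin: "F x < \<top>" for x
    unfolding F_def using Cu[of x] by (auto intro: order.strict_trans1[OF diff_le_self_ennreal])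
  have Tfin: "T x < \<top>" for x using T_le[of x] Cu[of x] by order
  have FT_kop: "F x + T x = kop kp F x + kop kp T x" for x
  proof -
    have "F x + T x = kop kp (\<lambda>x. C * u x) x" by (simp only: FT[symmetric] kop_cmult u_harm)
    then show ?thesis unfolding FT kop_add .
  qed
  have Fsup: "kop kp F x \<le> F x" for x
  proof -
    have "kop kp F x + T x \<le> F x + T x" unfolding FT_kop by (intro add_left_mono T_sub)
    then have "T x + kop kp F x \<le> T x + F x" by (subst (1 2) add.commute)
    then show ?thesis using Tfin[of x] by (rule ennreal_add_left_le_imp)
  qed
  have Fcov: "F (shift k x) = Q k * F x" for k x
    unfolding F_def T_cov u_cov by (simp add: ennreal_right_diff_distrib mult.left_commute)
  have "kop kp F x = F x" for x by (rule excessive_covariant_harmonic[OF Ffin Fsup Fcov])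
  then have Tharm: "kop kp T x \<le> T x" for x
    using FT_kop[of x] Ffin[of x] by (intro ennreal_add_left_le_imp[of "F x" "kop kp T x" "T x"]) auto
  have "t (\<xi> k) = 0" for k unfolding t_def using axis[of k] ffin[of "\<xi> k"] by (simp add: diff_eq_0_iff_ennreal)
  then have "T (\<xi> 0) = 0" unfolding T_def by simp
  then have "T x = 0" using superharmonic_zero[OF kp_irr Tharm] by blast
  then have "t x = 0" using T_upper[of 0 x] by simp
  then show ?thesis unfolding t_def using ffin[of x] by (simp add: diff_eq_0_iff_ennreal)
qed

end

section \<open>Mass transport modulo translations\<close>

lemma nn_integral_count_swap:
  "(\<Sum>\<^sup>+x. \<Sum>\<^sup>+y. f x y)
     = (\<Sum>\<^sup>+y. \<Sum>\<^sup>+x. f x y)"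
  using nn_integral_fst_count_space[of "\<lambda>(x, y). f x y"] nn_integral_snd_count_space[of "\<lambda>(x, y). f x y"]
  by simp

lemma nn_integral_bij_UNIV:
  "bij g \<Longrightarrow> (\<Sum>\<^sup>+x. f (g x)) = (\<Sum>\<^sup>+x. f x)"
  using nn_integral_bij_count_space[of g UNIV UNIV f] by simp

lemma kpow_kernel_mono:
  assumes "\<And>x y. k x y \<le> k' x y" shows "(kop k ^^ n) f x \<le> (kop k' ^^ n) f x"
proof (induction n arbitrary: x)
  case (Suc n)
  have "kop k ((kop k ^^ n) f) x \<le> kop k' ((kop k' ^^ n) f) x"
    unfolding kop_def[of k "(kop k ^^ n) f"] kop_def[of k' "(kop k' ^^ n) f"]
    by (intro nn_integral_mono mult_mono assms Suc) auto
  then show ?case by simp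
qed simp

context walk_axis begin

text \<open>The slice \<open>cx x = 0\<close> meets every orbit of the translations exactly
  once.\<close>

lemma nn_integral_shift_slices:
  "(\<Sum>\<^sup>+x. g x)
     = (\<Sum>\<^sup>+x. indicator {x. cx x = 0} x * (\<Sum>\<^sup>+k. g (shift k x)))"
proof -
  have "(\<Sum>\<^sup>+x. g x)
      = (\<Sum>\<^sup>+k. \<Sum>\<^sup>+x. g x * indicator {x. cx x = k} x)"
    by (rule nn_integral_fibers)
  also have "\<dots> = (\<Sum>\<^sup>+k. \<Sum>\<^sup>+x. indicator {x. cx x = 0} x * g (shift k x))"
  proof (rule nn_integral_cong)
    fix k
    have "(\<Sum>\<^sup>+x. g x * indicator {x. cx x = k} x)
        = (\<Sum>\<^sup>+x. g (shift k x) * indicator {x. cx x = k} (shift k x))"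
      by (rule nn_integral_bij_UNIV[OF shift_bij, symmetric])
    also have "\<dots> = (\<Sum>\<^sup>+x. indicator {x. cx x = 0} x * g (shift k x))"
      by (intro nn_integral_cong) (auto simp: indicator_def)
    finally show "(\<Sum>\<^sup>+x. g x * indicator {x. cx x = k} x)
        = (\<Sum>\<^sup>+x. indicator {x. cx x = 0} x * g (shift k x))" .
  qed
  also have "\<dots> = (\<Sum>\<^sup>+x. \<Sum>\<^sup>+k. indicator {x. cx x = 0} x * g (shift k x))"
    by (rule nn_integral_count_swap)
  also have "\<dots> = (\<Sum>\<^sup>+x. indicator {x. cx x = 0} x * (\<Sum>\<^sup>+k. g (shift k x)))"
    by (intro nn_integral_cong nn_integral_cmult) simp
  finally show ?thesis .
qed

text \<open>What a fundamental domain sends out equals what it receives: split the targets over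
  translates of the slice and move each translation to the source by diagonal invariance.\<close>

lemma mass_transport:
  fixes k :: "'v \<Rightarrow> 'v \<Rightarrow> ennreal"
  assumes inv: "\<And>i x y. k (shift i x) (shift i y) = k x y"
  shows "(\<Sum>\<^sup>+x. indicator {x. cx x = 0} x * (\<Sum>\<^sup>+y. k x y))
      = (\<Sum>\<^sup>+y. indicator {y. cx y = 0} y * (\<Sum>\<^sup>+x. k x y))"
proof -
  define J where "J y = (\<Sum>\<^sup>+x. indicator {x. cx x = 0} x * k x y)" for y
  have "(\<Sum>\<^sup>+x. indicator {x. cx x = 0} x * (\<Sum>\<^sup>+y. k x y))
      = (\<Sum>\<^sup>+x. \<Sum>\<^sup>+y. indicator {x. cx x = 0} x * k x y)"
    by (intro nn_integral_cong nn_integral_cmult[symmetric]) simp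
  also have "\<dots> = (\<Sum>\<^sup>+y. J y)"
    unfolding J_def by (rule nn_integral_count_swap)
  also have "\<dots> = (\<Sum>\<^sup>+y. indicator {x. cx x = 0} y * (\<Sum>\<^sup>+l. J (shift l y)))"
    by (rule nn_integral_shift_slices)
  also have "\<dots> = (\<Sum>\<^sup>+y. indicator {y. cx y = 0} y * (\<Sum>\<^sup>+x. k x y))"
  proof (intro nn_integral_cong arg_cong2[where f = "(*)"] refl)
    fix y
    have "(\<Sum>\<^sup>+l. J (shift l y))
        = (\<Sum>\<^sup>+l. J (shift (- l) y))"
      by (rule nn_integral_bij_UNIV[OF bij_uminus, symmetric])
    also have "\<dots> = (\<Sum>\<^sup>+l. \<Sum>\<^sup>+x. indicator {x. cx x = 0} x * k (shift l x) y)"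
    proof -
      have "k x (shift (- l) y) = k (shift l x) y" for l x using inv[of l x "shift (- l) y"] by simp
      then show ?thesis unfolding J_def by simp
    qed
    also have "\<dots> = (\<Sum>\<^sup>+x. \<Sum>\<^sup>+l. indicator {x. cx x = 0} x * k (shift l x) y)"
      by (rule nn_integral_count_swap)
    also have "\<dots> = (\<Sum>\<^sup>+x. indicator {x. cx x = 0} x * (\<Sum>\<^sup>+l. k (shift l x) y))"
      by (intro nn_integral_cong nn_integral_cmult) simp
    also have "\<dots> = (\<Sum>\<^sup>+x. k x y)"
      by (rule nn_integral_shift_slices[symmetric])
    finally show "(\<Sum>\<^sup>+l. J (shift l y)) = (\<Sum>\<^sup>+x. k x y)" .
  qed
  finally show ?thesis .
qed

end

section \<open>Almost sure exit of the reversed walk from the cone below \<xi> 0\<close>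

context walk_lyapunov begin

definition exit_prob :: "'v \<Rightarrow> ennreal" where
  "exit_prob x = indicator cone0 x * kop kh (indicator (- cone0)) x"

text \<open>Meant for s the probability of never leaving the cone. Foster's argument bounds s by its
  maximum over the finitely many cone points of height at most \<open>h0\<close>; a subharmonic
  function attaining its supremum is constant, and s vanishes outside the cone.\<close>

lemma stay_forever_zero:
  assumes sub: "\<And>x. s x \<le> kop kh s x" and le1: "\<And>x. s x \<le> indicator cone0 x"
  shows "s x = 0"
proof -
  have s_out: "s x = 0" if "x \<notin> cone0" for x using le1[of x] that by simp
  have s_fin: "s x < \<top>" for x using le1[of x] by (auto simp: indicator_def order.strict_trans1 split: if_splits intro: order.strict_trans1)
  define F2 where "F2 = {x \<in> cone0. ht x \<le> int h0}"
  have F2: "finite F2" "\<xi> 0 \<in> F2"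
    unfolding F2_def using finite_cone_slice by (auto simp: cone0_iff)
  have "Max (s ` F2) \<in> s ` F2" using F2 by (intro Max_in) auto
  then obtain x1 where x1: "x1 \<in> F2" "Max (s ` F2) = s x1" by auto
  have s_x1: "s x \<le> s x1" if "x \<in> F2" for x using F2 that Max_ge[of "s ` F2" "s x"] x1 by simp
  \<comment> \<open>Inside the cone the height takes the place of the distance to the axis. The
    value 0 outside means that a step out of the cone only helps the inequality.\<close>
  define W where "W x = indicator cone0 x * V (nat (ht x))" for x
  have W_super: "kop kh W x \<le> W x" if "x \<in> cone0" "int h0 < ht x" for x
  proof -
    have "kop kh W x \<le> stepE (\<lambda>j d. V ((nat (ht x) - j) + d))"
      unfolding kop_def kh_stepE[of x, symmetric]
    proof (intro nn_integral_mono mult_left_mono)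
      fix y
      show "W y \<le> V ((nat (ht x) - up pr x y) + up pr y x)"
        using hor_up[of x y] cone0_anc[of y] unfolding W_def
        by (auto simp: indicator_def intro!: monoD[OF V_mono])
    qed auto
    also have "\<dots> \<le> stepE (\<lambda>j d. of_nat (j - nat (ht x))) + stepE (\<lambda>j d. V ((nat (ht x) - j) + d))"
      by (simp add: add_increasing)
    also have "\<dots> \<le> V (nat (ht x))" using that by (intro V_step) auto
    finally show ?thesis unfolding W_def using that by simp
  qed
  have "s x \<le> s x1 + ennreal e * W x" if e: "e > 0" for x and e :: real
  proof -
    define w where "w x = s x - (s x1 + ennreal e * W x)" for x
    have w0: "w x = 0" if "x \<notin> cone0 \<or> ht x \<le> int h0" for x
    proof -
      have "s x \<le> s x1" using that s_out[of x] s_x1[of x] unfolding F2_def by (cases "x \<in> cone0") auto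
      then show ?thesis unfolding w_def using s_fin[of x] by (simp add: diff_eq_0_iff_ennreal add_increasing2)
    qed
    have wsub: "w x \<le> kop kh w x" for x
    proof (cases "x \<notin> cone0 \<or> ht x \<le> int h0")
      case False
      have "s x \<le> kop kh s x" by (rule sub)
      also have "\<dots> \<le> kop kh (\<lambda>y. w y + (s x1 * 1 + ennreal e * W y)) x"
        unfolding w_def by (intro kop_mono) (auto simp: add_diff_self_ennreal add.commute[of "s _ - _"])
      also have "\<dots> = kop kh w x + (s x1 + ennreal e * kop kh W x)"
        by (simp only: kop_add kop_cmult kh_sum1) simp
      also have "\<dots> \<le> kop kh w x + (s x1 + ennreal e * W x)"
        using False by (intro add_left_mono mult_left_mono W_super) auto
      finally show ?thesis unfolding w_def[of x] ennreal_minus_le_iff using s_fin[of x] by (auto simp: add.commute)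
    qed (simp add: w0)
    obtain H where H: "ennreal (1 / e) < V H" using V_unbounded[of "ennreal (1 / e)"] by auto
    define F3 where "F3 = {x \<in> cone0. ht x \<le> int H}"
    have F3: "finite F3" "\<xi> 0 \<in> F3" unfolding F3_def using finite_cone_slice by (auto simp: cone0_iff)
    have "Max (w ` F3) \<in> w ` F3" using F3 by (intro Max_in) auto
    then obtain x0 where x0: "x0 \<in> F3" "Max (w ` F3) = w x0" by auto
    have "w x \<le> w x0" for x
    proof (cases "x \<in> F3")
      case True
      then show ?thesis using F3 Max_ge[of "w ` F3" "w x"] x0 by simp
    next
      case False
      have "w x = 0"
      proof (cases "x \<in> cone0")
        case True
        then have "int H < ht x" using False unfolding F3_def by auto
        then have "V H \<le> W x" unfolding W_def using True by (auto intro!: monoD[OF V_mono])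
        then have "ennreal e * ennreal (1 / e) \<le> ennreal e * W x" using H by (intro mult_left_mono) auto
        then have "1 \<le> ennreal e * W x" using e by (simp flip: ennreal_mult')
        moreover have "s x \<le> 1" using le1[of x] True by simp
        ultimately show ?thesis unfolding w_def using s_fin[of x]
          by (simp add: diff_eq_0_iff_ennreal add_increasing)
      qed (simp add: w0)
      then show ?thesis by simp
    qed
    moreover have "w x0 < \<infinity>"
      unfolding w_def using s_fin[of x0] by (auto intro: order.strict_trans1[OF diff_le_self_ennreal])
    ultimately have "w x = w x0" "w (\<xi> 0) = w x0" for x
      using subharmonic_max_constant[OF kh_irr kh_sum1 wsub] by blast+
    then have "w x = 0" using w0[of "\<xi> 0"] by simp
    then show ?thesis unfolding w_def using s_fin[of x] by (simp add: diff_eq_0_iff_ennreal)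
  qed
  then have "s x \<le> s x1" for x
  proof (rule ennreal_le_eps)
    show "W x < \<top>" unfolding W_def using V_fin by (simp add: indicator_def)
  qed
  then have "s x = s x1" "s (\<xi> (-1)) = s x1" for x
    using subharmonic_max_constant[OF kh_irr kh_sum1 sub _ s_fin[of x1, folded infinity_ennreal_def]] by blast+
  moreover have "\<xi> (-1) \<notin> cone0" by (simp add: cone0_iff)
  ultimately show ?thesis using s_out[of "\<xi> (-1)"] by simp
qed

text \<open>One is the probability of a first exit within n steps plus that of staying, and the
  latter tends to 0 by \<open>stay_forever_zero\<close>. The potential also counts exits after a
  return to the cone, hence the inequality.\<close>

lemma exit_flux: assumes "y \<in> cone0" shows "1 \<le> pot kh exit_prob y"
proof -
  \<comment> \<open>The walk killed on leaving the cone; \<open>s n\<close> below is the probability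
    of staying for n steps.\<close>
  define k0 where "k0 x y = indicator cone0 x * kh x y * indicator cone0 y" for x y
  define s where "s n = (kop k0 ^^ n) (indicator cone0)" for n
  have k0_kop: "kop k0 f x = indicator cone0 x * kop kh (\<lambda>y. indicator cone0 y * f y) x" for f x
    unfolding kop_def k0_def by (subst nn_integral_cmult[symmetric]) (simp_all add: ac_simps)
  have k0_le: "k0 x y \<le> kh x y" for x y unfolding k0_def by (simp add: indicator_def)
  have dec: "indicator cone0 x = exit_prob x + kop k0 (indicator cone0) x" for x
  proof -
    have "(\<lambda>y. indicator (- cone0) y + indicator cone0 y :: ennreal) = (\<lambda>_. 1)"
      by (auto simp: indicator_def)
    then have "1 = kop kh (\<lambda>y. indicator (- cone0) y + indicator cone0 y) x"
      using kh_sum1[of x] by simp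
    then have "1 = kop kh (indicator (- cone0)) x + kop kh (indicator cone0) x" by (simp only: kop_add)
    then have "indicator cone0 x = indicator cone0 x * (kop kh (indicator (- cone0)) x + kop kh (indicator cone0) x)"
      by simp
    moreover have "(\<lambda>y. indicator cone0 y * indicator cone0 y :: ennreal) = indicator cone0"
      by (auto simp: indicator_def)
    ultimately show ?thesis unfolding exit_prob_def k0_kop by (simp add: distrib_left)
  qed
  have s0: "kop k0 (indicator cone0) x \<le> indicator cone0 x" for x by (subst dec) (simp add: add_increasing)
  have s_dec: "s (Suc n) x \<le> s n x" for n x
    unfolding s_def kpow_Suc_right by (intro kpow_mono s0)
  have s_le: "s n x \<le> indicator cone0 x" for n x unfolding s_def by (rule kpow_superharmonic[OF s0])
  have bound: "1 \<le> pot kh exit_prob y + s n y" for n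
  proof -
    have eq: "1 = (\<Sum>i<n. (kop k0 ^^ i) exit_prob y) + s n y"
      using kpow_decompose[OF dec, of y n] assms unfolding s_def by simp
    have "(\<Sum>i<n. (kop k0 ^^ i) exit_prob y) \<le> (\<Sum>i<n. (kop kh ^^ i) exit_prob y)"
      by (intro sum_mono kpow_kernel_mono k0_le)
    also have "\<dots> \<le> pot kh exit_prob y" unfolding pot_def by (intro sum_le_suminf) auto
    finally show ?thesis by (subst eq) (rule add_right_mono)
  qed
  have "(INF n. s n x) = 0" for x
  proof (rule stay_forever_zero)
    show "(INF n. s n x) \<le> indicator cone0 x" for x using s_le[of 0 x] by (meson INF_lower2 UNIV_I)
    show "(INF n. s n x) \<le> kop kh (\<lambda>x. INF n. s n x) x" for x
    proof -
      have "(\<lambda>n. kop kh (s n) x) \<longlonglongrightarrow> kop kh (\<lambda>x. INF n. s n x) x"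
      proof (rule kop_dominated_convergence[where w = "\<lambda>_. 1"])
        show "(\<lambda>n. s n x) \<longlonglongrightarrow> (INF n. s n x)" for x
          by (intro LIMSEQ_INF decseq_SucI s_dec)
        show "s n x \<le> 1" for n x using s_le[of n x] by (rule order.trans) (simp add: indicator_def)
      qed (simp_all add: kh_sum1 kh_less_top[simplified])
      moreover have "(INF n. s n x) \<le> kop kh (s n) x" for n
      proof -
        have "(INF n. s n x) \<le> s (Suc n) x" by (rule INF_lower) simp
        also have "\<dots> = kop k0 (s n) x" by (simp add: s_def)
        also have "\<dots> \<le> kop kh (s n) x"
          unfolding kop_def using k0_le by (intro nn_integral_mono mult_right_mono) auto
        finally show ?thesis .
      qed
      ultimately show ?thesis by (intro LIMSEQ_le_const) auto
    qed
  qed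
  moreover have "1 - pot kh exit_prob y \<le> (INF n. s n y)"
    using bound by (intro INF_greatest) (simp add: ennreal_minus_le_iff)
  ultimately have "1 - pot kh exit_prob y = 0" by simp
  then show ?thesis by (simp add: diff_eq_0_iff_ennreal)
qed

end

section \<open>The invariant measure of the reversed walk and the exit mass\<close>

context walk_excessive begin

text \<open>Invariant measure of the reversed walk: this is harmonicity of \<open>u\<close> read
  through the reversal. Translations preserve it, so \<open>slice_sum\<close> integrates over the
  quotient.\<close>

definition mh :: "'v \<Rightarrow> ennreal" where "mh x = Q (- ht x) * u x"
definition Ef :: "nat \<Rightarrow> ennreal" where "Ef h = stepE (\<lambda>j d. of_nat (j - h))"
definition slice_sum :: "('v \<Rightarrow> ennreal) \<Rightarrow> ennreal" where
  "slice_sum g = (\<Sum>\<^sup>+x. indicator {x. cx x = 0} x * (mh x * g x))"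

lemma mh_shift: "mh (shift k x) = mh x"
proof -
  have "Q (- (ht x + k)) = Q (- ht x) * Q (- k)" by (simp flip: Q_add)
  then show ?thesis unfolding mh_def shift_ht u_cov by (simp add: mult.assoc)
qed

lemma mh_fin: "mh x < \<top>"
  unfolding mh_def using u_fin by (simp add: ennreal_mult_less_top)

lemma slice_sum_mono: "(\<And>x. f x \<le> g x) \<Longrightarrow> slice_sum f \<le> slice_sum g"
  unfolding slice_sum_def by (intro nn_integral_mono mult_left_mono) auto

lemma slice_sum_add: "slice_sum (\<lambda>x. f x + g x) = slice_sum f + slice_sum g"
  unfolding slice_sum_def by (simp add: distrib_left nn_integral_add)

lemma slice_sum_finite:
  assumes "\<And>x. f x < \<top>" "\<And>x. n < ax x \<Longrightarrow> f x = 0"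
  shows "slice_sum f < \<top>"
proof -
  define A where "A = {x. cx x = 0 \<and> ax x \<le> n}"
  have A: "finite A" unfolding A_def by (rule finite_axis_slice)
  have "slice_sum f = (\<Sum>\<^sup>+x. mh x * f x * indicator A x)"
    unfolding slice_sum_def A_def
    by (intro nn_integral_cong) (use assms(2) in \<open>auto simp: indicator_def not_le\<close>)
  also have "\<dots> = (\<Sum>x\<in>A. mh x * f x)"
    using A by (simp add: nn_integral_count_space_finite flip: nn_integral_count_space_indicator)
  also have "\<dots> < \<top>" using A assms(1) mh_fin by (auto simp: ennreal_mult_less_top)
  finally show ?thesis .
qed

text \<open>Mass transport exchanges the start and the end of the step; the sum over starting points
  then collapses by \<open>u_harm\<close>.\<close>

lemma slice_sum_kh:
  assumes "\<And>k x. f (shift k x) = f x"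
  shows "slice_sum (kop kh f) \<le> slice_sum f"
proof -
  have "slice_sum (kop kh f)
      = (\<Sum>\<^sup>+x. indicator {x. cx x = 0} x * (\<Sum>\<^sup>+y. mh x * kh x y * f y))"
    unfolding slice_sum_def kop_def
    by (intro nn_integral_cong arg_cong2[where f = "(*)"] refl)
       (subst nn_integral_cmult[symmetric], simp_all add: mult.assoc)
  also have "\<dots> = (\<Sum>\<^sup>+y. indicator {y. cx y = 0} y * (\<Sum>\<^sup>+x. mh x * kh x y * f y))"
    by (rule mass_transport) (simp only: mh_shift kh_Aff[OF shift_Aff] assms)
  also have "\<dots> \<le> slice_sum f"
    unfolding slice_sum_def
  proof (intro nn_integral_mono mult_left_mono)
    fix y
    have "mh x * kh x y * f y = (Q (- ht y) * f y) * (kp y x * u x)" for x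
    proof -
      have "mh x * kh x y * f y = (Q (- ht x) * Q (ht x - ht y)) * (f y * (kp y x * u x))"
        unfolding mh_def kh_def by (simp only: ac_simps)
      also have "Q (- ht x) * Q (ht x - ht y) = Q (- ht y)" by (simp flip: Q_add)
      finally show ?thesis by (simp only: mult.assoc)
    qed
    then have "(\<Sum>\<^sup>+x. mh x * kh x y * f y) = (Q (- ht y) * f y) * kop kp u y"
      unfolding kop_def by (simp add: nn_integral_cmult)
    also have "\<dots> = mh y * f y" unfolding u_harm mh_def by (simp add: ac_simps)
    finally show "(\<Sum>\<^sup>+x. mh x * kh x y * f y) \<le> mh y * f y" by simp
  qed auto
  finally show ?thesis .
qed

lemma Ef_le: "Ef h \<le> Ef 0"
  unfolding Ef_def stepE_def by (intro nn_integral_mono mult_left_mono) auto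

lemma Ef_fin: "Ef h < \<top>"
  using Ef_le[of h] j_fin unfolding Ef_def by simp

text \<open>Summing the Lyapunov inequality against the invariant measure; the truncation
  \<open>n - V\<close> has finite support modulo the shift, which makes the cancellation legitimate.\<close>

lemma slice_sum_Ef_fin: "slice_sum (\<lambda>x. Ef (ax x)) < \<top>"
proof -
  define C where "C = slice_sum (\<lambda>x. of_bool (ax x \<le> h0) * kop kh (\<lambda>x. V (ax x)) x)"
  have kV_fin: "kop kh (\<lambda>x. V (ax x)) x < \<top>" for x
    using kh_V[of x] V_step_fin[of "ax x"] by order
  have C: "C < \<top>" unfolding C_def
    by (rule slice_sum_finite[of _ h0]) (use kV_fin in auto)
  define G where "G n x = of_bool (h0 < ax x \<and> V (ax x) \<le> of_nat n) * Ef (ax x)" for n :: nat and x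
  have G_bound: "slice_sum (G n) \<le> C" for n
  proof -
    define f where "f x = of_nat n - V (ax x)" for x
    obtain H where H: "of_nat n < V H" using V_unbounded[of "of_nat n"] by (auto simp: of_nat_less_top)
    have nkop: "of_nat n \<le> kop kh f x + kop kh (\<lambda>x. V (ax x)) x" for x
    proof -
      have "of_nat n = kop kh (\<lambda>_. of_nat n * 1) x" by (simp only: kop_cmult kh_sum1) simp
      also have "\<dots> \<le> kop kh (\<lambda>y. f y + V (ax y)) x"
        unfolding f_def by (intro kop_mono) (auto simp: add_diff_self_ennreal add.commute[of "_ - _"])
      finally show ?thesis by (simp only: kop_add)
    qed
    \<comment> \<open>Near the axis the error term of C is used, further out the Lyapunov
      inequality, and where \<open>V\<close> exceeds n both terms on the left vanish.\<close>
    have pw: "f x + G n x \<le> kop kh f x + of_bool (ax x \<le> h0) * kop kh (\<lambda>x. V (ax x)) x" for x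
    proof -
      consider "ax x \<le> h0" | "h0 < ax x" "V (ax x) \<le> of_nat n" | "h0 < ax x" "of_nat n < V (ax x)"
        by (meson not_le)
      then show ?thesis
      proof cases
        case 1
        have "f x \<le> of_nat n" unfolding f_def by (rule diff_le_self_ennreal)
        then show ?thesis using nkop[of x] 1 unfolding G_def by simp
      next
        case 2
        let ?v = "kop kh (\<lambda>x. V (ax x)) x"
        have "?v + (f x + G n x) = f x + (Ef (ax x) + ?v)" unfolding G_def using 2 by (simp add: ac_simps)
        also have "\<dots> \<le> f x + V (ax x)"
          using kh_V_super[of x] 2 unfolding Ef_def by (intro add_left_mono) auto
        also have "\<dots> = of_nat n" unfolding f_def using 2 by (simp add: diff_add_cancel_ennreal)
        also have "\<dots> \<le> ?v + kop kh f x" using nkop[of x] by (simp add: add.commute)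
        finally have "f x + G n x \<le> kop kh f x" using kV_fin[of x] by (rule ennreal_add_left_le_imp)
        then show ?thesis using 2 by simp
      next
        case 3
        then have "f x = 0" "G n x = 0" unfolding f_def G_def by (auto simp: diff_eq_0_iff_ennreal of_nat_less_top)
        then show ?thesis by simp
      qed
    qed
    have "slice_sum f + slice_sum (G n) \<le> slice_sum (kop kh f) + C"
      unfolding C_def slice_sum_add[symmetric] by (intro slice_sum_mono pw)
    also have "\<dots> \<le> slice_sum f + C"
      by (intro add_right_mono slice_sum_kh) (simp add: f_def)
    finally have le: "slice_sum f + slice_sum (G n) \<le> slice_sum f + C" .
    have "slice_sum f < \<top>"
    proof (rule slice_sum_finite[of _ H])
      show "f x < \<top>" for x unfolding f_def by (rule order.strict_trans1[OF diff_le_self_ennreal]) (rule of_nat_less_top)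
      show "f x = 0" if "H < ax x" for x
        using monoD[OF V_mono, of H "ax x"] H that unfolding f_def by (simp add: diff_eq_0_iff_ennreal of_nat_less_top)
    qed
    then show ?thesis using le ennreal_add_left_le_imp by blast
  qed
  have "slice_sum (\<lambda>x. of_bool (h0 < ax x) * Ef (ax x)) \<le> C"
  proof -
    \<comment> \<open>The truncation level is released by Fatou's lemma; for fixed x the values
      \<open>G n x\<close> are eventually constant.\<close>
    have lim: "(\<lambda>x. indicator {x. cx x = 0} x * (mh x * (of_bool (h0 < ax x) * Ef (ax x))))
        = (\<lambda>x. liminf (\<lambda>n. indicator {x. cx x = 0} x * (mh x * G n x)))"
    proof
      fix x
      obtain m where m: "V (ax x) < of_nat m" using V_fin[of "ax x"] by (auto dest: ennreal_Ex_less_of_nat)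
      have "eventually (\<lambda>n. indicator {x. cx x = 0} x * (mh x * G n x)
          = indicator {x. cx x = 0} x * (mh x * (of_bool (h0 < ax x) * Ef (ax x)))) sequentially"
      proof (rule eventually_sequentiallyI[of m])
        fix n assume "m \<le> n"
        then have "V (ax x) \<le> of_nat n" using m by (meson less_imp_le of_nat_mono order.trans)
        then show "indicator {x. cx x = 0} x * (mh x * G n x)
          = indicator {x. cx x = 0} x * (mh x * (of_bool (h0 < ax x) * Ef (ax x)))" by (simp add: G_def)
      qed
      then have "(\<lambda>n. indicator {x. cx x = 0} x * (mh x * G n x))
          \<longlonglongrightarrow> indicator {x. cx x = 0} x * (mh x * (of_bool (h0 < ax x) * Ef (ax x)))"
        by (rule tendsto_eventually)
      then show "indicator {x. cx x = 0} x * (mh x * (of_bool (h0 < ax x) * Ef (ax x)))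
          = liminf (\<lambda>n. indicator {x. cx x = 0} x * (mh x * G n x))"
        by (intro lim_imp_Liminf[symmetric]) auto
    qed
    have "slice_sum (\<lambda>x. of_bool (h0 < ax x) * Ef (ax x)) \<le> liminf (\<lambda>n. slice_sum (G n))"
      unfolding slice_sum_def lim by (rule nn_integral_liminf) simp
    also have "\<dots> \<le> C" using G_bound by (intro Liminf_le) (auto intro: always_eventually)
    finally show ?thesis .
  qed
  moreover have "slice_sum (\<lambda>x. of_bool (ax x \<le> h0) * Ef (ax x)) < \<top>"
    by (rule slice_sum_finite[of _ h0]) (use Ef_fin in auto)
  moreover have "slice_sum (\<lambda>x. Ef (ax x)) = slice_sum (\<lambda>x. of_bool (h0 < ax x) * Ef (ax x))
      + slice_sum (\<lambda>x. of_bool (ax x \<le> h0) * Ef (ax x))"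
    unfolding slice_sum_add[symmetric] by (intro arg_cong[of _ _ slice_sum]) auto
  ultimately show ?thesis using C by simp
qed

text \<open>An exit from height k needs a climb of more than k levels. The translates of a slice
  point x inside the cone have heights \<open>ax x\<close>, \<open>ax x + 1\<close> and so on, so
  the tail probabilities add up to the mean overshoot \<open>Ef (ax x)\<close>.\<close>

lemma exit_mass_fin: "(\<Sum>\<^sup>+x. mh x * exit_prob x) < \<top>"
proof -
  define R where "R h = stepE (\<lambda>j d. of_bool (h < j))" for h
  have exit_le: "exit_prob x \<le> indicator cone0 x * R (nat (ht x))" for x
  proof (cases "x \<in> cone0")
    case True
    then have "kop kh (indicator (- cone0)) x \<le> R (nat (ht x))"
      unfolding R_def kop_def kh_stepE[of x, symmetric] using cone0_leave[of x] cone0_anc[of x]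
      by (intro nn_integral_mono mult_left_mono) (auto simp: indicator_def nat_less_iff)
    then show ?thesis unfolding exit_prob_def using True by simp
  qed (simp add: exit_prob_def)
  have R_sum: "(\<Sum>k. R (a + k)) = Ef a" for a
  proof -
    have "(\<Sum>k. R (a + k)) = (\<Sum>\<^sup>+x. (\<Sum>k. kp rt x * of_bool (a + k < up pr x rt)))"
      unfolding R_def stepE_def by (rule nn_integral_suminf[symmetric]) simp
    also have "\<dots> = Ef a"
      unfolding Ef_def stepE_def
    proof (rule nn_integral_cong)
      fix x
      have "(\<Sum>k. of_bool (a + k < up pr x rt) :: ennreal) = (\<Sum>k\<in>{..<up pr x rt - a}. of_bool (a + k < up pr x rt))"
        by (rule suminf_finite) auto
      also have "\<dots> = (\<Sum>k\<in>{..<up pr x rt - a}. 1)" by (intro sum.cong) auto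
      finally show "(\<Sum>k. kp rt x * of_bool (a + k < up pr x rt)) = kp rt x * of_nat (up pr x rt - a)"
        by simp
    qed
    finally show ?thesis .
  qed
  have "(\<Sum>\<^sup>+x. mh x * exit_prob x)
      \<le> (\<Sum>\<^sup>+x. mh x * (indicator cone0 x * R (nat (ht x))))"
    by (intro nn_integral_mono mult_left_mono exit_le) auto
  also have "\<dots> = (\<Sum>\<^sup>+x. indicator {x. cx x = 0} x * (\<Sum>\<^sup>+k. mh (shift k x) *
      (indicator cone0 (shift k x) * R (nat (ht (shift k x))))))"
    by (rule nn_integral_shift_slices)
  also have "\<dots> = slice_sum (\<lambda>x. Ef (ax x))"
    unfolding slice_sum_def
  proof (rule nn_integral_cong)
    fix x
    show "indicator {x. cx x = 0} x * (\<Sum>\<^sup>+k. mh (shift k x) *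
      (indicator cone0 (shift k x) * R (nat (ht (shift k x)))))
      = indicator {x. cx x = 0} x * (mh x * Ef (ax x))"
    proof (cases "cx x = 0")
      case True
      then have ht: "ht x = int (ax x)" unfolding cx_def by simp
      have rng: "range int = {k. 0 \<le> k}" by (auto simp: image_def) (metis nonneg_int_cases)
      have "(\<Sum>\<^sup>+k. mh (shift k x) * (indicator cone0 (shift k x) * R (nat (ht (shift k x)))))
          = (\<Sum>\<^sup>+k. mh x * R (nat (int (ax x) + k)) * indicator (range int) k)"
        unfolding rng by (intro nn_integral_cong) (simp add: mh_shift ht cone0_iff True indicator_def)
      also have "\<dots> = (\<Sum>\<^sup>+k. mh x * R (nat (int (ax x) + int k)))"
        by (rule nn_integral_inj_range) simp
      also have "\<dots> = (\<Sum>k. mh x * R (ax x + k))"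
        by (simp add: nn_integral_count_space_nat nat_int_add)
      also have "\<dots> = mh x * Ef (ax x)" by (simp add: R_sum)
      finally show ?thesis by simp
    qed simp
  qed
  also have "\<dots> < \<top>" by (rule slice_sum_Ef_fin)
  finally show ?thesis .
qed

end

section \<open>The ratio limit along the axis\<close>

text \<open>In \<open>ennreal\<close> a limsup is always the limit of a subsequence, so diagonal
  selection works without any bound.\<close>

lemma pointwise_convergent_subseq:
  fixes f :: "nat \<Rightarrow> 'a \<Rightarrow> ennreal"
  assumes "countable (UNIV :: 'a set)"
  shows "\<exists>r L. strict_mono (r :: nat \<Rightarrow> nat) \<and> (\<forall>x. (\<lambda>n. f (r n) x) \<longlonglongrightarrow> L x)"
proof -
  define e where "e = from_nat_into (UNIV :: 'a set)"
  have e: "\<exists>i. x = e i" for x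
    unfolding e_def using from_nat_into_surj[OF assms, of x] by auto
  interpret subseqs "\<lambda>i s. convergent (\<lambda>n. f (s n) (e i))"
  proof
    fix i and s :: "nat \<Rightarrow> nat" assume "strict_mono s"
    obtain r :: "nat \<Rightarrow> nat" where "strict_mono r" "((\<lambda>n. f (s n) (e i)) \<circ> r) \<longlonglongrightarrow> limsup (\<lambda>n. f (s n) (e i))"
      using limsup_subseq_lim by blast
    then show "\<exists>r. strict_mono r \<and> convergent (\<lambda>n. f ((s \<circ> r) n) (e i))"
      by (auto simp: convergent_def o_def)
  qed
  have "convergent (\<lambda>n. f (diagseq n) (e i))" for i
  proof -
    have "convergent (\<lambda>n. f ((diagseq \<circ> (+) (Suc i)) n) (e i))"
    proof (rule diagseq_holds)
      fix r s :: "nat \<Rightarrow> nat" and n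
      assume "strict_mono r" "convergent (\<lambda>k. f (s k) (e n))"
      then show "convergent (\<lambda>k. f ((s \<circ> r) k) (e n))"
        using convergent_subseq_convergent[of "\<lambda>k. f (s k) (e n)" r] by (simp add: o_def)
    qed
    then have "convergent (\<lambda>n. f (diagseq (n + Suc i)) (e i))" by (simp add: add.commute)
    then obtain L where "(\<lambda>n. f (diagseq (n + Suc i)) (e i)) \<longlonglongrightarrow> L" unfolding convergent_def by blast
    then have "(\<lambda>n. f (diagseq n) (e i)) \<longlonglongrightarrow> L"
      by (rule LIMSEQ_offset[where f = "\<lambda>n. f (diagseq n) (e i)"])
    then show ?thesis by (rule convergentI)
  qed
  then have "convergent (\<lambda>n. f (diagseq n) x)" for x using e[of x] by auto
  then have "\<forall>x. (\<lambda>n. f (diagseq n) x) \<longlonglongrightarrow> lim (\<lambda>n. f (diagseq n) x)"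
    by (simp add: convergent_LIMSEQ_iff)
  then show ?thesis using subseq_diagseq by (intro exI conjI)
qed

context walk_excessive begin

definition gh :: "int \<Rightarrow> 'v \<Rightarrow> ennreal" where "gh h x = Q h * pot kp (indicator {\<xi> h}) x"

text \<open>The constant of \<open>green_domination\<close> for y on the axis; translation makes it
  the same for every h.\<close>

definition Cg :: ennreal where "Cg = pot kp (indicator {\<xi> 0}) (\<xi> 0) / u (\<xi> 0)"

lemma Cg_fin: "Cg < \<top>"
  unfolding Cg_def using transient[of "\<xi> 0" "\<xi> 0"] u_pos[of "\<xi> 0"]
  by (metis ennreal_divide_eq_top_iff less_irrefl less_top)

lemma Cu_fin: "Cg * u x < \<top>"
  using Cg_fin u_fin[of x] by (simp add: ennreal_mult_less_top)

lemma gh_le: "gh h x \<le> Cg * u x"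
proof -
  have u0: "u (\<xi> 0) \<noteq> 0" "u (\<xi> 0) \<noteq> \<top>"
    using u_pos[of "\<xi> 0"] u_fin[of "\<xi> 0"] by (auto simp: less_top[symmetric])
  have "pot kp (indicator {\<xi> h}) x * u (\<xi> h) \<le> pot kp (indicator {\<xi> h}) (\<xi> h) * u x"
    by (rule green_domination)
  also have "pot kp (indicator {\<xi> h}) (\<xi> h) = pot kp (indicator {\<xi> 0}) (\<xi> 0)"
    using pot_kp_shift[of h "\<xi> 0" "\<xi> 0"] by simp
  finally have "gh h x * u (\<xi> 0) \<le> pot kp (indicator {\<xi> 0}) (\<xi> 0) * u x"
    unfolding gh_def u_xi[of h] by (simp add: ac_simps)
  then have "gh h x * u (\<xi> 0) / u (\<xi> 0) \<le> pot kp (indicator {\<xi> 0}) (\<xi> 0) * u x / u (\<xi> 0)"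
    by (rule divide_right_mono_ennreal)
  moreover have "gh h x * u (\<xi> 0) / u (\<xi> 0) = gh h x" using u0 by (simp add: ennreal_mult_divide_eq)
  moreover have "pot kp (indicator {\<xi> 0}) (\<xi> 0) * u x / u (\<xi> 0) = Cg * u x"
    unfolding Cg_def by (simp add: ennreal_divide_times ennreal_times_divide)
  ultimately show ?thesis by simp
qed

lemma gh_fin: "gh h x < \<top>"
  using gh_le[of h x] Cu_fin[of x] by order

lemma gh_shift: "gh (h + k) (shift k x) = Q k * gh h x"
  unfolding gh_def using pot_kp_shift[of k "\<xi> h" x] by (simp add: Q_add ac_simps)

lemma gh_unfold: "gh h x = Q h * indicator {\<xi> h} x + kop kp (gh h) x"
proof -
  have "gh h = (\<lambda>x. Q h * pot kp (indicator {\<xi> h}) x)" by (auto simp: gh_def)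
  then show ?thesis using pot_unfold[of kp "indicator {\<xi> h}" x] by (simp add: kop_cmult distrib_left)
qed

text \<open>By \<open>gh_xi\<close> this sequence in a single variable contains all values of the
  functions \<open>gh h\<close> on the axis.\<close>

definition gam :: "int \<Rightarrow> real" where "gam h = enn2real (gh h (\<xi> 0))"

lemma gam_nonneg: "gam h \<ge> 0" unfolding gam_def by simp

lemma gh_xi: "gh h (\<xi> k) = Q k * ennreal (gam (h - k))"
  using gh_shift[of "h - k" k "\<xi> 0"] gh_fin[of "h - k" "\<xi> 0"] unfolding gam_def by simp

definition Bg :: real where "Bg = enn2real (Cg * u (\<xi> 0))"

lemma gam_le: "gam h \<le> Bg"
  unfolding gam_def Bg_def by (intro enn2real_mono gh_le Cu_fin)

definition glim :: "(nat \<Rightarrow> nat) \<Rightarrow> ('v \<Rightarrow> ennreal) \<Rightarrow> bool" where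
  "glim s L \<longleftrightarrow> strict_mono s \<and> (\<forall>x. (\<lambda>n. gh (int (s n)) x) \<longlonglongrightarrow> L x)"

lemma glim_exists: assumes "strict_mono (s :: nat \<Rightarrow> nat)" shows "\<exists>r L. strict_mono r \<and> glim (s \<circ> r) L"
proof -
  obtain r L where "strict_mono r" "\<forall>x. (\<lambda>n. gh (int (s (r n))) x) \<longlonglongrightarrow> L x"
    using pointwise_convergent_subseq[OF countable_vertices, of "\<lambda>n. gh (int (s n))"] by blast
  then show ?thesis unfolding glim_def using assms by (auto intro: strict_mono_o)
qed

lemma glim_le: "glim s L \<Longrightarrow> L x \<le> Cg * u x"
  unfolding glim_def by (meson LIMSEQ_le_const2 gh_le)

lemma glim_fin: assumes "glim s L" shows "L x < \<top>"
  using glim_le[OF assms, of x] Cu_fin[of x] by order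

text \<open>\<open>gh h\<close> fails to be harmonic only at its pole \<xi> h, which moves away from
  every fixed x; the common majorant Cg u justifies the limit.\<close>

lemma glim_harm: assumes "glim s L" shows "kop kp L x = L x"
proof -
  have lim: "(\<lambda>n. gh (int (s n)) x) \<longlonglongrightarrow> L x" for x using assms unfolding glim_def by blast
  have "kop kp (\<lambda>y. Cg * u y) x < \<infinity>" by (simp add: kop_cmult u_harm Cu_fin[simplified])
  then have "(\<lambda>n. kop kp (gh (int (s n))) x) \<longlonglongrightarrow> kop kp L x"
    by (intro kop_dominated_convergence[where w = "\<lambda>y. Cg * u y"] lim gh_le) auto
  moreover have "eventually (\<lambda>n. kop kp (gh (int (s n))) x = gh (int (s n)) x) sequentially"
  proof (rule eventually_sequentiallyI[of "nat (ht x) + 1"])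
    fix n assume n: "nat (ht x) + 1 \<le> n"
    have "n \<le> s n" using assms unfolding glim_def by (simp add: seq_suble)
    then have "ht x \<noteq> int (s n)" using n by linarith
    then have "x \<noteq> \<xi> (int (s n))" by auto
    then show "kop kp (gh (int (s n))) x = gh (int (s n)) x" using gh_unfold[of "int (s n)" x] by simp
  qed
  ultimately have "(\<lambda>n. gh (int (s n)) x) \<longlonglongrightarrow> kop kp L x" by (rule Lim_transform_eventually)
  then show ?thesis using lim[of x] by (rule LIMSEQ_unique)
qed

text \<open>Axis values with the covariance factor removed: L is a multiple of \<open>u\<close> on
  the axis exactly when this is constant in k.\<close>

definition ell :: "('v \<Rightarrow> ennreal) \<Rightarrow> int \<Rightarrow> real" where "ell L k = enn2real (Q (- k) * L (\<xi> k))"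

lemma glim_xi: assumes "glim s L" shows "L (\<xi> k) = Q k * ennreal (ell L k)"
proof -
  have "Q (- k) * L (\<xi> k) < \<top>" using glim_fin[OF assms] by (simp add: ennreal_mult_less_top)
  then show ?thesis unfolding ell_def by simp
qed

lemma ell_nonneg: "ell L k \<ge> 0" unfolding ell_def by simp

lemma ell_lim: assumes "glim s L" shows "(\<lambda>n. gam (int (s n) - k)) \<longlonglongrightarrow> ell L k"
proof -
  have "(\<lambda>n. gh (int (s n)) (\<xi> k)) \<longlonglongrightarrow> L (\<xi> k)" using assms unfolding glim_def by blast
  then have "(\<lambda>n. Q (- k) * gh (int (s n)) (\<xi> k)) \<longlonglongrightarrow> Q (- k) * L (\<xi> k)"
    by (intro ennreal_tendsto_cmult) auto
  then have "(\<lambda>n. ennreal (gam (int (s n) - k))) \<longlonglongrightarrow> ennreal (ell L k)"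
    unfolding gh_xi glim_xi[OF assms] by simp
  then show ?thesis using gam_nonneg ell_nonneg by (simp add: tendsto_ennreal_iff)
qed

lemma ell_le: "glim s L \<Longrightarrow> ell L k \<le> Bg"
  using ell_lim[of s L k] gam_le by (meson LIMSEQ_le_const2)

lemma u0_real: "u (\<xi> 0) = ennreal (enn2real (u (\<xi> 0)))" "enn2real (u (\<xi> 0)) > 0"
  using u_fin[of "\<xi> 0"] u_pos[of "\<xi> 0"] by (auto simp: enn2real_positive_iff)

text \<open>The translate of L by one step, rescaled so that \<open>u\<close> would be unchanged. It
  is again harmonic with the same majorant, and its normalized axis values are those of L displaced
  by one.\<close>

lemma glim_shifted:
  assumes "glim s L"
  shows "kop kp (\<lambda>y. Q 1 * L (shift (-1) y)) x = Q 1 * L (shift (-1) x)"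
    "Q 1 * L (shift (-1) x) \<le> Cg * u x"
    "Q 1 * L (shift (-1) (\<xi> k)) = Q k * ennreal (ell L (k - 1))"
proof -
  show "kop kp (\<lambda>y. Q 1 * L (shift (-1) y)) x = Q 1 * L (shift (-1) x)"
    unfolding kop_cmult kop_kp_shift[symmetric] glim_harm[OF assms] ..
  have "Q 1 * L (shift (-1) x) \<le> Q 1 * (Cg * u (shift (-1) x))"
    by (intro mult_left_mono glim_le[OF assms]) auto
  also have "\<dots> = Cg * u x" unfolding u_cov by (simp add: mult.left_commute[of Cg])
  finally show "Q 1 * L (shift (-1) x) \<le> Cg * u x" .
  have "Q 1 * Q (k - 1) = Q k" by (simp flip: Q_add)
  then show "Q 1 * L (shift (-1) (\<xi> k)) = Q k * ennreal (ell L (k - 1))"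
    using glim_xi[OF assms, of "k - 1"] by (simp flip: mult.assoc)
qed

text \<open>Adding this multiple of \<open>u\<close> raises all normalized axis values by the
  constant M.\<close>

lemma Cu_plus:
  assumes "M \<ge> 0"
  defines "\<kappa> \<equiv> ennreal (M / enn2real (u (\<xi> 0)))"
  shows "\<kappa> * u (\<xi> k) = Q k * ennreal M" "\<kappa> * u x < \<top>" "kop kp (\<lambda>x. \<kappa> * u x) x = \<kappa> * u x"
proof -
  have "\<kappa> * u (\<xi> 0) = ennreal M"
  proof -
    define r where "r = enn2real (u (\<xi> 0))"
    have "u (\<xi> 0) = ennreal r" "r > 0" unfolding r_def using u0_real by auto
    then show ?thesis unfolding \<kappa>_def using assms(1) by (simp flip: ennreal_mult')
  qed
  then show "\<kappa> * u (\<xi> k) = Q k * ennreal M" 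
    unfolding u_xi[of k] mult.left_commute[of \<kappa> "Q k" "u (\<xi> 0)"] by simp
  show "\<kappa> * u x < \<top>" unfolding \<kappa>_def using u_fin[of x] by (simp add: ennreal_mult_less_top)
  show "kop kp (\<lambda>x. \<kappa> * u x) x = \<kappa> * u x" by (simp add: kop_cmult u_harm)
qed

lemma no_linear_growth:
  fixes a :: "int \<Rightarrow> real"
  assumes "\<And>k. a (k - 1) = a k + M" "M > 0" "\<And>k. a k \<le> B"
  shows False
proof -
  have lin: "a (- int n) = a 0 + real n * M" for n
  proof (induction n)
    case (Suc n)
    have "- int (Suc n) = - int n - 1" by simp
    then have "a (- int (Suc n)) = a (- int n) + M" by (simp only: assms(1))
    then show ?case using Suc by (simp add: algebra_simps)
  qed simp
  obtain n where "real n * M > B - a 0" using reals_Archimedean3[OF assms(2)] by blast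
  then show False using lin[of n] assms(3)[of "- int n"] by simp
qed

text \<open>If the largest increment M is attained, the translate of L touches L plus a multiple of
  \<open>u\<close> from below at \<xi> 0. Comparison on the axis and \<open>harmonic_touch\<close>
  make the two equal, so every increment is M and \<open>ell L\<close> grows linearly against its
  bound.\<close>

lemma no_increase:
  assumes L: "glim s L" and M: "M > 0" and ax: "\<And>k. ell L (k - 1) \<le> ell L k + M"
    and eq: "ell L (-1) = ell L 0 + M"
  shows False
proof -
  define \<kappa> where "\<kappa> = ennreal (M / enn2real (u (\<xi> 0)))"
  note \<kappa> = Cu_plus[of M, folded \<kappa>_def]
  define f where "f x = Q 1 * L (shift (-1) x)" for x
  define g where "g x = L x + \<kappa> * u x" for x
  have fh: "kop kp f x = f x" for x
    using glim_shifted(1)[OF L, of x] by (simp add: f_def[abs_def])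
  have ghm: "kop kp g x = g x" for x
    using M by (simp add: g_def[abs_def] kop_add \<kappa>(3) glim_harm[OF L])
  have gfin: "g x < \<top>" for x unfolding g_def using \<kappa>(2) M glim_fin[OF L] by simp
  have fxi: "f (\<xi> k) = Q k * ennreal (ell L (k - 1))" for k unfolding f_def by (rule glim_shifted(3)[OF L])
  have gxi: "g (\<xi> k) = Q k * ennreal (ell L k + M)" for k
    unfolding g_def using \<kappa>(1) M glim_xi[OF L, of k] ell_nonneg[of L k] by (simp add: distrib_left)
  have le: "f x \<le> g x" for x
  proof (rule axis_comparison[OF fh ghm _ Cg_fin gfin])
    show "f x \<le> Cg * u x" for x unfolding f_def by (rule glim_shifted(2)[OF L])
    show "f (\<xi> k) \<le> g (\<xi> k)" for k
      unfolding fxi gxi by (intro mult_left_mono ennreal_leI ax) auto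
  qed
  have "f x = g x" for x
  proof (rule harmonic_touch[OF fh ghm le gfin])
    show "f (\<xi> 0) = g (\<xi> 0)" unfolding fxi gxi using eq by simp
  qed
  then have "Q k * ennreal (ell L (k - 1)) = Q k * ennreal (ell L k + M)" for k
    using fxi gxi by metis
  then have "Q (- k) * (Q k * ennreal (ell L (k - 1))) = Q (- k) * (Q k * ennreal (ell L k + M))" for k
    by metis
  then have "ennreal (ell L (k - 1)) = ennreal (ell L k + M)" for k by (simp only: Q_cancel')
  then have "ell L (k - 1) = ell L k + M" for k
    using ell_nonneg[of L] M by (metis add_nonneg_nonneg ennreal_inj less_imp_le)
  then show False using no_linear_growth[of "ell L" M Bg] M ell_le[OF L] by blast
qed

text \<open>The same argument with L and its translate exchanged; the growth now appears for
  increasing k.\<close>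

lemma no_decrease:
  assumes L: "glim s L" and M: "M > 0" and ax: "\<And>k. ell L k \<le> ell L (k - 1) + M"
    and eq: "ell L 0 = ell L (-1) + M"
  shows False
proof -
  define \<kappa> where "\<kappa> = ennreal (M / enn2real (u (\<xi> 0)))"
  note \<kappa> = Cu_plus[of M, folded \<kappa>_def]
  define f where "f x = Q 1 * L (shift (-1) x)" for x
  define g where "g x = f x + \<kappa> * u x" for x
  have fh: "kop kp f x = f x" for x
    using glim_shifted(1)[OF L, of x] by (simp add: f_def[abs_def])
  have ghm: "kop kp g x = g x" for x
    using M by (simp add: g_def[abs_def] kop_add \<kappa>(3) fh)
  have ffin: "f x < \<top>" for x
    unfolding f_def using glim_fin[OF L] by (simp add: ennreal_mult_less_top)
  have gfin: "g x < \<top>" for x unfolding g_def using \<kappa>(2) M ffin by simp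
  have fxi: "f (\<xi> k) = Q k * ennreal (ell L (k - 1))" for k unfolding f_def by (rule glim_shifted(3)[OF L])
  have gxi: "g (\<xi> k) = Q k * ennreal (ell L (k - 1) + M)" for k
    unfolding g_def using \<kappa>(1) M fxi[of k] ell_nonneg[of L "k - 1"] by (simp add: distrib_left)
  have le: "L x \<le> g x" for x
  proof (rule axis_comparison[OF glim_harm[OF L] ghm glim_le[OF L] Cg_fin gfin])
    show "L (\<xi> k) \<le> g (\<xi> k)" for k
      unfolding glim_xi[OF L] gxi by (intro mult_left_mono ennreal_leI ax) auto
  qed
  have "L x = g x" for x
  proof (rule harmonic_touch[OF glim_harm[OF L] ghm le gfin])
    show "L (\<xi> 0) = g (\<xi> 0)" unfolding glim_xi[OF L] gxi using eq by simp
  qed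
  then have "Q k * ennreal (ell L k) = Q k * ennreal (ell L (k - 1) + M)" for k
    using glim_xi[OF L] gxi by metis
  then have "Q (- k) * (Q k * ennreal (ell L k)) = Q (- k) * (Q k * ennreal (ell L (k - 1) + M))" for k
    by metis
  then have "ennreal (ell L k) = ennreal (ell L (k - 1) + M)" for k by (simp only: Q_cancel')
  then have st: "ell L k = ell L (k - 1) + M" for k
    using ell_nonneg[of L] M by (metis add_nonneg_nonneg ennreal_inj less_imp_le)
  have "ell L (- (k - 1)) = ell L (- k) + M" for k
    using st[of "- (k - 1)"] by simp
  then show False using no_linear_growth[of "\<lambda>k. ell L (- k)" M Bg] M ell_le[OF L] by blast
qed

end

section \<open>Vanishing increments along the axis and the ratio limit\<close>

lemma bounded_limsup_subseq:
  fixes D :: "nat \<Rightarrow> real"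
  assumes "\<And>n. \<bar>D n\<bar> \<le> B"
  shows "\<exists>m s. strict_mono (s :: nat \<Rightarrow> nat) \<and> (\<lambda>n. D (s n)) \<longlonglongrightarrow> m
      \<and> (\<forall>e>0. eventually (\<lambda>n. D n < m + e) sequentially)"
proof -
  define M where "M = limsup (\<lambda>n. ereal (D n))"
  have "- B \<le> D n \<and> D n \<le> B" for n using assms[of n] by (simp add: abs_le_iff)
  then have "M \<le> ereal B" "ereal (- B) \<le> M"
    unfolding M_def
    by (auto intro!: Limsup_bounded always_eventually le_Limsup simp del: uminus_ereal.simps)
  then obtain m where m: "M = ereal m" by (cases M) auto
  obtain s :: "nat \<Rightarrow> nat" where s: "strict_mono s" "((\<lambda>n. ereal (D n)) \<circ> s) \<longlonglongrightarrow> M"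
    unfolding M_def using limsup_subseq_lim by blast
  have "(\<lambda>n. D (s n)) \<longlonglongrightarrow> m" using s(2) unfolding m by (simp add: o_def)
  moreover have "eventually (\<lambda>n. D n < m + e) sequentially" if "e > 0" for e
    using Limsup_lessD[of sequentially "\<lambda>n. ereal (D n)" "ereal (m + e)"] m that unfolding M_def by auto
  ultimately show ?thesis using s(1) by blast
qed

context walk_excessive begin

definition dg :: "int \<Rightarrow> real" where "dg h = gam (h + 1) - gam h"

lemma dg_bound: "\<bar>dg h\<bar> \<le> Bg"
  unfolding dg_def using gam_nonneg[of h] gam_nonneg[of "h + 1"] gam_le[of h] gam_le[of "h + 1"] by linarith

lemma ell_diff_lim:
  assumes "glim s L" shows "(\<lambda>n. dg (int (s n) - k)) \<longlonglongrightarrow> ell L (k - 1) - ell L k"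
proof -
  have "(\<lambda>n. gam (int (s n) - (k - 1)) - gam (int (s n) - k)) \<longlonglongrightarrow> ell L (k - 1) - ell L k"
    by (intro tendsto_diff ell_lim assms)
  moreover have "int (s n) - (k - 1) = int (s n) - k + 1" for n by simp
  ultimately show ?thesis unfolding dg_def by simp
qed

lemma eventually_shifted:
  assumes "strict_mono (s :: nat \<Rightarrow> nat)" "eventually (\<lambda>n. P (int n)) sequentially"
  shows "eventually (\<lambda>n. P (int (s n) - k)) sequentially"
proof -
  obtain N where N: "\<And>n. n \<ge> N \<Longrightarrow> P (int n)" using assms(2) unfolding eventually_sequentially by blast
  show ?thesis
  proof (rule eventually_sequentiallyI[of "N + nat k"])
    fix n assume "N + nat k \<le> n"
    moreover have "n \<le> s n" using assms(1) by (rule seq_suble)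
    ultimately have "N \<le> nat (int (s n) - k)" "0 \<le> int (s n) - k" by linarith+
    then show "P (int (s n) - k)" using N[of "nat (int (s n) - k)"] by simp
  qed
qed

text \<open>Let the increments tend to their limsup m along a subsequence with limit function L. All
  increments of \<open>ell L\<close> are then at most m, with equality at 0, which
  \<open>no_increase\<close> excludes for m > 0. The negated increments are treated alike with
  \<open>no_decrease\<close>.\<close>

lemma dg_tendsto_0: "(\<lambda>n. dg (int n)) \<longlonglongrightarrow> 0"
proof -
  have up: "eventually (\<lambda>n. dg (int n) < e) sequentially" if e: "e > 0" for e
  proof -
    obtain m s where s: "strict_mono s" "(\<lambda>n. dg (int (s n))) \<longlonglongrightarrow> m"
        "\<forall>e>0. eventually (\<lambda>n. dg (int n) < m + e) sequentially"
      using bounded_limsup_subseq[of "\<lambda>n. dg (int n)" Bg] dg_bound by blast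
    have "m \<le> 0"
    proof (rule ccontr)
      assume "\<not> m \<le> 0"
      then have m: "m > 0" by simp
      obtain r L where r: "strict_mono r" "glim (s \<circ> r) L" using glim_exists[OF s(1)] by blast
      have sr: "strict_mono (s \<circ> r)" using s r by (simp add: strict_mono_o)
      have "ell L (k - 1) \<le> ell L k + m" for k
      proof (rule field_le_epsilon)
        fix e :: real assume "0 < e"
        then have "eventually (\<lambda>n. dg (int ((s \<circ> r) n) - k) < m + e) sequentially"
          by (intro eventually_shifted[OF sr]) (use s(3) in blast)
        then have "eventually (\<lambda>n. dg (int ((s \<circ> r) n) - k) \<le> m + e) sequentially"
          by (rule eventually_mono) simp
        then have "ell L (k - 1) - ell L k \<le> m + e"
          by (rule tendsto_upperbound[OF ell_diff_lim[OF r(2)]]) simp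
        then show "ell L (k - 1) \<le> ell L k + m + e" by simp
      qed
      moreover have "ell L (-1) = ell L 0 + m"
      proof -
        have "(\<lambda>n. dg (int ((s \<circ> r) n))) \<longlonglongrightarrow> m"
          using LIMSEQ_subseq_LIMSEQ[OF s(2) r(1)] by (simp add: o_def)
        moreover have "(\<lambda>n. dg (int ((s \<circ> r) n))) \<longlonglongrightarrow> ell L (-1) - ell L 0"
          using ell_diff_lim[OF r(2), of 0] by simp
        ultimately have "m = ell L (-1) - ell L 0" by (rule LIMSEQ_unique)
        then show ?thesis by simp
      qed
      ultimately show False using no_increase[OF r(2) m] by blast
    qed
    have "eventually (\<lambda>n. dg (int n) < m + e) sequentially" using s(3) e by blast
    then show ?thesis by (rule eventually_mono) (use \<open>m \<le> 0\<close> in linarith)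
  qed
  have down: "eventually (\<lambda>n. - dg (int n) < e) sequentially" if e: "e > 0" for e
  proof -
    obtain m s where s: "strict_mono s" "(\<lambda>n. - dg (int (s n))) \<longlonglongrightarrow> m"
        "\<forall>e>0. eventually (\<lambda>n. - dg (int n) < m + e) sequentially"
      using bounded_limsup_subseq[of "\<lambda>n. - dg (int n)" Bg] dg_bound by auto
    have "m \<le> 0"
    proof (rule ccontr)
      assume "\<not> m \<le> 0"
      then have m: "m > 0" by simp
      obtain r L where r: "strict_mono r" "glim (s \<circ> r) L" using glim_exists[OF s(1)] by blast
      have sr: "strict_mono (s \<circ> r)" using s r by (simp add: strict_mono_o)
      have "ell L k \<le> ell L (k - 1) + m" for k
      proof (rule field_le_epsilon)
        fix e :: real assume "0 < e"
        then have "eventually (\<lambda>n. - dg (int ((s \<circ> r) n) - k) < m + e) sequentially"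
          by (intro eventually_shifted[OF sr, of "\<lambda>h. - dg h < m + e"]) (use s(3) in blast)
        then have "eventually (\<lambda>n. - dg (int ((s \<circ> r) n) - k) \<le> m + e) sequentially"
          by (rule eventually_mono) simp
        then have "- (ell L (k - 1) - ell L k) \<le> m + e"
          by (rule tendsto_upperbound[OF tendsto_minus[OF ell_diff_lim[OF r(2)]]]) simp
        then show "ell L k \<le> ell L (k - 1) + m + e" by simp
      qed
      moreover have "ell L 0 = ell L (-1) + m"
      proof -
        have "(\<lambda>n. - dg (int ((s \<circ> r) n))) \<longlonglongrightarrow> m"
          using LIMSEQ_subseq_LIMSEQ[OF s(2) r(1)] by (simp add: o_def)
        moreover have "(\<lambda>n. - dg (int ((s \<circ> r) n))) \<longlonglongrightarrow> - (ell L (-1) - ell L 0)"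
          using tendsto_minus[OF ell_diff_lim[OF r(2), of 0]] by simp
        ultimately have "m = - (ell L (-1) - ell L 0)" by (rule LIMSEQ_unique)
        then show ?thesis by simp
      qed
      ultimately show False using no_decrease[OF r(2) m] by blast
    qed
    have "eventually (\<lambda>n. - dg (int n) < m + e) sequentially" using s(3) e by blast
    then show ?thesis by (rule eventually_mono) (use \<open>m \<le> 0\<close> in linarith)
  qed
  show ?thesis
    unfolding tendsto_iff
  proof (intro allI impI)
    fix e :: real assume e: "0 < e"
    show "eventually (\<lambda>n. dist (dg (int n)) 0 < e) sequentially"
      using up[OF e] down[OF e] by eventually_elim (simp add: dist_real_def abs_less_iff)
  qed
qed

lemma glim_eq:
  assumes L: "glim s L"
  shows "\<exists>\<kappa>. 0 < \<kappa> \<and> \<kappa> < \<top> \<and> (\<forall>x. L x = \<kappa> * u x)"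
proof -
  have s: "strict_mono s" using L unfolding glim_def by blast
  have st: "ell L (k - 1) = ell L k" for k
  proof -
    have "(\<lambda>n. dg (int (s n) - k)) \<longlonglongrightarrow> 0"
      unfolding tendsto_iff
    proof (intro allI impI)
      fix e :: real assume "0 < e"
      then have "eventually (\<lambda>n. dist (dg (int n)) 0 < e) sequentially"
        using dg_tendsto_0 unfolding tendsto_iff by blast
      then show "eventually (\<lambda>n. dist (dg (int (s n) - k)) 0 < e) sequentially"
        by (rule eventually_shifted[OF s])
    qed
    then have "ell L (k - 1) - ell L k = 0" using ell_diff_lim[OF L] LIMSEQ_unique by blast
    then show ?thesis by simp
  qed
  have cst: "ell L k = ell L 0" for k
  proof (induction k rule: int_induct[where k = 0])
    case (step1 i)
    then show ?case using st[of "i + 1"] by simp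
  next
    case (step2 i)
    then show ?case using st[of i] by simp
  qed simp
  define \<kappa> where "\<kappa> = ennreal (ell L 0 / enn2real (u (\<xi> 0)))"
  note \<kappa> = Cu_plus[OF ell_nonneg, of L 0, folded \<kappa>_def]
  have xi_eq: "L (\<xi> k) = \<kappa> * u (\<xi> k)" for k unfolding \<kappa>(1) using glim_xi[OF L, of k] cst[of k] by simp
  have "L x \<le> \<kappa> * u x" for x
    by (rule axis_comparison[OF glim_harm[OF L] \<kappa>(3) glim_le[OF L] Cg_fin \<kappa>(2)]) (simp add: xi_eq)
  moreover have "\<kappa> * u x \<le> L x" for x
    by (rule axis_comparison[where f = "\<lambda>x. \<kappa> * u x" and C = \<kappa>, OF \<kappa>(3) glim_harm[OF L] _ _ glim_fin[OF L]])
      (simp_all add: xi_eq \<kappa>_def)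
  ultimately have eq: "L x = \<kappa> * u x" for x by (simp add: order.antisym)
  \<comment> \<open>For \<kappa> = 0 the functions \<open>gh\<close> tend to zero, and by domination
    with the finite exit mass so does the flux out of the cone, although \<open>exit_flux\<close>
    keeps it at least 1.\<close>
  have "\<kappa> \<noteq> 0"
  proof
    assume "\<kappa> = 0"
    then have L0: "L x = 0" for x using eq by simp
    have flux: "1 \<le> (\<Sum>\<^sup>+x. Q (- ht x) * gh (int (s n)) x * exit_prob x)" for n
    proof -
      have "1 \<le> pot kh exit_prob (\<xi> (int (s n)))" by (rule exit_flux) (simp add: cone0_iff)
      also have "\<dots> = (\<Sum>\<^sup>+x. pot kh (indicator {x}) (\<xi> (int (s n))) * exit_prob x)"
        by (rule pot_eq_nn_integral)
      also have "\<dots> = (\<Sum>\<^sup>+x. Q (- ht x) * gh (int (s n)) x * exit_prob x)"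
      proof (rule nn_integral_cong)
        fix x
        have "Q (int (s n) - ht x) = Q (- ht x) * Q (int (s n))" by (simp flip: Q_add)
        then show "pot kh (indicator {x}) (\<xi> (int (s n))) * exit_prob x
            = Q (- ht x) * gh (int (s n)) x * exit_prob x"
          unfolding kh_pot gh_def by (simp add: mult.assoc)
      qed
      finally show ?thesis .
    qed
    have "(\<lambda>n. \<Sum>\<^sup>+x. Q (- ht x) * gh (int (s n)) x * exit_prob x)
        \<longlonglongrightarrow> (\<integral>\<^sup>+x. 0 \<partial>count_space (UNIV :: 'v set))"
    proof (rule nn_integral_dominated_convergence[where w = "\<lambda>x. Cg * (mh x * exit_prob x)"])
      show "AE x in count_space UNIV. Q (- ht x) * gh (int (s n)) x * exit_prob x \<le> Cg * (mh x * exit_prob x)" for n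
      proof (rule AE_I2)
        fix x
        have "Q (- ht x) * gh (int (s n)) x * exit_prob x \<le> Q (- ht x) * (Cg * u x) * exit_prob x"
          by (intro mult_right_mono mult_left_mono gh_le) auto
        then show "Q (- ht x) * gh (int (s n)) x * exit_prob x \<le> Cg * (mh x * exit_prob x)"
          unfolding mh_def by (simp add: ac_simps)
      qed
      show "(\<Sum>\<^sup>+x. Cg * (mh x * exit_prob x)) < \<infinity>"
        using exit_mass_fin Cg_fin by (simp add: nn_integral_cmult ennreal_mult_less_top)
      show "AE x in count_space UNIV. (\<lambda>n. Q (- ht x) * gh (int (s n)) x * exit_prob x) \<longlonglongrightarrow> 0"
      proof (rule AE_I2)
        fix x
        have lx: "(\<lambda>n. gh (int (s n)) x) \<longlonglongrightarrow> 0" using L L0[of x] unfolding glim_def by metis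
        have "exit_prob x \<le> kop kh (\<lambda>_. 1) x"
          unfolding exit_prob_def
          by (cases "x \<in> cone0") (auto intro!: kop_mono simp: indicator_def)
        then have "exit_prob x < \<top>" unfolding kh_sum1 by (rule order.strict_trans1) simp
        then have "Q (- ht x) * exit_prob x < \<top>" by (simp add: ennreal_mult_less_top)
        then have "(\<lambda>n. Q (- ht x) * exit_prob x * gh (int (s n)) x) \<longlonglongrightarrow> Q (- ht x) * exit_prob x * 0"
          by (intro ennreal_tendsto_cmult lx)
        then show "(\<lambda>n. Q (- ht x) * gh (int (s n)) x * exit_prob x) \<longlonglongrightarrow> 0" by (simp add: ac_simps)
      qed
    qed auto
    then have "(1::ennreal) \<le> 0" using flux LIMSEQ_le_const[of _ "0::ennreal" 1] by auto
    then show False by simp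
  qed
  then show ?thesis using eq unfolding \<kappa>_def by (intro exI[of _ \<kappa>]) (auto simp: \<kappa>_def zero_less_iff_neq_zero)
qed

text \<open>The multiple in \<open>glim_eq\<close> may depend on the subsequence, but it cancels in
  the ratio, so every subsequence has a further one with the same limit.\<close>

theorem green_ratio_limit:
  "(\<lambda>n. green p x (\<xi> (int n)) / green p y (\<xi> (int n))) \<longlonglongrightarrow> enn2real (u x) / enn2real (u y)"
proof (rule ccontr)
  define X where "X n = green p x (\<xi> (int n)) / green p y (\<xi> (int n))" for n
  define l where "l = enn2real (u x) / enn2real (u y)"
  have X: "X n = enn2real (gh (int n) x) / enn2real (gh (int n) y)" for n
  proof -
    have "green p z (\<xi> (int n)) = enn2real (pot kp (indicator {\<xi> (int n)}) z)" for z
      using ennreal_green[OF transient] by (metis enn2real_ennreal)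
    then show ?thesis unfolding X_def gh_def using Q_pos[of "int n"] Q_less_top[of "int n"]
      by (simp add: enn2real_mult enn2real_eq_0_iff)
  qed
  assume "\<not> (\<lambda>n. green p x (\<xi> (int n)) / green p y (\<xi> (int n))) \<longlonglongrightarrow> enn2real (u x) / enn2real (u y)"
  then have "\<not> X \<longlonglongrightarrow> l" unfolding X_def l_def .
  then obtain e where e: "e > 0" "\<not> eventually (\<lambda>n. dist (X n) l < e) sequentially" unfolding tendsto_iff by blast
  then obtain s :: "nat \<Rightarrow> nat" where s: "strict_mono s" "\<And>n. \<not> dist (X (s n)) l < e"
    using not_eventually_sequentiallyD by blast
  obtain r L where r: "strict_mono r" "glim (s \<circ> r) L" using glim_exists[OF s(1)] by blast
  obtain \<kappa> where \<kappa>: "0 < \<kappa>" "\<kappa> < \<top>" "\<forall>x. L x = \<kappa> * u x" using glim_eq[OF r(2)] by blast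
  have \<kappa>': "\<kappa> \<noteq> 0" "\<kappa> \<noteq> \<top>" using \<kappa>(1,2) by (metis less_irrefl)+
  have lim: "(\<lambda>n. enn2real (gh (int (s (r n))) z)) \<longlonglongrightarrow> enn2real (L z)" for z
  proof -
    have "(\<lambda>n. gh (int (s (r n))) z) \<longlonglongrightarrow> ennreal (enn2real (L z))"
      using r(2) glim_fin[OF r(2), of z] unfolding glim_def by simp
    then show ?thesis by (rule tendsto_enn2real) simp
  qed
  have "enn2real (L y) \<noteq> 0"
    using \<kappa>(3) \<kappa>' u_pos[of y] u_fin[of y] by (auto simp: enn2real_mult enn2real_eq_0_iff)
  then have "(\<lambda>n. X (s (r n))) \<longlonglongrightarrow> enn2real (L x) / enn2real (L y)"
    unfolding X by (intro tendsto_divide lim)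
  also have "enn2real (L x) / enn2real (L y) = l"
    unfolding l_def using \<kappa>(3) \<kappa>' by (simp add: enn2real_mult enn2real_eq_0_iff)
  finally have "eventually (\<lambda>n. dist (X (s (r n))) l < e) sequentially" using e unfolding tendsto_iff by blast
  then show False using s(2) by (auto simp: eventually_sequentially)
qed

end

section \<open>A Lyapunov function for the reversed walk\<close>

text \<open>The bound on c makes the right side minus the left convex on (-1, b). This difference
  and its derivative vanish at 0, so it lies above the zero tangent.\<close>

lemma powr_second_order:
  fixes \<theta> b c t :: real
  assumes \<theta>: "0 < \<theta>" "\<theta> < 1" and c: "2 * c \<le> \<theta> * (1 - \<theta>) * (1 + b) powr (\<theta> - 2)"
    and t: "-1 < t" "t < b" and b: "0 < b"
  shows "(1 + t) powr \<theta> \<le> 1 + \<theta> * t - c * t\<^sup>2"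
proof -
  define f where "f t = 1 + \<theta> * t - c * t\<^sup>2 - (1 + t) powr \<theta>" for t :: real
  define f' where "f' t = \<theta> - 2 * c * t - \<theta> * (1 + t) powr (\<theta> - 1)" for t :: real
  define f'' where "f'' t = - 2 * c - \<theta> * (\<theta> - 1) * (1 + t) powr (\<theta> - 2)" for t :: real
  have "f' 0 * (t - 0) \<le> f t - f 0"
  proof (rule f''_imp_f'[where C = "{-1<..<b}" and f'' = f''])
    show "(f has_real_derivative f' x) (at x)" if "x \<in> {-1<..<b}" for x
      unfolding f_def f'_def using that
      by (auto intro!: derivative_eq_intros simp: algebra_simps)
    show "(f' has_real_derivative f'' x) (at x)" if "x \<in> {-1<..<b}" for x
      unfolding f'_def f''_def using that
      by (auto intro!: derivative_eq_intros simp: algebra_simps)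
    show "f'' x \<ge> 0" if "x \<in> {-1<..<b}" for x
    proof -
      have "(1 + b) powr (\<theta> - 2) \<le> (1 + x) powr (\<theta> - 2)"
        using that \<theta> by (intro powr_mono2') auto
      then have "\<theta> * (1 - \<theta>) * (1 + b) powr (\<theta> - 2) \<le> \<theta> * (1 - \<theta>) * (1 + x) powr (\<theta> - 2)"
        using \<theta> by (intro mult_left_mono) auto
      then have "2 * c \<le> \<theta> * (1 - \<theta>) * (1 + x) powr (\<theta> - 2)" using c by linarith
      then show ?thesis unfolding f''_def by (simp add: algebra_simps)
    qed
  qed (use t b in auto)
  then show ?thesis by (simp add: f_def f'_def)
qed

text \<open>The step \<open>(j, d)\<close> moves \<open>j\<close> levels up and then \<open>d\<close> down; a walker at height \<open>h\<close> above the
  reflecting level \<open>0\<close> arrives at \<open>(h - j) + d\<close> (truncated subtraction). All terms are moved to the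
  side where they are nonnegative.\<close>

lemma lyapunov_pointwise:
  fixes h j d :: nat and \<beta> c :: real
  assumes \<beta>: "0 < \<beta>" "\<beta> \<le> 1/2" and c: "c = (1 - \<beta>) * \<beta> * 3 powr (- 1 - \<beta>) / 2" and h: "1 \<le> h"
  shows "real ((h - j) + d) powr (1 - \<beta>) + real (j - h) + (1 - \<beta>) * real h powr (- \<beta>) * real j
      + c * real h powr (- 1 - \<beta>) * of_bool (d \<noteq> j \<and> \<bar>int d - int j\<bar> \<le> int h)
    \<le> real h powr (1 - \<beta>) + (1 - \<beta>) * real h powr (- \<beta>) * real d
      + 3 * real h powr (- 1 - 2 * \<beta>) * real (j + d) powr (2 + 2 * \<beta>)"
proof -
  have p3: "(3::real) powr (- 1 - \<beta>) \<le> 1" using \<beta> powr_mono[of "- 1 - \<beta>" 0 3] by simp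
  have cpos: "0 \<le> c" unfolding c using \<beta> by auto
  have "(1 - \<beta>) * \<beta> * 3 powr (- 1 - \<beta>) \<le> 1 * \<beta> * 1" using \<beta> p3 by (intro mult_mono) auto
  then have cle: "c \<le> \<beta> / 2" unfolding c by simp
  have hp: "0 < real h" using h by simp
  let ?R = "3 * real h powr (- 1 - 2 * \<beta>) * real (j + d) powr (2 + 2 * \<beta>)"
  have R0: "0 \<le> ?R" by simp
  show ?thesis
  proof (cases "j \<le> h")
    case True
    define X where "X = real d - real j"
    define t where "t = X / real h"
    have X: "real ((h - j) + d) = real h * (1 + t)"
      unfolding t_def X_def using True hp by (simp add: field_simps of_nat_diff)
    have "- real h \<le> X" unfolding X_def using True by simp
    then have t1: "-1 \<le> t" unfolding t_def using hp by (simp add: field_simps)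
    \<comment> \<open>The second-order gain is claimed only for 1 \<le> |d - j| \<le> h: then t lies
      in [-1, 1] and its square is at least h^(-2).\<close>
    have key: "(1 + t) powr (1 - \<beta>) \<le> 1 + (1 - \<beta>) * t - c * of_bool (d \<noteq> j \<and> \<bar>int d - int j\<bar> \<le> int h) / (real h)\<^sup>2"
    proof (cases "d \<noteq> j \<and> \<bar>int d - int j\<bar> \<le> int h")
      case dj: True
      have "1 \<le> \<bar>X\<bar>" "\<bar>X\<bar> \<le> real h" unfolding X_def using dj by linarith+
      then have X2: "1 \<le> X\<^sup>2" and t2: "t \<le> 1"
        unfolding t_def using hp by (auto simp: field_simps abs_square_le_1 power2_ge_1_iff)
      have ct: "c / (real h)\<^sup>2 \<le> c * t\<^sup>2"
      proof -
        have "c * 1 \<le> c * X\<^sup>2" using X2 cpos by (rule mult_left_mono)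
        then show ?thesis unfolding t_def power_divide using hp by (simp add: field_simps)
      qed
      have "(1 + t) powr (1 - \<beta>) \<le> 1 + (1 - \<beta>) * t - c * t\<^sup>2"
      proof (cases "t = -1")
        case True
        then show ?thesis using cle \<beta> by simp
      next
        case False
        \<comment> \<open>The choice b = 2 leaves room above t \<le> 1 and is the origin of the
          number 3 in c.\<close>
        have "1 - \<beta> - 2 = - 1 - \<beta>" "1 - (1 - \<beta>) = \<beta>" "(1::real) + 2 = 3" by simp_all
        then have "2 * c \<le> (1 - \<beta>) * (1 - (1 - \<beta>)) * (1 + 2) powr (1 - \<beta> - 2)" unfolding c by (simp only:)
        then show ?thesis using False \<beta> t1 t2 by (intro powr_second_order[where b = 2]) auto
      qed
      then show ?thesis using ct dj by simp
    next
      case dj: False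
      have "(1 + t) powr (1 - \<beta>) \<le> 1 + (1 - \<beta>) * t"
      proof (cases "t = -1")
        case True
        then show ?thesis using \<beta> by simp
      next
        case False
        then show ?thesis using powr_second_order[of "1 - \<beta>" 0 "\<bar>t\<bar> + 1" t] \<beta> t1 by auto
      qed
      then show ?thesis using dj by auto
    qed
    have h1: "real h powr (1 - \<beta>) * (1 / real h) = real h powr (- \<beta>)"
      using hp by (simp add: powr_diff powr_minus_divide)
    have h2: "real h powr (1 - \<beta>) / (real h)\<^sup>2 = real h powr (- 1 - \<beta>)"
      using hp by (simp add: powr_diff powr_minus_divide power2_eq_square)
    have "real ((h - j) + d) powr (1 - \<beta>) = real h powr (1 - \<beta>) * (1 + t) powr (1 - \<beta>)"
      unfolding X using hp t1 by (simp add: powr_mult)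
    also have "\<dots> \<le> real h powr (1 - \<beta>) *
        (1 + (1 - \<beta>) * t - c * of_bool (d \<noteq> j \<and> \<bar>int d - int j\<bar> \<le> int h) / (real h)\<^sup>2)"
      using key by (rule mult_left_mono) simp
    also have "\<dots> = real h powr (1 - \<beta>) + (1 - \<beta>) * (real h powr (1 - \<beta>) * (1 / real h)) * X
        - c * of_bool (d \<noteq> j \<and> \<bar>int d - int j\<bar> \<le> int h) * (real h powr (1 - \<beta>) / (real h)\<^sup>2)"
      unfolding t_def by (simp add: algebra_simps)
    finally have "real ((h - j) + d) powr (1 - \<beta>) \<le> real h powr (1 - \<beta>) + (1 - \<beta>) * real h powr (- \<beta>) * X
        - c * of_bool (d \<noteq> j \<and> \<bar>int d - int j\<bar> \<le> int h) * real h powr (- 1 - \<beta>)"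
      unfolding h1 h2 .
    moreover have "(1 - \<beta>) * real h powr (- \<beta>) * X
        = (1 - \<beta>) * real h powr (- \<beta>) * real d - (1 - \<beta>) * real h powr (- \<beta>) * real j"
      unfolding X_def by (simp add: algebra_simps)
    moreover have "real (j - h) = 0" using True by simp
    moreover have "c * of_bool (d \<noteq> j \<and> \<bar>int d - int j\<bar> \<le> int h) * real h powr (- 1 - \<beta>)
        = c * real h powr (- 1 - \<beta>) * of_bool (d \<noteq> j \<and> \<bar>int d - int j\<bar> \<le> int h)" by (simp only: ac_simps)
    ultimately show ?thesis using R0 by linarith
  next
    case False
    \<comment> \<open>Here j > h, so D is at least h and every power of D with exponent at most 1 is
      below h^(-1-2\<beta>) D^(2+2\<beta>). Three terms are bounded in this way, whence the factor
      3; the fourth is absorbed by \<open>real h powr (1 - \<beta>)\<close>.\<close>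
    define D where "D = real (j + d)"
    have D: "real h \<le> D" "1 \<le> D" unfolding D_def using False h by auto
    have Dp: "D powr a \<le> real h powr (- 1 - 2 * \<beta>) * D powr (2 + 2 * \<beta>)" if "a \<le> 1" for a
    proof -
      have "D powr a \<le> D powr 1" using that D by (intro powr_mono) auto
      also have "\<dots> = D powr (- 1 - 2 * \<beta>) * D powr (2 + 2 * \<beta>)" using D by (simp flip: powr_add)
      also have "\<dots> \<le> real h powr (- 1 - 2 * \<beta>) * D powr (2 + 2 * \<beta>)"
        using D hp \<beta> by (intro mult_right_mono powr_mono2') auto
      finally show ?thesis .
    qed
    have a1: "real ((h - j) + d) powr (1 - \<beta>) \<le> real h powr (- 1 - 2 * \<beta>) * D powr (2 + 2 * \<beta>)"
    proof -
      have "real ((h - j) + d) powr (1 - \<beta>) \<le> D powr (1 - \<beta>)"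
        unfolding D_def using False \<beta> by (intro powr_mono2) auto
      also have "\<dots> \<le> real h powr (- 1 - 2 * \<beta>) * D powr (2 + 2 * \<beta>)" using \<beta> by (intro Dp) auto
      finally show ?thesis .
    qed
    have a2: "real (j - h) \<le> real h powr (- 1 - 2 * \<beta>) * D powr (2 + 2 * \<beta>)"
    proof -
      have "real (j - h) \<le> D powr 1" using D unfolding D_def by simp
      also have "\<dots> \<le> real h powr (- 1 - 2 * \<beta>) * D powr (2 + 2 * \<beta>)" by (intro Dp) auto
      finally show ?thesis .
    qed
    have a3: "(1 - \<beta>) * real h powr (- \<beta>) * real j \<le> real h powr (- 1 - 2 * \<beta>) * D powr (2 + 2 * \<beta>)"
    proof -
      have "real h powr (- \<beta>) \<le> 1" using h \<beta> powr_mono[of "- \<beta>" 0 "real h"] by simp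
      then have "(1 - \<beta>) * real h powr (- \<beta>) * real j \<le> 1 * 1 * D"
        unfolding D_def using \<beta> by (intro mult_mono) auto
      also have "1 * 1 * D = D powr 1" using D by simp
      also have "\<dots> \<le> real h powr (- 1 - 2 * \<beta>) * D powr (2 + 2 * \<beta>)" by (intro Dp) auto
      finally show ?thesis .
    qed
    have a4: "c * real h powr (- 1 - \<beta>) * of_bool (d \<noteq> j \<and> \<bar>int d - int j\<bar> \<le> int h) \<le> real h powr (1 - \<beta>)"
    proof -
      have "real h powr (- 1 - \<beta>) \<le> real h powr (1 - \<beta>)" using h by (intro powr_mono) auto
      moreover have "c \<le> 1" using cle \<beta> by simp
      ultimately have "c * real h powr (- 1 - \<beta>) * of_bool (d \<noteq> j \<and> \<bar>int d - int j\<bar> \<le> int h)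
          \<le> 1 * real h powr (1 - \<beta>) * 1" using cpos by (intro mult_mono) auto
      then show ?thesis by simp
    qed
    have "0 \<le> (1 - \<beta>) * real h powr (- \<beta>) * real d" using \<beta> by simp
    then show ?thesis using a1 a2 a3 a4 unfolding D_def by linarith
  qed
qed


context walk begin

lemma stepE_add: "stepE (\<lambda>j d. F j d + G j d) = stepE F + stepE G"
  unfolding stepE_def by (simp add: distrib_left nn_integral_add)

lemma stepE_cmult: "stepE (\<lambda>j d. c * F j d) = c * stepE F"
  unfolding stepE_def by (simp add: mult.left_commute nn_integral_cmult)

lemma stepE_const: "stepE (\<lambda>j d. c) = c"
  using kop_cmult[of kp c "\<lambda>_. 1" rt] kp_sum1[of rt] unfolding stepE_def kop_def by simp

lemma stepE_mono: "(\<And>j d. F j d \<le> G j d) \<Longrightarrow> stepE F \<le> stepE G"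
  unfolding stepE_def by (intro nn_integral_mono mult_left_mono) auto

lemma hor_eq_up: "ht x = int (up pr x rt) - int (up pr rt x)"
  using hor_up[of x rt] by simp

text \<open>Otherwise the walk would never leave its horocycle, against irreducibility. It supplies
  the nondegeneracy at zero drift and the strictness in \<open>ps_drift_pos\<close>.\<close>

lemma exists_level_change: "\<exists>x. p rt x > 0 \<and> ht x \<noteq> 0"
proof (rule ccontr)
  assume "\<not> ?thesis"
  then have z: "p rt x > 0 \<Longrightarrow> ht x = 0" for x by blast
  have lev: "ht x = ht y" if xy: "p x y > 0" for x y
  proof -
    obtain g where g: "g \<in> Aff pr" "g x = rt" using Aff_transitive by blast
    then have "p rt (g y) > 0" using p_Aff[OF g(1), of x y] xy by simp
    then have "ht (g y) = 0" by (rule z)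
    then show ?thesis using Aff_hor[OF g(1), of x y] g(2) by simp
  qed
  have "mpow p n x y = 0" if "ht x \<noteq> ht y" for n x y
    using that
  proof (induction n arbitrary: x)
    case (Suc n)
    have "p x z * mpow p n z y = 0" for z
    proof (cases "p x z > 0")
      case True
      then show ?thesis using lev[OF True] Suc by simp
    next
      case False
      then have "p x z = 0" using p_nonneg[of x z] by simp
      then show ?thesis by simp
    qed
    then show ?case unfolding mpow.simps by (intro infsum_0) blast
  qed auto
  then have "mpow p n rt (pr rt) = 0" for n by (simp add: hor_pr)
  then show False using irred unfolding irreducible_tm_def by (metis less_irrefl)
qed

text \<open>\<open>V\<close> is the height itself. Reflection raises its mean by the overshoot
  \<open>Ef h\<close>, since (h - j) + d + j = h + (j - h) + d in truncated arithmetic, and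
  \<open>Ef h\<close> tends to 0 by dominated convergence.\<close>

lemma lyapunov_positive_drift:
  assumes fin: "stepE (\<lambda>j d. of_nat j) < \<top>" "stepE (\<lambda>j d. of_nat d) < \<top>"
    and drift: "stepE (\<lambda>j d. of_nat d) + ennreal \<alpha> = stepE (\<lambda>j d. of_nat j)" and \<alpha>: "\<alpha> > 0"
  shows "\<exists>V h0. (\<forall>h. V h < \<top>) \<and> mono V \<and> (\<forall>M<\<top>. \<exists>h. M < V h)
    \<and> (\<forall>h. stepE (\<lambda>j d. V ((h - j) + d)) < \<top>)
    \<and> (\<forall>h>h0. stepE (\<lambda>j d. of_nat (j - h)) + stepE (\<lambda>j d. V ((h - j) + d)) \<le> V h)"
proof -
  define V where "V h = (of_nat h :: ennreal)" for h
  define Ef where "Ef h = stepE (\<lambda>j d. of_nat (j - h))" for h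
  have Ef_fin: "Ef h < \<top>" for h
    using fin(1) stepE_mono[of "\<lambda>j d. of_nat (j - h)" "\<lambda>j d. of_nat j"] unfolding Ef_def
    by (simp add: order.strict_trans1)
  have Ef_lim: "Ef \<longlonglongrightarrow> 0"
  proof -
    have "(\<lambda>h. \<Sum>\<^sup>+x. kp rt x * of_nat (up pr x rt - h)) \<longlonglongrightarrow> (\<integral>\<^sup>+x. 0 \<partial>count_space (UNIV :: 'v set))"
    proof (rule nn_integral_dominated_convergence[where w = "\<lambda>x. kp rt x * of_nat (up pr x rt)"])
      show "(\<Sum>\<^sup>+x. kp rt x * of_nat (up pr x rt)) < \<infinity>"
        using fin(1) unfolding stepE_def by simp
      show "AE x in count_space UNIV. (\<lambda>h. kp rt x * of_nat (up pr x rt - h)) \<longlonglongrightarrow> 0"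
      proof (rule AE_I2)
        fix x
        have "eventually (\<lambda>h. kp rt x * of_nat (up pr x rt - h) = 0) sequentially"
          by (rule eventually_sequentiallyI[of "up pr x rt"]) simp
        then show "(\<lambda>h. kp rt x * of_nat (up pr x rt - h)) \<longlonglongrightarrow> 0" by (rule tendsto_eventually)
      qed
    qed (auto intro!: AE_I2 mult_left_mono)
    then show ?thesis unfolding Ef_def stepE_def by simp
  qed
  have split: "stepE (\<lambda>j d. V ((h - j) + d)) + ennreal \<alpha> = of_nat h + Ef h" for h
  proof -
    have "(h - j) + d + j = h + (j - h) + d" for j d :: nat by simp
    then have "stepE (\<lambda>j d. of_nat ((h - j) + d) + of_nat j) = stepE (\<lambda>j d. (of_nat h + of_nat (j - h)) + of_nat d)"
      by (metis (no_types, lifting) of_nat_add)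
    then have "stepE (\<lambda>j d. V ((h - j) + d)) + (stepE (\<lambda>j d. of_nat d) + ennreal \<alpha>)
        = (of_nat h + Ef h) + stepE (\<lambda>j d. of_nat d)"
      unfolding drift Ef_def V_def by (simp only: stepE_add stepE_const)
    then have "stepE (\<lambda>j d. of_nat d) + (stepE (\<lambda>j d. V ((h - j) + d)) + ennreal \<alpha>)
        = stepE (\<lambda>j d. of_nat d) + (of_nat h + Ef h)" by (simp only: ac_simps)
    then show ?thesis using fin(2) by (auto simp: ennreal_add_left_cancel)
  qed
  have Vfin: "stepE (\<lambda>j d. V ((h - j) + d)) < \<top>" for h
  proof -
    have "stepE (\<lambda>j d. V ((h - j) + d)) \<le> of_nat h + Ef h"
      unfolding split[symmetric] by (simp add: add_increasing2)
    also have "\<dots> < \<top>" using Ef_fin[of h] by (simp add: of_nat_less_top)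
    finally show ?thesis .
  qed
  \<comment> \<open>Half the drift, because the overshoot enters twice: through the reflection and
    as the extra term of the Lyapunov inequality.\<close>
  have "eventually (\<lambda>h. Ef h < ennreal (\<alpha> / 2)) sequentially"
    using Ef_lim \<alpha> by (intro order_tendstoD) auto
  then obtain h0 where h0: "\<And>h. h \<ge> h0 \<Longrightarrow> Ef h < ennreal (\<alpha> / 2)" unfolding eventually_sequentially by blast
  have "Ef h + stepE (\<lambda>j d. V ((h - j) + d)) \<le> V h" if "h > h0" for h
  proof -
    define S where "S = stepE (\<lambda>j d. V ((h - j) + d))"
    have "ennreal \<alpha> + (Ef h + S) = Ef h + (S + ennreal \<alpha>)" by (simp only: ac_simps)
    also have "S + ennreal \<alpha> = of_nat h + Ef h" unfolding S_def by (rule split)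
    finally have "ennreal \<alpha> + (Ef h + stepE (\<lambda>j d. V ((h - j) + d))) = Ef h + (of_nat h + Ef h)"
      unfolding S_def .
    also have "\<dots> \<le> ennreal (\<alpha> / 2) + (of_nat h + ennreal (\<alpha> / 2))"
      using h0[of h] that by (intro add_mono) auto
    also have "\<dots> = (ennreal (\<alpha> / 2) + ennreal (\<alpha> / 2)) + of_nat h" by (simp only: ac_simps)
    also have "\<dots> = ennreal \<alpha> + V h" using \<alpha> unfolding V_def by (simp flip: ennreal_plus)
    finally show ?thesis by (rule ennreal_add_left_le_imp) simp
  qed
  moreover have "mono V" unfolding V_def by (auto simp: mono_def)
  moreover have "\<exists>h. M < V h" if "M < \<top>" for M
    using ennreal_Ex_less_of_nat[of M] that unfolding V_def by auto
  ultimately show ?thesis using Vfin unfolding Ef_def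
    by (intro exI[of _ V] exI[of _ h0]) (auto simp: V_def of_nat_less_top)
qed

text \<open>Averaging \<open>lyapunov_pointwise\<close> cancels the first-order terms. There remains
  a gain of order h^(-1-\<beta>) times the probability of a level change of size at most h, and it
  beats the error of order h^(-1-2\<beta>) for large h.\<close>

lemma lyapunov_zero_drift:
  assumes fin: "stepE (\<lambda>j d. of_nat j) < \<top>"
    and drift: "stepE (\<lambda>j d. of_nat d) = stepE (\<lambda>j d. of_nat j)"
    and \<epsilon>: "\<epsilon> > 0" and mom: "stepE (\<lambda>j d. ennreal (real (j + d) powr (2 + \<epsilon>))) < \<top>"
  shows "\<exists>V h0. (\<forall>h. V h < \<top>) \<and> mono V \<and> (\<forall>M<\<top>. \<exists>h. M < V h)
    \<and> (\<forall>h. stepE (\<lambda>j d. V ((h - j) + d)) < \<top>)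
    \<and> (\<forall>h>h0. stepE (\<lambda>j d. of_nat (j - h)) + stepE (\<lambda>j d. V ((h - j) + d)) \<le> V h)"
proof -
  \<comment> \<open>2 + 2\<beta> must not exceed the available moment 2 + \<epsilon>, and
    \<open>lyapunov_pointwise\<close> asks for \<beta> \<le> 1/2.\<close>
  define \<beta> where "\<beta> = min (\<epsilon> / 2) (1 / 2)"
  have \<beta>: "0 < \<beta>" "\<beta> \<le> 1/2" "2 * \<beta> \<le> \<epsilon>" unfolding \<beta>_def using \<epsilon> by auto
  define c where "c = (1 - \<beta>) * \<beta> * 3 powr (- 1 - \<beta>) / 2"
  have c: "c > 0" unfolding c_def using \<beta> by auto
  define V where "V h = ennreal (real h powr (1 - \<beta>))" for h :: nat
  define J where "J = stepE (\<lambda>j d. of_nat j)"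
  define M where "M = stepE (\<lambda>j d. ennreal (real (j + d) powr (2 + 2 * \<beta>)))"
  define B where "B h = stepE (\<lambda>j d. of_bool (d \<noteq> j \<and> \<bar>int d - int j\<bar> \<le> int h))" for h :: nat
  have "M \<le> stepE (\<lambda>j d. ennreal (real (j + d) powr (2 + \<epsilon>)))"
    unfolding M_def
  proof (intro stepE_mono ennreal_leI)
    fix j d :: nat
    show "real (j + d) powr (2 + 2 * \<beta>) \<le> real (j + d) powr (2 + \<epsilon>)"
    proof (cases "j + d = 0")
      case False
      then show ?thesis using \<beta> by (intro powr_mono) auto
    qed simp
  qed
  then have M: "M < \<top>" using mom by order
  have B_le: "B h \<le> 1" for h
    using stepE_mono[of "\<lambda>j d. of_bool (d \<noteq> j \<and> \<bar>int d - int j\<bar> \<le> int h)" "\<lambda>j d. 1"] stepE_const[of 1]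
    unfolding B_def by simp
  obtain x0 where x0: "p rt x0 > 0" "ht x0 \<noteq> 0" using exists_level_change by blast
  have B_ge: "kp rt x0 \<le> B h" if "nat \<bar>ht x0\<bar> \<le> h" for h
  proof -
    have "kp rt x0 = kp rt x0 * of_bool (up pr rt x0 \<noteq> up pr x0 rt
        \<and> \<bar>int (up pr rt x0) - int (up pr x0 rt)\<bar> \<le> int h)"
      using hor_eq_up[of x0] x0(2) that by simp
    also have "\<dots> \<le> B h" unfolding B_def stepE_def
      using kop_point_le[of kp rt x0 "\<lambda>x. of_bool (up pr rt x \<noteq> up pr x rt \<and> \<bar>int (up pr rt x) - int (up pr x rt)\<bar> \<le> int h)"]
      unfolding kop_def .
    finally show ?thesis .
  qed
  have main: "(stepE (\<lambda>j d. of_nat (j - h)) + stepE (\<lambda>j d. V ((h - j) + d))) + ennreal (c * real h powr (- 1 - \<beta>)) * B h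
      \<le> V h + ennreal (3 * real h powr (- 1 - 2 * \<beta>)) * M" if h: "1 \<le> h" for h
  proof -
    define a where "a = (1 - \<beta>) * real h powr (- \<beta>)"
    have a: "0 \<le> a" unfolding a_def using \<beta> by simp
    have pw: "((V ((h - j) + d) + of_nat (j - h)) + ennreal a * of_nat j)
          + ennreal (c * real h powr (- 1 - \<beta>)) * of_bool (d \<noteq> j \<and> \<bar>int d - int j\<bar> \<le> int h)
        \<le> (V h + ennreal a * of_nat d) + ennreal (3 * real h powr (- 1 - 2 * \<beta>)) * ennreal (real (j + d) powr (2 + 2 * \<beta>))"
      for j d
    proof -
      have "ennreal (((real ((h - j) + d) powr (1 - \<beta>) + real (j - h)) + a * real j)
          + c * real h powr (- 1 - \<beta>) * of_bool (d \<noteq> j \<and> \<bar>int d - int j\<bar> \<le> int h))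
        \<le> ennreal ((real h powr (1 - \<beta>) + a * real d)
          + 3 * real h powr (- 1 - 2 * \<beta>) * real (j + d) powr (2 + 2 * \<beta>))"
        using lyapunov_pointwise[OF \<beta>(1,2) c_def h, of j d] unfolding a_def by (intro ennreal_leI)
      moreover obtain b where b: "b = (d \<noteq> j \<and> \<bar>int d - int j\<bar> \<le> int h)" by blast
      ultimately show ?thesis unfolding V_def b[symmetric] using a c
        by (cases b) (simp_all add: ennreal_mult ennreal_of_nat_eq_real_of_nat)
    qed
    have "stepE (\<lambda>j d. ((V ((h - j) + d) + of_nat (j - h)) + ennreal a * of_nat j)
          + ennreal (c * real h powr (- 1 - \<beta>)) * of_bool (d \<noteq> j \<and> \<bar>int d - int j\<bar> \<le> int h))
        \<le> stepE (\<lambda>j d. (V h + ennreal a * of_nat d)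
          + ennreal (3 * real h powr (- 1 - 2 * \<beta>)) * ennreal (real (j + d) powr (2 + 2 * \<beta>)))"
      by (rule stepE_mono) (rule pw)
    then have "((stepE (\<lambda>j d. V ((h - j) + d)) + stepE (\<lambda>j d. of_nat (j - h))) + ennreal a * J)
          + ennreal (c * real h powr (- 1 - \<beta>)) * B h
        \<le> (V h + ennreal a * J) + ennreal (3 * real h powr (- 1 - 2 * \<beta>)) * M"
      unfolding stepE_add stepE_cmult stepE_const drift J_def[symmetric] M_def[symmetric] B_def[symmetric] .
    \<comment> \<open>Zero drift makes the first-order terms on the two sides equal; they are
      finite, hence can be cancelled.\<close>
    then have "ennreal a * J + ((stepE (\<lambda>j d. of_nat (j - h)) + stepE (\<lambda>j d. V ((h - j) + d))) + ennreal (c * real h powr (- 1 - \<beta>)) * B h)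
      \<le> ennreal a * J + (V h + ennreal (3 * real h powr (- 1 - 2 * \<beta>)) * M)" by (simp only: ac_simps)
    moreover have "ennreal a * J < \<top>" using fin unfolding J_def by (simp add: ennreal_mult_less_top)
    ultimately show ?thesis by (rule ennreal_add_left_le_imp)
  qed
  define s where "s = p rt x0"
  define m' where "m' = enn2real M"
  have "(\<lambda>h. 3 * m' * real h powr (- \<beta>)) \<longlonglongrightarrow> 3 * m' * 0"
    using \<beta> by (intro tendsto_mult tendsto_const tendsto_neg_powr filterlim_real_sequentially) auto
  then have "eventually (\<lambda>h. 3 * m' * real h powr (- \<beta>) < c * s) sequentially"
    using c x0(1) unfolding s_def by (intro order_tendstoD(2)) auto
  then obtain N where N: "\<And>h. h \<ge> N \<Longrightarrow> 3 * m' * real h powr (- \<beta>) < c * s" unfolding eventually_sequentially by blast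
  define h0 where "h0 = max N (nat \<bar>ht x0\<bar>)"
  have step: "stepE (\<lambda>j d. of_nat (j - h)) + stepE (\<lambda>j d. V ((h - j) + d)) \<le> V h" if "h > h0" for h
  proof -
    have h: "1 \<le> h" "N \<le> h" "nat \<bar>ht x0\<bar> \<le> h" using that unfolding h0_def by auto
    have "3 * real h powr (- 1 - 2 * \<beta>) * m' = (3 * m' * real h powr (- \<beta>)) * real h powr (- 1 - \<beta>)"
    proof -
      have "real h powr (- 1 - 2 * \<beta>) = real h powr (- \<beta> + (- 1 - \<beta>))" by (rule arg_cong) simp
      then show ?thesis by (simp only: powr_add ac_simps)
    qed
    also have "\<dots> \<le> (c * s) * real h powr (- 1 - \<beta>)" using N[OF h(2)] by (intro mult_right_mono) auto
    finally have "ennreal (3 * real h powr (- 1 - 2 * \<beta>) * m') \<le> ennreal (c * real h powr (- 1 - \<beta>) * s)"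
      by (intro ennreal_leI) (simp add: ac_simps)
    then have "ennreal (3 * real h powr (- 1 - 2 * \<beta>)) * M \<le> ennreal (c * real h powr (- 1 - \<beta>)) * kp rt x0"
      using M c p_nonneg[of rt x0] unfolding m'_def s_def by (simp add: ennreal_mult' ennreal_mult)
    also have "\<dots> \<le> ennreal (c * real h powr (- 1 - \<beta>)) * B h" by (intro mult_left_mono B_ge h) auto
    finally have le: "ennreal (3 * real h powr (- 1 - 2 * \<beta>)) * M \<le> ennreal (c * real h powr (- 1 - \<beta>)) * B h" .
    have "ennreal (c * real h powr (- 1 - \<beta>)) * B h + (stepE (\<lambda>j d. of_nat (j - h)) + stepE (\<lambda>j d. V ((h - j) + d)))
        \<le> V h + ennreal (3 * real h powr (- 1 - 2 * \<beta>)) * M"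
      using main[OF h(1)] by (simp only: add.commute)
    also have "\<dots> \<le> V h + ennreal (c * real h powr (- 1 - \<beta>)) * B h" using le by (rule add_left_mono)
    also have "\<dots> = ennreal (c * real h powr (- 1 - \<beta>)) * B h + V h" by (rule add.commute)
    finally have "ennreal (c * real h powr (- 1 - \<beta>)) * B h + (stepE (\<lambda>j d. of_nat (j - h)) + stepE (\<lambda>j d. V ((h - j) + d)))
        \<le> ennreal (c * real h powr (- 1 - \<beta>)) * B h + V h" .
    moreover have "ennreal (c * real h powr (- 1 - \<beta>)) * B h < \<top>"
      using B_le[of h] by (auto simp: ennreal_mult_less_top intro: order.strict_trans1)
    ultimately show ?thesis by (rule ennreal_add_left_le_imp)
  qed
  have "mono V" unfolding V_def mono_def using \<beta> by (auto intro!: ennreal_leI powr_mono2)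
  moreover have "\<exists>h. A < V h" if A: "A < \<top>" for A
  proof -
    have "filterlim (\<lambda>h. real h powr (1 - \<beta>)) at_top sequentially"
      using \<beta> by (intro filterlim_compose[OF real_powr_at_top filterlim_real_sequentially]) auto
    then have "eventually (\<lambda>h. enn2real A < real h powr (1 - \<beta>)) sequentially"
      unfolding filterlim_at_top_dense by blast
    then obtain h where "enn2real A < real h powr (1 - \<beta>)" by (auto simp: eventually_sequentially)
    then have "ennreal (enn2real A) < V h" 
      unfolding V_def by (subst ennreal_less_iff) auto
    then show ?thesis using A by auto
  qed
  moreover have "stepE (\<lambda>j d. V ((h - j) + d)) < \<top>" for h
  proof -
    have "V ((h - j) + d) \<le> of_nat h + of_nat d" for j d
    proof -
      have "real n powr (1 - \<beta>) \<le> real n" for n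
        using \<beta> powr_mono[of "1 - \<beta>" 1 "real n"] by (cases "n = 0") auto
      then have "V ((h - j) + d) \<le> ennreal (real ((h - j) + d))" unfolding V_def by (intro ennreal_leI)
      also have "\<dots> \<le> ennreal (real (h + d))" by (intro ennreal_leI) auto
      also have "\<dots> = of_nat h + of_nat d" by (simp add: ennreal_of_nat_eq_real_of_nat)
      finally show ?thesis .
    qed
    then have "stepE (\<lambda>j d. V ((h - j) + d)) \<le> stepE (\<lambda>j d. of_nat h + of_nat d)" by (rule stepE_mono)
    also have "\<dots> = of_nat h + stepE (\<lambda>j d. of_nat d)" by (simp only: stepE_add stepE_const)
    also have "\<dots> < \<top>" using fin drift by (simp add: of_nat_less_top)
    finally show ?thesis .
  qed
  ultimately show ?thesis using step by (intro exI[of _ V] exI[of _ h0]) (auto simp: V_def)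
qed

end

section \<open>From the harmonic measure to an excessive function\<close>

text \<open>Common form of the two cases: the convolution over the group has become a sum over
  vertices, and in case (B) the kernels p and K are replaced by their transforms.\<close>

locale boundary_walk = walk q pr rt p
  for q :: nat and pr :: "'v \<Rightarrow> 'v" and rt :: 'v and p :: "'v \<Rightarrow> 'v \<Rightarrow> real" +
  fixes \<nu> :: "(int \<Rightarrow> 'v) measure" and K :: "'v \<Rightarrow> (int \<Rightarrow> 'v) \<Rightarrow> real"
  assumes nu_meas: "ends_measurable pr rt \<nu>" and nu_radon: "radon_ends pr rt \<nu>"
    and nu_nonzero: "emeasure \<nu> (ends pr rt) \<noteq> 0"
    and K_cont: "continuous_ends pr rt (K x)"
    and K_nonneg: "\<xi> \<in> ends pr rt \<Longrightarrow> K x \<xi> \<ge> 0"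
    and K_density: "g \<in> Aff pr \<Longrightarrow> E \<in> sets \<nu> \<Longrightarrow>
      emeasure \<nu> (end_preimage pr rt g E) = (\<integral>\<^sup>+\<xi>\<in>E. ennreal (K (g rt) \<xi>) \<partial>\<nu>)"
    and nu_invariant: "E \<in> sets \<nu> \<Longrightarrow>
      emeasure \<nu> E = (\<Sum>\<^sup>+x. kp rt x * (\<integral>\<^sup>+\<xi>\<in>E. ennreal (K x \<xi>) \<partial>\<nu>))"
begin

definition cone :: "'v \<Rightarrow> (int \<Rightarrow> 'v) set" where "cone v = {\<xi> \<in> ends pr rt. \<xi> (ht v) = v}"

text \<open>The mass that the harmonic measure with base point x gives to the ends below v.\<close>

definition cval :: "'v \<Rightarrow> 'v \<Rightarrow> ennreal" where "cval x v = (\<integral>\<^sup>+\<xi>\<in>cone v. ennreal (K x \<xi>) \<partial>\<nu>)"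

lemma cone_sets [measurable]: "cone v \<in> sets \<nu>"
  using nu_meas unfolding ends_measurable_def cone_def ends_cones_def by auto

lemma cone_fin: "emeasure \<nu> (cone v) < \<top>"
  using nu_radon unfolding radon_ends_def cone_def ends_cones_def by (auto simp: less_top)

lemma ends_anc: "\<xi> \<in> ends pr rt \<Longrightarrow> anc n (\<xi> k) = \<xi> (k - int n)"
proof -
  assume "\<xi> \<in> ends pr rt"
  then interpret walk_axis q pr rt p \<xi> by unfold_locales
  show ?thesis by (rule xi_anc)
qed

lemma ends_ht: "\<xi> \<in> ends pr rt \<Longrightarrow> ht (\<xi> k) = k"
  unfolding ends_def by auto

lemma end_act_ends: assumes "g \<in> Aff pr" "\<xi> \<in> ends pr rt" shows "end_act pr rt g \<xi> \<in> ends pr rt"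
proof -
  have "pr (end_act pr rt g \<xi> (k + 1)) = end_act pr rt g \<xi> k" for k
  proof -
    have "pr (\<xi> (k - ht (g rt) + 1)) = \<xi> (k - ht (g rt))" using assms(2) unfolding ends_def by blast
    then show ?thesis unfolding end_act_def using Aff_pr[OF assms(1)] by (metis add_diff_eq diff_add_eq)
  qed
  moreover have "ht (end_act pr rt g \<xi> k) = k" for k
    unfolding end_act_def 
    using Aff_hor_root[OF assms(1), of "\<xi> (k - ht (g rt))"] ends_ht[OF assms(2)] by simp
  ultimately show ?thesis unfolding ends_def by blast
qed

lemma end_preimage_cone: assumes g: "g \<in> Aff pr" shows "end_preimage pr rt g (cone (g v)) = cone v"
proof -
  have "end_act pr rt g \<xi> (ht (g v)) = g v \<longleftrightarrow> \<xi> (ht v) = v" for \<xi>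
    unfolding end_act_def using Aff_hor_root[OF g, of v] Aff_bij[OF g] by (simp add: bij_def inj_eq)
  then show ?thesis unfolding end_preimage_def cone_def using end_act_ends[OF g] by auto
qed

lemma cval_Aff_root: "g \<in> Aff pr \<Longrightarrow> cval (g rt) (g v) = emeasure \<nu> (cone v)"
  unfolding cval_def using K_density[of g "cone (g v)"] end_preimage_cone[of g v] by simp

lemma cval_root: "cval rt v = emeasure \<nu> (cone v)"
  using cval_Aff_root[OF Aff_id, of v] by simp

text \<open>Every base point is an image of the root, where \<open>K_density\<close> turns the value
  into \<nu> of a translated cone; two automorphisms compose.\<close>

lemma cval_Aff: assumes g: "g \<in> Aff pr" shows "cval (g x) (g v) = cval x v"
proof -
  obtain k where k: "k \<in> Aff pr" "k rt = x" using Aff_transitive by blast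
  obtain w where w: "v = k w" using Aff_bij[OF k(1)] by (metis bij_pointE)
  have "cval (g x) (g v) = cval ((g \<circ> k) rt) ((g \<circ> k) w)" using k w by simp
  also have "\<dots> = emeasure \<nu> (cone w)" by (rule cval_Aff_root[OF Aff_comp[OF g k(1)]])
  also have "\<dots> = cval x v" using cval_Aff_root[OF k(1), of w] k w by simp
  finally show ?thesis .
qed

lemma cval_fin: "cval x v < \<top>"
proof -
  obtain g where g: "g \<in> Aff pr" "g x = rt" using Aff_transitive by blast
  then show ?thesis using cval_Aff[OF g(1), of x v] cval_root[of "g v"] cone_fin[of "g v"] by simp
qed

lemma cval_cong_up:
  assumes "up pr x v = up pr x' v'" "up pr v x = up pr v' x'" shows "cval x v = cval x' v'"
  using Aff_two_point_transitive[OF assms] cval_Aff by metis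

lemma cone_children: "cone v = (\<Union>w\<in>ch v. cone w)"
proof (intro equalityI subsetI)
  fix \<xi> assume "\<xi> \<in> cone v"
  then have e: "\<xi> \<in> ends pr rt" "\<xi> (ht v) = v" unfolding cone_def by auto
  have "pr (\<xi> (ht v + 1)) = v" using ends_anc[OF e(1), of 1 "ht v + 1"] e(2) by simp
  then show "\<xi> \<in> (\<Union>w\<in>ch v. cone w)" unfolding cone_def using e(1) ends_ht[OF e(1)] by auto
next
  fix \<xi> assume "\<xi> \<in> (\<Union>w\<in>ch v. cone w)"
  then obtain w where w: "pr w = v" "\<xi> \<in> ends pr rt" "\<xi> (ht w) = w" unfolding cone_def by auto
  then have "\<xi> (ht w - 1) = v" using ends_anc[OF w(2), of 1 "ht w"] by simp
  then show "\<xi> \<in> cone v" unfolding cone_def using w hor_pr[of w] by simp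
qed

lemma cone_disjoint: "disjoint_family_on cone (ch v)"
proof -
  have "w = w'" if "pr w = v" "pr w' = v" "\<xi> \<in> cone w" "\<xi> \<in> cone w'" for w w' \<xi>
  proof -
    have "ht w = ht w'" using hor_pr[of w] hor_pr[of w'] that by simp
    then show ?thesis using that unfolding cone_def by auto
  qed
  then show ?thesis unfolding disjoint_family_on_def by blast
qed

lemma nu_children: "emeasure \<nu> (cone v) = (\<Sum>w\<in>ch v. emeasure \<nu> (cone w))"
  by (subst cone_children, rule sum_emeasure[symmetric]) (use finite_ch cone_disjoint in auto)

lemma Aff_ch: assumes g: "g \<in> Aff pr" shows "ch (g v) = g ` ch v"
proof (intro equalityI subsetI)
  fix y assume y: "y \<in> ch (g v)"
  obtain z where z: "y = g z" using Aff_bij[OF g] by (metis bij_pointE)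
  then have "g (pr z) = g v" using y Aff_pr[OF g] by simp
  then have "pr z = v" using Aff_bij[OF g] by (simp add: bij_def inj_eq)
  then show "y \<in> g ` ch v" using z by auto
qed (auto simp: Aff_pr[OF g, symmetric])

lemma cval_children: "cval x v = (\<Sum>w\<in>ch v. cval x w)"
proof -
  obtain g where g: "g \<in> Aff pr" "g x = rt" using Aff_transitive by blast
  have eq: "cval x w = emeasure \<nu> (cone (g w))" for w
    using cval_Aff[OF g(1), of x w] cval_root[of "g w"] g(2) by simp
  have "inj_on g (ch v)" using Aff_bij[OF g(1)] by (simp add: bij_def inj_on_def)
  then have "(\<Sum>w\<in>ch (g v). emeasure \<nu> (cone w)) = (\<Sum>w\<in>ch v. emeasure \<nu> (cone (g w)))"
    unfolding Aff_ch[OF g(1)] by (simp add: sum.reindex)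
  then show ?thesis unfolding eq nu_children[of "g v"] .
qed

text \<open>The first hypothesis says that v is not a proper ancestor of x; then x does not
  distinguish between the children of v.\<close>

lemma up_child:
  assumes "up pr x v = 0 \<or> 0 < up pr v x" "pr w = v"
  shows "up pr x w = up pr x v" "up pr w x = Suc (up pr v x)"
proof -
  have "anc (Suc (up pr v x)) w = anc (up pr x v) x"
    using up_meet[of v x] assms(2) by (simp only: funpow_Suc_right o_apply)
  moreover have "up pr x v = 0 \<or> anc (up pr v x) w \<noteq> anc (up pr x v - 1) x"
  proof (cases "up pr x v = 0")
    case False
    then have pos: "0 < up pr v x" using assms(1) by simp
    have "anc (up pr v x) w = anc (up pr v x - 1) v"
    proof -
      obtain n where n: "up pr v x = Suc n" using pos gr0_implies_Suc by blast
      show ?thesis using assms(2) unfolding n by (simp only: funpow_Suc_right o_apply diff_Suc_1)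
    qed
    moreover have "anc (up pr v x - 1) v \<noteq> anc (up pr x v - 1) x"
      using up_le[of "up pr v x - 1" v "up pr x v - 1" x] pos by auto
    ultimately show ?thesis by simp
  qed simp
  ultimately show "up pr x w = up pr x v" "up pr w x = Suc (up pr v x)"
    using up_eqI[of "Suc (up pr v x)" w "up pr x v" x] by auto
qed

text \<open>Uniformity on small cones: the q children of v have the same position relative to x,
  hence the same mass.\<close>

lemma cval_child:
  assumes "up pr x v = 0 \<or> 0 < up pr v x" "pr w = v"
  shows "cval x v = Q 1 * cval x w"
proof -
  have "cval x w' = cval x w" if "w' \<in> ch v" for w'
    using up_child[OF assms] up_child[OF assms(1), of w'] that by (intro cval_cong_up) auto
  then have "cval x v = (\<Sum>w'\<in>ch v. cval x w)" unfolding cval_children[of x v] by (intro sum.cong) auto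
  then show ?thesis by (simp add: card_ch Q_def ennreal_of_nat_eq_real_of_nat)
qed

text \<open>Invariance of \<nu> is this identity at the root; automorphisms carry it to every
  vertex.\<close>

lemma cval_harmonic: "kop kp (\<lambda>x. cval x v) z = cval z v"
proof -
  have root: "kop kp (\<lambda>x. cval x w) rt = cval rt w" for w
  proof -
    have "cval rt w = emeasure \<nu> (cone w)" by (rule cval_root)
    also have "\<dots> = (\<Sum>\<^sup>+x. kp rt x * (\<integral>\<^sup>+\<xi>\<in>cone w. ennreal (K x \<xi>) \<partial>\<nu>))"
      by (rule nu_invariant[OF cone_sets])
    also have "\<dots> = kop kp (\<lambda>x. cval x w) rt" unfolding kop_def cval_def ..
    finally show ?thesis by simp
  qed
  obtain g where g: "g \<in> Aff pr" "g rt = z" using Aff_transitive by blast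
  obtain w where w: "v = g w" using Aff_bij[OF g(1)] by (metis bij_pointE)
  have "kop kp (\<lambda>x. cval x v) z = kop kp (\<lambda>x. cval (g x) (g w)) rt"
    using kop_bij_equivariant[OF Aff_bij[OF g(1)], of kp "\<lambda>x. cval x v" rt] kp_Aff[OF g(1)] g(2) w by simp
  also have "\<dots> = cval rt w" unfolding cval_Aff[OF g(1)] by (rule root)
  also have "\<dots> = cval z v" using cval_Aff[OF g(1), of rt w] g(2) w by simp
  finally show ?thesis .
qed

text \<open>Otherwise all cones off the ray from the root to \<omega> are null. Climbing this ray
  makes the cones of all ancestors null, and these countably many cones cover the ends.\<close>

lemma cval_not_null: "\<exists>x v. 0 < up pr v x \<and> cval x v \<noteq> 0"
proof (rule ccontr)
  assume "\<not> ?thesis"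
  then have z: "cval x v = 0" if "0 < up pr v x" for x v using that by blast
  have "cval rt (anc n rt) = 0" for n
  proof (induction n)
    case 0
    have "cval rt w = 0" if "w \<in> ch rt" for w
      using up_child(2)[of rt rt w] that by (intro z) auto
    then show ?case unfolding cval_children[of rt "anc 0 rt"] by (intro sum.neutral) auto
  next
    case (Suc n)
    have "cval rt w = 0" if w: "w \<in> ch (anc (Suc n) rt)" for w
    proof (cases "up pr w rt = 0")
      case True
      then have "w = anc (up pr rt w) rt" using up_meet[of w rt] by simp
      moreover have "ht w = - int n" using hor_pr[of w] hor_anc[of "Suc n" rt] w by simp
      ultimately have "w = anc n rt" using hor_anc[of "up pr rt w" rt] by (metis add.inverse_inverse diff_0 hor_root of_nat_eq_iff)
      then show ?thesis using Suc by simp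
    qed (auto intro: z)
    then show ?case unfolding cval_children[of rt "anc (Suc n) rt"] by (intro sum.neutral) auto
  qed
  then have null: "cone (anc n rt) \<in> null_sets \<nu>" for n unfolding cval_root by (intro null_setsI) auto
  have "ends pr rt \<subseteq> (\<Union>n. cone (anc n rt))"
  proof
    fix \<xi> assume \<xi>: "\<xi> \<in> ends pr rt"
    then interpret walk_axis q pr rt p \<xi> by unfold_locales
    obtain n where "anc n rt \<in> range \<xi>" using anc_in_axis by blast
    then have "\<xi> \<in> cone (anc n rt)" unfolding cone_def using \<xi> by auto
    then show "\<xi> \<in> (\<Union>n. cone (anc n rt))" by blast
  qed
  then have "emeasure \<nu> (ends pr rt) \<le> emeasure \<nu> (\<Union>n. cone (anc n rt))" by (intro emeasure_mono) auto
  moreover have "(\<Union>n. cone (anc n rt)) \<in> null_sets \<nu>" by (rule null_sets_UN) (rule null)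
  ultimately show False using nu_nonzero by (simp add: null_setsD1)
qed

end

section \<open>The covariant function attached to a boundary point\<close>

locale boundary_axis = boundary_walk q pr rt p \<nu> K + walk_axis q pr rt p \<xi>
  for q :: nat and pr :: "'v \<Rightarrow> 'v" and rt :: 'v and p :: "'v \<Rightarrow> 'v \<Rightarrow> real"
    and \<nu> :: "(int \<Rightarrow> 'v) measure" and K :: "'v \<Rightarrow> (int \<Rightarrow> 'v) \<Rightarrow> real" and \<xi> :: "int \<Rightarrow> 'v"
begin

text \<open>By \<open>ub_eq\<close> every axis vertex of height above \<open>cx x\<close> gives the
  same value. The + 1 excludes the foot of x, which may be a proper ancestor of x, so that the mass
  below it need not be uniform.\<close>

definition ub :: "'v \<Rightarrow> ennreal" where "ub x = Q (cx x + 1) * cval x (\<xi> (cx x + 1))"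

text \<open>x and y separate at the foot of x, so from x the vertex y looks like the axis vertex of
  the same height. This also lets \<open>martin_limit\<close> replace the given sequence by axis
  vertices.\<close>

lemma up_below_axis:
  assumes "anc n y = \<xi> k" "cx x < k"
  shows "up pr x y = ax x" "int (up pr y x) = ht y - cx x"
proof -
  define b where "b = nat (ht y - cx x)"
  have hty: "ht y = k + int n" using hor_anc[of n y] assms(1) by simp
  have b: "int b = ht y - cx x" "b = n + nat (k - cx x)" "0 < nat (k - cx x)"
    unfolding b_def using assms(2) hty by auto
  have an: "anc (n + i) y = \<xi> (k - int i)" for i
    using anc_add[of i n y] assms(1) xi_anc[of i k] by (simp add: add.commute)
  have "anc b y = anc (ax x) x" unfolding anc_ax b(2) an using b(3) by simp
  moreover have "ax x = 0 \<or> anc (b - 1) y \<noteq> anc (ax x - 1) x"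
  proof (cases "ax x = 0")
    case False
    have "anc (ax x - 1) x \<notin> range \<xi>" using ax_le[of "ax x - 1" x] False by auto
    moreover have "b - 1 = n + (nat (k - cx x) - 1)" using b by simp
    then have "anc (b - 1) y \<in> range \<xi>" using an by simp
    ultimately show ?thesis by auto
  qed simp
  ultimately have "up pr x y = ax x" "up pr y x = b" using up_eqI[of "ax x" x b y] by auto
  then show "up pr x y = ax x" "int (up pr y x) = ht y - cx x" using b(1) by auto
qed

lemma up_axis_point:
  assumes "cx x < h" shows "up pr x (\<xi> h) = ax x" "int (up pr (\<xi> h) x) = h - cx x"
  using up_below_axis[of 0 "\<xi> h" h x] assms by auto

lemma ub_eq: assumes "cx x < h" shows "Q h * cval x (\<xi> h) = ub x"
proof -
  have "Q (cx x + 1 + int n) * cval x (\<xi> (cx x + 1 + int n)) = ub x" for n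
  proof (induction n)
    case 0
    then show ?case by (simp add: ub_def)
  next
    case (Suc n)
    define h where "h = cx x + 1 + int n"
    have "0 < up pr (\<xi> h) x" using up_axis_point(2)[of x h] unfolding h_def by simp
    then have "cval x (\<xi> h) = Q 1 * cval x (\<xi> (h + 1))"
      by (intro cval_child) (auto simp: xi_pr)
    then have "Q (h + 1) * cval x (\<xi> (h + 1)) = Q h * cval x (\<xi> h)"
      by (simp add: Q_add mult.assoc)
    then show ?case using Suc unfolding h_def by (simp add: algebra_simps)
  qed
  from this[of "nat (h - (cx x + 1))"] show ?thesis using assms by simp
qed

lemma ub_fin: "ub x < \<top>"
  unfolding ub_def using cval_fin by (simp add: ennreal_mult_less_top)

lemma ub_cov: "ub (shift k x) = Q k * ub x"
proof -
  have "ub (shift k x) = Q (cx x + 1 + k) * cval (shift k x) (shift k (\<xi> (cx x + 1)))"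
    unfolding ub_def by (simp add: algebra_simps)
  also have "\<dots> = Q k * ub x" unfolding cval_Aff[OF shift_Aff] ub_def Q_add[of "cx x + 1" k] by (simp only: ac_simps)
  finally show ?thesis .
qed

text \<open>Fatou's lemma: at each vertex the harmonic functions \<open>H n\<close> eventually equal
  \<open>ub\<close>. Harmonicity itself comes from
  \<open>excessive_covariant_harmonic\<close>.\<close>

lemma ub_sup: "kop kp ub x \<le> ub x"
proof -
  define H where "H n y = Q (int n) * cval y (\<xi> (int n))" for n y
  have lim: "(\<lambda>n. H n y) \<longlonglongrightarrow> ub y" for y
  proof (rule tendsto_eventually, rule eventually_sequentiallyI[of "nat (cx y) + 1"])
    fix n assume "nat (cx y) + 1 \<le> n"
    then show "H n y = ub y" unfolding H_def by (intro ub_eq) linarith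
  qed
  have harm: "kop kp (H n) y = H n y" for n y
    unfolding H_def[abs_def] kop_cmult cval_harmonic ..
  have "kop kp ub x = (\<Sum>\<^sup>+y. liminf (\<lambda>n. kp x y * H n y))"
    unfolding kop_def
  proof (rule nn_integral_cong)
    fix y
    have "(\<lambda>n. kp x y * H n y) \<longlonglongrightarrow> kp x y * ub y" by (intro ennreal_tendsto_cmult lim) simp
    then show "kp x y * ub y = liminf (\<lambda>n. kp x y * H n y)" by (intro lim_imp_Liminf[symmetric]) auto
  qed
  also have "\<dots> \<le> liminf (\<lambda>n. kop kp (H n) x)" unfolding kop_def by (rule nn_integral_liminf) simp
  also have "\<dots> = ub x" unfolding harm using lim by (intro lim_imp_Liminf) auto
  finally show ?thesis .
qed

text \<open>One zero would make \<open>ub\<close> vanish everywhere, but an automorphism carries the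
  non-null cone of \<open>cval_not_null\<close> to the cone of \<xi> 0 and its base point to a
  vertex outside \<open>cone0\<close>, where \<open>ub_eq\<close> applies.\<close>

lemma ub_pos: "ub x > 0"
proof (rule ccontr)
  assume "\<not> ub x > 0"
  then have "ub x = 0" by simp
  then have u0: "ub y = 0" for y using superharmonic_zero[OF kp_irr ub_sup] by blast
  obtain x' v where v: "0 < up pr v x'" "cval x' v \<noteq> 0" using cval_not_null by blast
  obtain g where g: "g \<in> Aff pr" "g v = \<xi> 0" using Aff_transitive by blast
  have up: "0 < up pr (\<xi> 0) (g x')" using v(1) Aff_up[OF g(1), of v x'] g(2) by simp
  have "cx (g x') < 0"
  proof (rule ccontr)
    assume "\<not> cx (g x') < 0"
    then have "g x' \<in> cone0" by (simp add: cone0_iff)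
    then obtain n where "anc n (g x') = \<xi> 0" unfolding cone0_def by blast
    then have "up pr (\<xi> 0) (g x') \<le> 0" using up_le[of 0 "\<xi> 0" n "g x'"] by simp
    then show False using up by simp
  qed
  then have "cval (g x') (\<xi> 0) = 0" using ub_eq[of "g x'" 0] u0 by simp
  then show False using v(2) cval_Aff[OF g(1), of x' v] g(2) by simp
qed

text \<open>On deep cones around \<xi> the masses for the base points x and \<open>rt\<close> have
  exactly the ratio of \<open>ub x\<close> to \<open>ub rt\<close>, while continuity of
  \<open>K x\<close> brings this ratio arbitrarily close to \<open>K x \<xi>\<close>.\<close>

lemma K_eq: "K x \<xi> = enn2real (ub x) / enn2real (ub rt)"
proof -
  define r where "r = enn2real (ub rt)"
  define w where "w = enn2real (ub x)"
  have r: "ub rt = ennreal r" "r > 0" and w: "ub x = ennreal w" "w \<ge> 0"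
    unfolding r_def w_def using ub_fin ub_pos by (auto simp: enn2real_positive_iff)
  have main: "w \<le> (K x \<xi> + e) * r" "(K x \<xi> - e) * r \<le> w" if e: "e > 0" for e
  proof -
    obtain k where k: "\<And>\<eta>. \<eta> \<in> ends pr rt \<Longrightarrow> \<eta> k = \<xi> k \<Longrightarrow> \<bar>K x \<eta> - K x \<xi>\<bar> < e"
      using K_cont[of x] xi e unfolding continuous_ends_def by blast
    \<comment> \<open>Deep enough for the continuity estimate and for \<open>ub_eq\<close> at both x
      and the root.\<close>
    define h where "h = max k (max (cx x + 1) (cx rt + 1))"
    have near: "\<bar>K x \<eta> - K x \<xi>\<bar> < e" if "\<eta> \<in> cone (\<xi> h)" for \<eta>
    proof -
      have \<eta>: "\<eta> \<in> ends pr rt" "\<eta> h = \<xi> h" using that unfolding cone_def by auto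
      have "\<eta> k = anc (nat (h - k)) (\<eta> h)" using ends_anc[OF \<eta>(1), of "nat (h - k)" h] unfolding h_def by simp
      also have "\<dots> = \<xi> k" unfolding \<eta>(2) xi_anc unfolding h_def by simp
      finally show ?thesis using k \<eta>(1) by blast
    qed
    have qu: "Q h * cval x (\<xi> h) = ennreal w" "Q h * cval rt (\<xi> h) = ennreal r"
      using ub_eq[of x h] ub_eq[of rt h] r w unfolding h_def by auto
    have Kn: "0 \<le> K x \<xi>" using K_nonneg[OF xi] .
    have up: "cval x (\<xi> h) \<le> ennreal (K x \<xi> + e) * cval rt (\<xi> h)"
    proof -
      have "cval x (\<xi> h) \<le> (\<integral>\<^sup>+\<eta>. ennreal (K x \<xi> + e) * indicator (cone (\<xi> h)) \<eta> \<partial>\<nu>)"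
        unfolding cval_def
      proof (rule nn_integral_mono)
        fix \<eta>
        show "ennreal (K x \<eta>) * indicator (cone (\<xi> h)) \<eta> \<le> ennreal (K x \<xi> + e) * indicator (cone (\<xi> h)) \<eta>"
        proof (cases "\<eta> \<in> cone (\<xi> h)")
          case True
          then have "K x \<eta> \<le> K x \<xi> + e" using near[OF True] by linarith
          then show ?thesis using True by (simp add: ennreal_leI)
        qed simp
      qed
      then show ?thesis by (simp add: nn_integral_cmult_indicator cval_root)
    qed
    have low: "ennreal (K x \<xi> - e) * cval rt (\<xi> h) \<le> cval x (\<xi> h)"
    proof -
      have "(\<integral>\<^sup>+\<eta>. ennreal (K x \<xi> - e) * indicator (cone (\<xi> h)) \<eta> \<partial>\<nu>) \<le> cval x (\<xi> h)"
        unfolding cval_def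
      proof (rule nn_integral_mono)
        fix \<eta>
        show "ennreal (K x \<xi> - e) * indicator (cone (\<xi> h)) \<eta> \<le> ennreal (K x \<eta>) * indicator (cone (\<xi> h)) \<eta>"
        proof (cases "\<eta> \<in> cone (\<xi> h)")
          case True
          then have "K x \<xi> - e \<le> K x \<eta>" using near[OF True] by linarith
          then show ?thesis using True by (simp add: ennreal_leI)
        qed simp
      qed
      then show ?thesis by (simp add: nn_integral_cmult_indicator cval_root)
    qed
    have "Q h * cval x (\<xi> h) \<le> ennreal (K x \<xi> + e) * (Q h * cval rt (\<xi> h))"
      using mult_left_mono[OF up, of "Q h"] by (simp add: mult.left_commute)
    then have "ennreal w \<le> ennreal ((K x \<xi> + e) * r)" unfolding qu using r Kn e by (simp add: ennreal_mult)
    then show "w \<le> (K x \<xi> + e) * r" using r Kn e by (simp add: ennreal_le_iff)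
    have "ennreal (K x \<xi> - e) * (Q h * cval rt (\<xi> h)) \<le> Q h * cval x (\<xi> h)"
      using mult_left_mono[OF low, of "Q h"] by (simp add: mult.left_commute)
    then have "ennreal ((K x \<xi> - e) * r) \<le> ennreal w" unfolding qu using r by (simp add: ennreal_mult'')
    then show "(K x \<xi> - e) * r \<le> w" using w by (simp add: ennreal_le_iff)
  qed
  have "w / r \<le> K x \<xi>"
  proof (rule field_le_epsilon)
    fix e :: real assume "0 < e"
    then show "w / r \<le> K x \<xi> + e" using main(1)[of e] r(2) by (simp add: field_simps)
  qed
  moreover have "K x \<xi> \<le> w / r"
  proof (rule field_le_epsilon)
    fix e :: real assume "0 < e"
    then show "K x \<xi> \<le> w / r + e" using main(2)[of e] r(2) by (simp add: field_simps)
  qed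
  ultimately show ?thesis unfolding w_def r_def by simp
qed

end

section \<open>From the moment conditions and the axis limit to the Martin kernel\<close>

context walk begin

lemma mpow_cong_up:
  assumes "up pr x y = up pr x' y'" "up pr y x = up pr y' x'"
  shows "mpow p n x y = mpow p n x' y'"
proof -
  obtain g where g: "g \<in> Aff pr" "g x = x'" "g y = y'" using Aff_two_point_transitive[OF assms] by blast
  have "(\<lambda>z. indicator {g y} (g z) :: ennreal) = indicator {y}"
    using Aff_bij[OF g(1)] by (auto simp: indicator_def bij_def inj_eq fun_eq_iff)
  then have "(kop kp ^^ n) (indicator {y'}) x' = (kop kp ^^ n) (indicator {y}) x"
    using kpow_bij_equivariant[OF Aff_bij[OF g(1)], of kp n "indicator {g y}" x] kp_Aff[OF g(1)] g by simp
  then show ?thesis using mpow_kop[of n x y] mpow_kop[of n x' y'] by (metis ennreal_inj)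
qed

lemma green_cong_up:
  "up pr x y = up pr x' y' \<Longrightarrow> up pr y x = up pr y' x' \<Longrightarrow> green p x y = green p x' y'"
  unfolding green_def using mpow_cong_up by metis

lemma summable_mpow: "pot kp (indicator {y}) x < \<top> \<Longrightarrow> summable (\<lambda>n. mpow p n x y)"
  using mpow_kop unfolding pot_kp_mpow by (intro summable_suminf_not_top) auto

definition lyapunov :: "(nat \<Rightarrow> ennreal) \<Rightarrow> nat \<Rightarrow> bool" where
  "lyapunov V h0 \<longleftrightarrow> (\<forall>h. V h < \<top>) \<and> mono V \<and> (\<forall>M<\<top>. \<exists>h. M < V h)
    \<and> (\<forall>h. stepE (\<lambda>j d. V ((h - j) + d)) < \<top>)
    \<and> (\<forall>h>h0. stepE (\<lambda>j d. of_nat (j - h)) + stepE (\<lambda>j d. V ((h - j) + d)) \<le> V h)"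

lemma stepE_eq_infsum:
  assumes "\<And>j d. F j d \<ge> (0::real)" "(\<lambda>x. F (up pr x rt) (up pr rt x) * p rt x) summable_on UNIV"
  shows "stepE (\<lambda>j d. ennreal (F j d)) = ennreal (\<Sum>\<^sub>\<infinity>x. F (up pr x rt) (up pr rt x) * p rt x)"
  unfolding stepE_def using assms p_nonneg
  by (subst ennreal_infsum_eq) (auto simp: ennreal_mult mult.commute)

text \<open>\<alpha> is the mean descent minus the mean ascent of a step of P, both finite by the
  first moment; in the reversed walk they change places.\<close>

lemma lyapunov_exists:
  assumes mom1: "(\<lambda>x. real (tdist pr rt x) * p rt x) summable_on UNIV"
    and cases: "\<alpha> > 0 \<or> (\<alpha> = 0 \<and> (\<exists>\<epsilon>>0. moment pr rt p (2 + \<epsilon>)))"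
    and \<alpha>: "\<alpha> = (\<Sum>\<^sub>\<infinity>x. real_of_int (ht x) * p rt x)"
  shows "stepE (\<lambda>j d. of_nat j) < \<top> \<and> (\<exists>V h0. lyapunov V h0)"
proof -
  have sj: "(\<lambda>x. real (up pr x rt) * p rt x) summable_on UNIV"
    and sd: "(\<lambda>x. real (up pr rt x) * p rt x) summable_on UNIV"
    using mom1 p_nonneg unfolding tdist_def
    by (auto elim!: summable_on_comparison_test intro!: mult_right_mono)
  define Ej where "Ej = (\<Sum>\<^sub>\<infinity>x. real (up pr x rt) * p rt x)"
  define Ed where "Ed = (\<Sum>\<^sub>\<infinity>x. real (up pr rt x) * p rt x)"
  have J: "stepE (\<lambda>j d. of_nat j) = ennreal Ej" and D: "stepE (\<lambda>j d. of_nat d) = ennreal Ed"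
    unfolding ennreal_of_nat_eq_real_of_nat Ej_def Ed_def
    using stepE_eq_infsum[of "\<lambda>j d. real j", OF _ sj] stepE_eq_infsum[of "\<lambda>j d. real d", OF _ sd] by simp_all
  have nn: "0 \<le> Ej" "0 \<le> Ed" unfolding Ej_def Ed_def using p_nonneg by (auto intro!: infsum_nonneg)
  have "\<alpha> = Ej - Ed"
  proof -
    have "(\<lambda>x. real_of_int (ht x) * p rt x) = (\<lambda>x. real (up pr x rt) * p rt x + - (real (up pr rt x) * p rt x))"
      by (auto simp: hor_eq_up algebra_simps)
    then have "\<alpha> = (\<Sum>\<^sub>\<infinity>x. real (up pr x rt) * p rt x) + (\<Sum>\<^sub>\<infinity>x. - (real (up pr rt x) * p rt x))"
      unfolding \<alpha> using sj sd by (simp only: infsum_add summable_on_uminus)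
    then show ?thesis unfolding Ej_def Ed_def by (simp add: infsum_uminus)
  qed
  then have EJ: "stepE (\<lambda>j d. of_nat d) + ennreal \<alpha> = stepE (\<lambda>j d. of_nat j)" if "0 \<le> \<alpha>"
    unfolding J D using that nn by (simp flip: ennreal_plus)
  show ?thesis
    using cases
  proof (elim disjE conjE exE)
    assume "\<alpha> > 0"
    then show ?thesis using lyapunov_positive_drift[of \<alpha>] EJ J D unfolding lyapunov_def by auto
  next
    fix \<epsilon> assume a0: "\<alpha> = 0" and e: "\<epsilon> > 0" "moment pr rt p (2 + \<epsilon>)"
    have "(\<lambda>x. real (up pr x rt + up pr rt x) powr (2 + \<epsilon>) * p rt x) summable_on UNIV"
      using e(2) unfolding moment_def tdist_def by (simp add: add.commute)
    then have "stepE (\<lambda>j d. ennreal (real (j + d) powr (2 + \<epsilon>))) < \<top>"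
      by (subst stepE_eq_infsum[of "\<lambda>j d. real (j + d) powr (2 + \<epsilon>)"]) auto
    then show ?thesis using lyapunov_zero_drift[OF _ _ e(1)] EJ a0 J D unfolding lyapunov_def by auto
  qed
qed

text \<open>\<open>drift\<close> sums level by level; absolute summability, from |hor x| \<le> d(o,
  x), allows the regrouping.\<close>

lemma drift_eq:
  assumes mom1: "(\<lambda>x. real (tdist pr rt x) * p rt x) summable_on UNIV"
  shows "drift pr rt p = (\<Sum>\<^sub>\<infinity>x. real_of_int (ht x) * p rt x)"
proof -
  define f where "f x = real_of_int (ht x) * p rt x" for x
  have "(\<lambda>x. norm (f x)) summable_on UNIV"
  proof (rule summable_on_comparison_test[OF mom1])
    show "norm (f x) \<le> real (tdist pr rt x) * p rt x" for x
    proof -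
      have "\<bar>real_of_int (ht x)\<bar> \<le> real (tdist pr rt x)" unfolding tdist_def using hor_eq_up[of x] by simp
      then show ?thesis unfolding f_def norm_mult using p_nonneg[of rt x] by (simp add: mult_right_mono)
    qed
  qed auto
  then have sf: "f summable_on UNIV" by (rule abs_summable_summable)
  define S where "S = Sigma (UNIV :: int set) (\<lambda>n. {y. ht y = n})"
  have bij: "bij_betw (\<lambda>x. (ht x, x)) UNIV S"
    unfolding S_def bij_betw_def inj_on_def by auto
  have "(\<lambda>(n, y). f y) summable_on S"
    using summable_on_reindex_bij_betw[OF bij, of "\<lambda>(n, y). f y"] sf by simp
  then have "(\<Sum>\<^sub>\<infinity>n. \<Sum>\<^sub>\<infinity>y\<in>{y. ht y = n}. f y) = (\<Sum>\<^sub>\<infinity>(n, y)\<in>S. f y)"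
    unfolding S_def by (rule infsum_Sigma'_banach)
  also have "\<dots> = (\<Sum>\<^sub>\<infinity>x. f x)"
    using infsum_reindex_bij_betw[OF bij, of "\<lambda>(n, y). f y"] by simp
  also have "(\<Sum>\<^sub>\<infinity>n. \<Sum>\<^sub>\<infinity>y\<in>{y. ht y = n}. f y) = drift pr rt p"
    unfolding drift_def
  proof (rule infsum_cong)
    fix n :: int
    have "(\<Sum>\<^sub>\<infinity>y\<in>{y. ht y = n}. f y) = (\<Sum>\<^sub>\<infinity>y\<in>{y. ht y = n}. real_of_int n * p rt y)"
      unfolding f_def by (intro infsum_cong) auto
    also have "\<dots> = real_of_int n * mutilde pr rt p n" unfolding mutilde_def by (simp add: infsum_cmult_right')
    finally show "(\<Sum>\<^sub>\<infinity>y\<in>{y. ht y = n}. f y) = real_of_int n * mutilde pr rt p n" .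
  qed
  finally show ?thesis unfolding f_def by simp
qed

end

context boundary_walk begin

text \<open>Once \<open>ys n\<close> lies below an axis vertex beyond the feet of x and of the root,
  both Green values are those of the axis vertex of equal height. The second claim is transience,
  which case (B) needs to undo the change of measure.\<close>

lemma martin_limit:
  assumes jfin: "stepE (\<lambda>j d. of_nat j) < \<top>" and ly: "lyapunov V h0"
    and xi: "\<xi> \<in> ends pr rt" and conv: "conv_to_end pr ys \<xi>"
  shows "(\<lambda>n. martinK p rt x (ys n)) \<longlonglongrightarrow> K x \<xi>" "summable (\<lambda>n. mpow p n y z)"
proof -
  interpret boundary_axis q pr rt p \<nu> K \<xi> using xi by unfold_locales
  interpret walk_excessive q pr rt p \<xi> V h0 ub
    using jfin ly ub_fin ub_pos ub_sup ub_cov unfolding lyapunov_def by unfold_locales auto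
  show "summable (\<lambda>n. mpow p n y z)" by (intro summable_mpow transient)
  have hit: "eventually (\<lambda>n. \<exists>j. anc j (ys n) = \<xi> k) sequentially" for k
    using conv unfolding conv_to_end_def by blast
  have same: "eventually (\<lambda>n. green p z (ys n) = green p z (\<xi> (int (nat (ht (ys n)))))) sequentially" for z
    \<comment> \<open>The maximum with 0 makes the height a natural number, the index in
      \<open>green_ratio_limit\<close>.\<close>
    using hit[of "max 0 (cx z + 1)"]
  proof eventually_elim
    case (elim n)
    then obtain j where j: "anc j (ys n) = \<xi> (max 0 (cx z + 1))" by blast
    then have h: "ht (ys n) = max 0 (cx z + 1) + int j" using hor_anc[of j "ys n"] by simp
    define h where "h = ht (ys n)"
    have h0: "0 \<le> h" "cx z < h" using h unfolding h_def by auto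
    have "up pr z (ys n) = ax z" "int (up pr (ys n) z) = h - cx z"
      unfolding h_def by (rule up_below_axis[OF j], simp)+
    moreover have "up pr z (\<xi> h) = ax z" "int (up pr (\<xi> h) z) = h - cx z" using up_axis_point[OF h0(2)] .
    ultimately have "green p z (ys n) = green p z (\<xi> h)" by (intro green_cong_up) auto
    then show ?case using h0(1) unfolding h_def by simp
  qed
  have "filterlim (\<lambda>n. nat (ht (ys n))) at_top sequentially"
    unfolding filterlim_at_top
  proof
    fix Z :: nat
    show "eventually (\<lambda>n. Z \<le> nat (ht (ys n))) sequentially"
      using hit[of "int Z"]
    proof eventually_elim
      case (elim n)
      then obtain j where "anc j (ys n) = \<xi> (int Z)" by blast
      then have "ht (ys n) = int Z + int j" using hor_anc[of j "ys n"] by simp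
      then show ?case by simp
    qed
  qed
  then have "(\<lambda>n. green p x (\<xi> (int (nat (ht (ys n))))) / green p rt (\<xi> (int (nat (ht (ys n))))))
      \<longlonglongrightarrow> enn2real (ub x) / enn2real (ub rt)"
    by (rule filterlim_compose[OF green_ratio_limit])
  moreover have "eventually (\<lambda>n. green p x (\<xi> (int (nat (ht (ys n))))) / green p rt (\<xi> (int (nat (ht (ys n)))))
      = martinK p rt x (ys n)) sequentially"
    using same[of x] same[of rt] by eventually_elim (simp add: martinK_def)
  ultimately show "(\<lambda>n. martinK p rt x (ys n)) \<longlonglongrightarrow> K x \<xi>"
    unfolding K_eq by (rule Lim_transform_eventually)
qed

end

section \<open>Haar measure and the two cases\<close>

context end_tree begin

text \<open>The elements with a prescribed image of the root form a left coset of its stabilizer, of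
  mass one, so the orbit map carries Haar measure to counting measure.\<close>

lemma nn_integral_haar:
  assumes "haar_measure pr rt m"
  shows "(\<lambda>g. g rt) \<in> measurable m (count_space UNIV)"
    "(\<integral>\<^sup>+g. f (g rt) \<partial>m) = (\<Sum>\<^sup>+x. f x)"
proof -
  have sp: "space m = Aff pr" and st: "sets m = sigma_sets (Aff pr) (aff_cylinders pr)"
    and inv: "\<And>g A. g \<in> Aff pr \<Longrightarrow> A \<in> sets m \<Longrightarrow> emeasure m ((\<lambda>h. g \<circ> h) ` A) = emeasure m A"
    and one: "emeasure m {g \<in> Aff pr. g rt = rt} = 1"
    using assms unfolding haar_measure_def by auto
  have cyl: "{g \<in> Aff pr. g rt = x} \<in> sets m" for x
    unfolding st aff_cylinders_def by (intro sigma_sets.Basic) auto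
  have vim: "(\<lambda>g. g rt) -` {x} \<inter> space m = {g \<in> Aff pr. g rt = x}" for x unfolding sp by auto
  show meas: "(\<lambda>g. g rt) \<in> measurable m (count_space UNIV)"
    unfolding measurable_count_space_eq_countable[OF countable_vertices] vim using cyl by auto
  have mass: "emeasure m {g \<in> Aff pr. g rt = x} = 1" for x
  proof -
    obtain k where k: "k \<in> Aff pr" "k rt = x" using Aff_transitive by blast
    have "{g \<in> Aff pr. g rt = x} = (\<lambda>h. k \<circ> h) ` {g \<in> Aff pr. g rt = rt}"
    proof (intro equalityI subsetI)
      fix g assume g: "g \<in> {g \<in> Aff pr. g rt = x}"
      have b: "bij k" by (rule Aff_bij[OF k(1)])
      have "g = k \<circ> (inv k \<circ> g)" using b by (auto simp: bij_inv_eq_iff[symmetric] surj_f_inv_f bij_is_surj)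
      moreover have "inv k \<circ> g \<in> {g \<in> Aff pr. g rt = rt}"
        using g k b Aff_comp[OF Aff_inv[OF k(1)], of g] by (auto simp: inv_f_f bij_is_inj)
      ultimately show "g \<in> (\<lambda>h. k \<circ> h) ` {g \<in> Aff pr. g rt = rt}" by blast
    next
      fix g assume "g \<in> (\<lambda>h. k \<circ> h) ` {g \<in> Aff pr. g rt = rt}"
      then show "g \<in> {g \<in> Aff pr. g rt = x}" using k Aff_comp[OF k(1)] by auto
    qed
    then show ?thesis using inv[OF k(1) cyl[of rt]] one by simp
  qed
  have "distr m (count_space UNIV) (\<lambda>g. g rt) = count_space UNIV"
  proof (rule measure_eqI_countable[OF _ _ countable_vertices])
    fix a :: 'v
    show "emeasure (distr m (count_space UNIV) (\<lambda>g. g rt)) {a} = emeasure (count_space UNIV) {a}"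
      using meas by (subst emeasure_distr) (auto simp: vim mass)
  qed auto
  then show "(\<integral>\<^sup>+g. f (g rt) \<partial>m) = (\<Sum>\<^sup>+x. f x)"
    using nn_integral_distr[OF meas, of f] by simp
qed

text \<open>Continuity writes each sublevel set as a union of cones, and there are only countably
  many vertices.\<close>

lemma continuous_ends_measurable:
  assumes "ends_measurable pr rt \<nu>" "continuous_ends pr rt f"
  shows "f \<in> borel_measurable \<nu>"
  unfolding borel_measurable_iff_less
proof
  fix a :: real
  have sp: "space \<nu> = ends pr rt" and st: "sets \<nu> = sigma_sets (ends pr rt) (ends_cones pr rt)"
    using assms(1) unfolding ends_measurable_def by auto
  define C where "C v = {\<xi> \<in> ends pr rt. \<xi> (ht v) = v}" for v
  have C: "C v \<in> sets \<nu>" for v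
    unfolding st C_def ends_cones_def by (intro sigma_sets.Basic) auto
  have "{\<xi> \<in> space \<nu>. f \<xi> < a} = (\<Union>v\<in>{v. C v \<subseteq> {\<xi> \<in> space \<nu>. f \<xi> < a}}. C v)"
  proof (intro equalityI subsetI)
    fix \<xi> assume "\<xi> \<in> {\<xi> \<in> space \<nu>. f \<xi> < a}"
    then have \<xi>: "\<xi> \<in> ends pr rt" "a - f \<xi> > 0" unfolding sp by auto
    then obtain k where k: "\<And>\<eta>. \<eta> \<in> ends pr rt \<Longrightarrow> \<eta> k = \<xi> k \<Longrightarrow> \<bar>f \<eta> - f \<xi>\<bar> < a - f \<xi>"
      using assms(2) unfolding continuous_ends_def by blast
    have ht: "ht (\<xi> k) = k" using \<xi>(1) unfolding ends_def by auto
    have "C (\<xi> k) \<subseteq> {\<xi> \<in> space \<nu>. f \<xi> < a}" unfolding C_def sp ht using k by fastforce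
    moreover have "\<xi> \<in> C (\<xi> k)" unfolding C_def ht using \<xi> by simp
    ultimately show "\<xi> \<in> (\<Union>v\<in>{v. C v \<subseteq> {\<xi> \<in> space \<nu>. f \<xi> < a}}. C v)" by blast
  qed auto
  also have "\<dots> \<in> sets \<nu>"
    by (rule sets.countable_UN') (auto intro: C countable_subset[OF _ countable_vertices])
  finally show "{\<xi> \<in> space \<nu>. f \<xi> < a} \<in> sets \<nu>" .
qed

end

context walk begin

text \<open>By the density hypothesis the integrand of the convolution depends on g only through
  \<open>g rt\<close>, so \<open>nn_integral_haar\<close> applies.\<close>

lemma boundary_walk_haar:
  assumes haar: "haar_measure pr rt m" and nu: "ends_measurable pr rt \<nu>" "radon_ends pr rt \<nu>"
      "emeasure \<nu> (ends pr rt) \<noteq> 0"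
    and inv: "invariant_ends pr rt (density m (\<lambda>g. kp rt (g rt))) \<nu>"
    and K: "\<And>x. continuous_ends pr rt (K x)" "\<And>x \<xi>. \<xi> \<in> ends pr rt \<Longrightarrow> K x \<xi> \<ge> 0"
    and dens: "\<And>g E. g \<in> Aff pr \<Longrightarrow> E \<in> sets \<nu> \<Longrightarrow>
      emeasure \<nu> (end_preimage pr rt g E) = (\<integral>\<^sup>+\<xi>\<in>E. ennreal (K (g rt) \<xi>) \<partial>\<nu>)"
  shows "boundary_walk q pr rt p \<nu> K"
proof unfold_locales
  fix E assume E: "E \<in> sets \<nu>"
  define \<Phi> where "\<Phi> x = (\<integral>\<^sup>+\<xi>\<in>E. ennreal (K x \<xi>) \<partial>\<nu>)" for x
  note haar' = nn_integral_haar[OF haar]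
  have sp: "space m = Aff pr" using haar unfolding haar_measure_def by blast
  have [measurable]: "(\<lambda>g. f (g rt)) \<in> borel_measurable m" for f :: "'v \<Rightarrow> ennreal"
    by (rule measurable_compose[OF haar'(1)]) simp
  have "emeasure \<nu> E = (\<integral>\<^sup>+g. emeasure \<nu> (end_preimage pr rt g E) \<partial>density m (\<lambda>g. kp rt (g rt)))"
    using inv E unfolding invariant_ends_def conv_ends_def by simp
  also have "\<dots> = (\<integral>\<^sup>+g. \<Phi> (g rt) \<partial>density m (\<lambda>g. kp rt (g rt)))"
    by (intro nn_integral_cong) (use E sp in \<open>simp add: dens \<Phi>_def\<close>)
  also have "\<dots> = (\<integral>\<^sup>+g. kp rt (g rt) * \<Phi> (g rt) \<partial>m)"
    by (subst nn_integral_density) simp_all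
  also have "\<dots> = (\<Sum>\<^sup>+x. kp rt x * \<Phi> x)"
    by (rule haar'(2)[of "\<lambda>x. kp rt x * \<Phi> x"])
  finally show "emeasure \<nu> E = (\<Sum>\<^sup>+x. kp rt x * (\<integral>\<^sup>+\<xi>\<in>E. ennreal (K x \<xi>) \<partial>\<nu>))"
    unfolding \<Phi>_def .
qed (use nu K dens in auto)

lemma martin_limit_case_A:
  assumes haar: "haar_measure pr rt m" and A: "case_A pr rt p" and bk: "boundary_kernel_A pr rt p m \<nu> K"
    and xi: "\<xi> \<in> ends pr rt" and conv: "conv_to_end pr ys \<xi>"
  shows "(\<lambda>n. martinK p rt x (ys n)) \<longlonglongrightarrow> K x \<xi>"
proof -
  interpret boundary_walk q pr rt p \<nu> K
    by (rule boundary_walk_haar[OF haar]) (use bk in \<open>auto simp: boundary_kernel_A_def mu_meas_def\<close>)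
  have mom1: "(\<lambda>x. real (tdist pr rt x) * p rt x) summable_on UNIV"
    using A unfolding case_A_def
  proof (elim disjE conjE exE)
    assume "moment pr rt p 1"
    then show ?thesis unfolding moment_def by (simp add: powr_one)
  next
    fix \<epsilon> assume e: "(0::real) < \<epsilon>" "moment pr rt p (2 + \<epsilon>)"
    then have s: "(\<lambda>x. real (tdist pr rt x) powr (2 + \<epsilon>) * p rt x) summable_on UNIV" unfolding moment_def by simp
    show ?thesis
    proof (rule summable_on_comparison_test[OF s])
      fix x
      \<comment> \<open>Distances are integers, so a power with exponent above 1 dominates the first
        power.\<close>
      have "real n \<le> real n powr (2 + \<epsilon>)" for n
        using e powr_mono[of 1 "2 + \<epsilon>" "real n"] by (cases "n = 0") auto
      then show "real (tdist pr rt x) * p rt x \<le> real (tdist pr rt x) powr (2 + \<epsilon>) * p rt x"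
        using p_nonneg by (intro mult_right_mono)
    qed (use p_nonneg in auto)
  qed
  have "drift pr rt p > 0 \<or> (drift pr rt p = 0 \<and> (\<exists>\<epsilon>>0. moment pr rt p (2 + \<epsilon>)))"
    using A unfolding case_A_def by blast
  then obtain V h0 where "stepE (\<lambda>j d. of_nat j) < \<top>" "lyapunov V h0"
    using lyapunov_exists[OF mom1 _ drift_eq[OF mom1]] by blast
  then show ?thesis using martin_limit(1) xi conv by blast
qed

section \<open>Doob transform by the exponential of the height\<close>

definition ps :: "real \<Rightarrow> 'v \<Rightarrow> 'v \<Rightarrow> real" where
  "ps c x y = p x y * exp (c * real_of_int (ht y - ht x))"

lemma ps_nonneg: "ps c x y \<ge> 0" unfolding ps_def using p_nonneg by simp

lemma phi_eq:
  assumes "phi pr rt p c = 1"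
  shows "(\<Sum>\<^sup>+y. ennreal (ps c rt y)) = 1"
proof -
  have psum: "p rt summable_on A" for A
    using stoch summable_on_subset_banach[of "p rt" UNIV A] unfolding stochastic_def by auto
  have mt: "0 \<le> mutilde pr rt p n" for n unfolding mutilde_def using p_nonneg by (intro infsum_nonneg) auto
  have mt_eq: "ennreal (mutilde pr rt p n) = (\<Sum>\<^sup>+y. kp rt y * indicator {y. ht y = n} y)" for n
  proof -
    have "ennreal (mutilde pr rt p n) = (\<integral>\<^sup>+y. kp rt y \<partial>count_space {y. ht y = n})"
      unfolding mutilde_def using ennreal_infsum_eq[OF p_nonneg psum] by simp
    then show ?thesis by (simp add: nn_integral_count_space_indicator)
  qed
  define F where "F n = mutilde pr rt p n * exp (c * real_of_int n)" for n
  have Fn: "0 \<le> F n" for n unfolding F_def using mt by simp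
  \<comment> \<open>A divergent \<open>infsum\<close> has the default value 0, so the value 1
    already proves convergence.\<close>
  have "F summable_on UNIV"
  proof (rule ccontr)
    assume "\<not> F summable_on UNIV"
    then have "infsum F UNIV = 0" by (rule infsum_not_exists)
    then show False using assms unfolding phi_def F_def by simp
  qed
  then have "1 = (\<Sum>\<^sup>+n. ennreal (F n))"
    using ennreal_infsum_eq[of F UNIV, OF Fn] assms unfolding phi_def F_def by simp
  also have "\<dots> = (\<Sum>\<^sup>+n. \<Sum>\<^sup>+y. ennreal (ps c rt y) * indicator {y. ht y = n} y)"
  proof (rule nn_integral_cong)
    fix n
    have "ennreal (F n) = ennreal (exp (c * real_of_int n)) * (\<Sum>\<^sup>+y. kp rt y * indicator {y. ht y = n} y)"
      unfolding F_def mt_eq[symmetric] using mt by (simp add: ennreal_mult mult.commute)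
    also have "\<dots> = (\<Sum>\<^sup>+y. ennreal (exp (c * real_of_int n)) * (kp rt y * indicator {y. ht y = n} y))"
      by (rule nn_integral_cmult[symmetric]) simp
    also have "\<dots> = (\<Sum>\<^sup>+y. ennreal (ps c rt y) * indicator {y. ht y = n} y)"
      by (intro nn_integral_cong) (auto simp: ps_def indicator_def ennreal_mult p_nonneg mult.commute)
    finally show "ennreal (F n) = (\<Sum>\<^sup>+y. ennreal (ps c rt y) * indicator {y. ht y = n} y)" .
  qed
  also have "\<dots> = (\<Sum>\<^sup>+y. ennreal (ps c rt y))" by (rule nn_integral_fibers[symmetric])
  finally show ?thesis by simp
qed

lemma ps_Aff: "g \<in> Aff pr \<Longrightarrow> ps c (g x) (g y) = ps c x y"
  unfolding ps_def using p_Aff[of g x y] Aff_hor[of g y x] by simp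

lemma mpow_ps: "mpow (ps c) n x y = mpow p n x y * exp (c * real_of_int (ht y - ht x))"
proof (induction n arbitrary: x)
  case (Suc n)
  have "ps c x z * mpow (ps c) n z y = p x z * mpow p n z y * exp (c * real_of_int (ht y - ht x))" for z
  proof -
    have e: "exp (c * real_of_int (ht z - ht x)) * exp (c * real_of_int (ht y - ht z)) = exp (c * real_of_int (ht y - ht x))"
      by (simp add: algebra_simps flip: exp_add)
    show ?thesis unfolding Suc ps_def e[symmetric] by (simp only: ac_simps)
  qed
  then show ?case by (simp add: infsum_cmult_left')
qed auto

lemma ps_walk:
  assumes "phi pr rt p c = 1" shows "walk q pr (ps c)"
proof unfold_locales
  have sum1: "(\<Sum>\<^sup>+y. ennreal (ps c x y)) = 1" for x
  proof -
    obtain g where g: "g \<in> Aff pr" "g rt = x" using Aff_transitive by blast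
    have "(\<Sum>\<^sup>+y. ennreal (ps c x y)) = (\<Sum>\<^sup>+y. ennreal (ps c (g rt) (g y)))"
      using nn_integral_bij_UNIV[OF Aff_bij[OF g(1)], of "\<lambda>y. ennreal (ps c x y)"] g(2) by simp
    then show ?thesis unfolding ps_Aff[OF g(1)] using phi_eq[OF assms] by simp
  qed
  have "ps c x summable_on UNIV" for x
    using nonneg_summable_on_iff[of "ps c x", OF ps_nonneg] sum1[of x] by simp
  moreover have "(\<Sum>\<^sub>\<infinity>y. ps c x y) = 1" for x
  proof -
    have "ennreal (\<Sum>\<^sub>\<infinity>y. ps c x y) = ennreal 1"
      using ennreal_infsum_eq[of "ps c x", OF ps_nonneg calculation] sum1[of x] by simp
    then show ?thesis by (subst (asm) ennreal_inj) (auto intro: infsum_nonneg ps_nonneg)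
  qed
  ultimately show "stochastic (ps c)" unfolding stochastic_def using ps_nonneg by blast
  show "irreducible_tm (ps c)"
    using irred unfolding irreducible_tm_def mpow_ps by (simp add: zero_less_mult_iff)
  show "semi_isotropic pr (ps c)"
    unfolding semi_isotropic_def
  proof (intro allI impI)
    fix x y x' y' assume u: "up pr x y = up pr x' y' \<and> up pr y x = up pr y' x'"
    then have "p x y = p x' y'" using semi unfolding semi_isotropic_def by blast
    moreover have "ht y - ht x = ht y' - ht x'" using u hor_up[of x y] hor_up[of x' y'] by simp
    ultimately show "ps c x y = ps c x' y'" unfolding ps_def by simp
  qed
qed

text \<open>Convexity of \<open>phi\<close>: it equals 1 at 0 and at c, so its slope at c is
  positive. The chord is compared with the tangent term by term, strictly at a level change, which
  avoids differentiating the series.\<close>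

lemma ps_drift_pos:
  assumes c: "c > 0" and ph: "phi pr rt p c = 1"
    and mom1: "(\<lambda>x. real (tdist pr rt x) * ps c rt x) summable_on UNIV"
  shows "(\<Sum>\<^sub>\<infinity>x. real_of_int (ht x) * ps c rt x) > 0"
proof -
  interpret S: walk q pr rt "ps c" by (rule ps_walk[OF ph])
  define f where "f x = real_of_int (ht x) * ps c rt x" for x
  \<comment> \<open>The slope of the chord of \<open>phi\<close> between 0 and c, term by term; its
    sum is 0.\<close>
  define g where "g x = (ps c rt x - p rt x) / c" for x
  have hp: "(ps c rt has_sum 1) UNIV" "(p rt has_sum 1) UNIV"
    using S.stoch stoch unfolding stochastic_def by (metis has_sum_infsum)+
  have sf: "f summable_on UNIV"
  proof (rule abs_summable_summable, rule summable_on_comparison_test[OF mom1])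
    show "norm (f x) \<le> real (tdist pr rt x) * ps c rt x" for x
    proof -
      have "\<bar>real_of_int (ht x)\<bar> \<le> real (tdist pr rt x)" unfolding tdist_def using hor_eq_up[of x] by simp
      then show ?thesis unfolding f_def norm_mult using ps_nonneg[of c rt x] by (simp add: mult_right_mono)
    qed
  qed auto
  have g0: "(g has_sum 0) UNIV"
  proof -
    have "((\<lambda>x. ps c rt x + - p rt x) has_sum (1 + - 1)) UNIV"
      by (intro has_sum_add hp(1) has_sum_uminusI hp(2))
    then have "((\<lambda>x. (ps c rt x + - p rt x) * (1 / c)) has_sum (1 + - 1) * (1 / c)) UNIV"
      by (rule has_sum_cmult_left)
    then show ?thesis unfolding g_def by simp
  qed
  have le: "g x \<le> f x \<and> (0 < p rt x \<and> ht x \<noteq> 0 \<longrightarrow> g x < f x)" for x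
  proof -
    define t where "t = c * real_of_int (ht x)"
    have ps: "ps c rt x = p rt x * exp t" unfolding ps_def t_def by simp
    have e1: "exp t - 1 \<le> t * exp t"
    proof -
      have "1 - t \<le> exp (- t)" using exp_ge_add_one_self[of "- t"] by simp
      then have "(1 - t) * exp t \<le> exp (- t) * exp t" by (intro mult_right_mono) auto
      then show ?thesis by (simp add: algebra_simps flip: exp_add)
    qed
    have e2: "exp t - 1 < t * exp t" if "t \<noteq> 0"
    proof -
      have "1 - t < exp (- t)"
      proof (cases "t < 1")
        case True
        have "0 < (t / 2)\<^sup>2" using that by simp
        \<comment> \<open>Squaring the usual bound at -t/2 leaves the surplus (t/2)^2, which gives
          strictness.\<close>
        then have "1 - t < (1 + - t / 2)\<^sup>2" by (simp add: power2_eq_square algebra_simps)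
        also have "\<dots> \<le> (exp (- t / 2))\<^sup>2"
          using True exp_ge_add_one_self[of "- t / 2"] by (intro power_mono) auto
        also have "\<dots> = exp (- t)" by (simp add: power2_eq_square flip: exp_add)
        finally show ?thesis .
      next
        case False
        then show ?thesis using exp_gt_zero[of "- t"] by linarith
      qed
      then have "(1 - t) * exp t < exp (- t) * exp t" by (intro mult_strict_right_mono) auto
      then show ?thesis by (simp add: algebra_simps flip: exp_add)
    qed
    have gf: "g x = p rt x * (exp t - 1) / c" "f x = p rt x * (t * exp t) / c"
      unfolding g_def f_def ps t_def using c by (simp_all add: field_simps)
    have "g x \<le> f x" unfolding gf using e1 c p_nonneg[of rt x] by (intro divide_right_mono mult_left_mono) auto
    moreover have "g x < f x" if "0 < p rt x" "ht x \<noteq> 0"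
    proof -
      have "t \<noteq> 0" unfolding t_def using that c by simp
      then show ?thesis unfolding gf using e2 c that by (intro divide_strict_right_mono mult_strict_left_mono) auto
    qed
    ultimately show ?thesis by blast
  qed
  obtain x0 where x0: "p rt x0 > 0" "ht x0 \<noteq> 0" using exists_level_change by blast
  have d: "((\<lambda>x. f x + - g x) has_sum (infsum f UNIV + - 0)) UNIV"
    by (intro has_sum_add has_sum_uminusI g0 has_sum_infsum sf)
  have "0 < f x0 + - g x0" using le[of x0] x0 by simp
  also have "\<dots> = (\<Sum>x\<in>{x0}. f x + - g x)" by simp
  also have "\<dots> \<le> infsum f UNIV + - 0"
    using le by (intro finite_sum_le_has_sum[OF d]) (auto simp: algebra_simps)
  finally show ?thesis unfolding f_def by simp
qed

lemma martin_limit_case_B: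
  assumes haar: "haar_measure pr rt m" and B: "case_B pr rt p c" and bk: "boundary_kernel_B pr rt p c m \<nu> K"
    and xi: "\<xi> \<in> ends pr rt" and conv: "conv_to_end pr ys \<xi>"
  shows "(\<lambda>n. martinK p rt x (ys n)) \<longlonglongrightarrow> K x \<xi>"
proof -
  have c: "c > 0" "phi pr rt p c = 1" using B unfolding case_B_def by auto
  interpret S: walk q pr rt "ps c" by (rule ps_walk[OF c(2)])
  \<comment> \<open>The measures of case (B) carry the factor exp (c hor x); once it is removed,
    \<open>K'\<close> is a density in the form of case (A) for the transformed walk.\<close>
  define K' where "K' x \<xi> = exp (- c * real_of_int (ht x)) * K x \<xi>" for x \<xi>
  have nu: "ends_measurable pr rt \<nu>" "emeasure \<nu> (ends pr rt) < \<infinity>" "emeasure \<nu> (ends pr rt) \<noteq> 0"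
    and inv: "invariant_ends pr rt (mu_sharp pr p rt c m) \<nu>"
    and Kc: "\<And>x. continuous_ends pr rt (K x)" and Kn: "\<And>x \<xi>. \<xi> \<in> ends pr rt \<Longrightarrow> K x \<xi> \<ge> 0"
    and dens: "\<And>g E. g \<in> Aff pr \<Longrightarrow> E \<in> sets \<nu> \<Longrightarrow> ennreal (exp (c * real_of_int (ht (g rt)))) * emeasure \<nu> (end_preimage pr rt g E)
          = (\<integral>\<^sup>+\<xi>\<in>E. ennreal (K (g rt) \<xi>) \<partial>\<nu>)"
    using bk unfolding boundary_kernel_B_def by auto
  have sp: "space \<nu> = ends pr rt" using nu(1) unfolding ends_measurable_def by blast
  have Km [measurable]: "K x \<in> borel_measurable \<nu>" for x by (rule continuous_ends_measurable[OF nu(1) Kc])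
  have meas: "(\<lambda>g. f (g rt)) \<in> borel_measurable m" for f :: "'v \<Rightarrow> ennreal"
    by (rule measurable_compose[OF nn_integral_haar(1)[OF haar]]) simp
  interpret bw: boundary_walk q pr rt "ps c" \<nu> K'
  proof (rule S.boundary_walk_haar[OF haar])
    show "ends_measurable pr rt \<nu>" "emeasure \<nu> (ends pr rt) \<noteq> 0" using nu by auto
    show "radon_ends pr rt \<nu>"
      unfolding radon_ends_def
    proof
      fix C assume "C \<in> ends_cones pr rt"
      then have "emeasure \<nu> C \<le> emeasure \<nu> (ends pr rt)"
        using sp sets.top[of \<nu>] unfolding ends_cones_def by (intro emeasure_mono) auto
      then show "emeasure \<nu> C < \<infinity>" using nu(2) by order
    qed
    have "density m (\<lambda>g. ennreal (ps c rt (g rt))) = mu_sharp pr p rt c m"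
      unfolding mu_sharp_def mu_meas_def
    proof (subst density_density_eq)
      show "density m (\<lambda>g. ennreal (ps c rt (g rt)))
          = density m (\<lambda>g. kp rt (g rt) * ennreal (exp (c * real_of_int (ht (g rt)))))"
        unfolding ps_def using p_nonneg by (simp add: ennreal_mult)
    qed (rule meas[of "\<lambda>x. kp rt x"], rule meas[of "\<lambda>x. ennreal (exp (c * real_of_int (ht x)))"])
    then show "invariant_ends pr rt (density m (\<lambda>g. ennreal (ps c rt (g rt)))) \<nu>" using inv by simp
    show "continuous_ends pr rt (K' x)" for x
      unfolding continuous_ends_def
    proof (intro ballI allI impI)
      fix \<xi> and e :: real assume a: "\<xi> \<in> ends pr rt" "0 < e"
      define r where "r = exp (- c * real_of_int (ht x))"
      have r: "r > 0" unfolding r_def by simp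
      obtain k where k: "\<forall>\<eta>\<in>ends pr rt. \<eta> k = \<xi> k \<longrightarrow> \<bar>K x \<eta> - K x \<xi>\<bar> < e / r"
        using Kc[of x] a r unfolding continuous_ends_def by (metis divide_pos_pos)
      have "\<bar>K' x \<eta> - K' x \<xi>\<bar> < e" if "\<eta> \<in> ends pr rt" "\<eta> k = \<xi> k" for \<eta>
      proof -
        have "\<bar>K' x \<eta> - K' x \<xi>\<bar> = r * \<bar>K x \<eta> - K x \<xi>\<bar>"
          unfolding K'_def r_def[symmetric] using r by (simp add: abs_mult flip: right_diff_distrib)
        then show ?thesis using k that r by (simp add: field_simps)
      qed
      then show "\<exists>k. \<forall>\<eta>\<in>ends pr rt. \<eta> k = \<xi> k \<longrightarrow> \<bar>K' x \<eta> - K' x \<xi>\<bar> < e" by blast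
    qed
    show "0 \<le> K' x \<xi>" if "\<xi> \<in> ends pr rt" for x \<xi> unfolding K'_def using Kn[OF that] by simp
    show "emeasure \<nu> (end_preimage pr rt g E) = (\<integral>\<^sup>+\<xi>\<in>E. ennreal (K' (g rt) \<xi>) \<partial>\<nu>)"
      if g: "g \<in> Aff pr" and E: "E \<in> sets \<nu>" for g E
    proof -
      define r where "r = exp (c * real_of_int (ht (g rt)))"
      have r: "r > 0" "exp (- c * real_of_int (ht (g rt))) = 1 / r"
        unfolding r_def by (simp_all add: exp_minus field_simps)
      have em: "ennreal (1 / r * b) = ennreal (1 / r) * ennreal b" for b
        by (rule ennreal_mult') (use r in simp)
      have "(\<integral>\<^sup>+\<xi>\<in>E. ennreal (K' (g rt) \<xi>) \<partial>\<nu>) = (\<integral>\<^sup>+\<xi>. ennreal (1 / r) * (ennreal (K (g rt) \<xi>) * indicator E \<xi>) \<partial>\<nu>)"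
        unfolding K'_def r(2) by (simp only: em mult.assoc)
      also have "\<dots> = ennreal (1 / r) * (\<integral>\<^sup>+\<xi>\<in>E. ennreal (K (g rt) \<xi>) \<partial>\<nu>)"
        by (intro nn_integral_cmult borel_measurable_times_ennreal measurable_compose[OF Km]
            borel_measurable_indicator E) simp
      also have "\<dots> = ennreal (1 / r) * (ennreal r * emeasure \<nu> (end_preimage pr rt g E))"
        using dens[OF g E] unfolding r_def by simp
      also have "\<dots> = ennreal (1 / r * r) * emeasure \<nu> (end_preimage pr rt g E)"
        by (simp only: em mult.assoc)
      also have "\<dots> = emeasure \<nu> (end_preimage pr rt g E)" using r(1) by simp
      finally show ?thesis by simp
    qed
  qed
  have mom1: "(\<lambda>x. real (tdist pr rt x) * ps c rt x) summable_on UNIV"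
    using B unfolding case_B_def ps_def by (simp add: mult.assoc)
  obtain V h0 where V: "S.stepE (\<lambda>j d. of_nat j) < \<top>" "S.lyapunov V h0"
    using S.lyapunov_exists[OF mom1 disjI1[OF ps_drift_pos[OF c mom1]] refl] by blast
  have lim: "(\<lambda>n. martinK (ps c) rt x (ys n)) \<longlonglongrightarrow> K' x \<xi>" by (rule bw.martin_limit(1)[OF V xi conv])
  \<comment> \<open>Transience of the transformed walk makes both series converge, so the factor can
    be taken out of the sum.\<close>
  have gs: "green (ps c) y z = green p y z * exp (c * real_of_int (ht z - ht y))" for y z
  proof -
    have "summable (\<lambda>n. mpow (ps c) n y z)" by (rule bw.martin_limit(2)[OF V xi conv])
    then have "summable (\<lambda>n. mpow p n y z)" 
      unfolding mpow_ps using summable_cmult_iff[of "exp (c * real_of_int (ht z - ht y))" "\<lambda>n. mpow p n y z"]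
      by (simp add: mult.commute)
    then show ?thesis unfolding green_def mpow_ps by (rule suminf_mult2[symmetric])
  qed
  \<comment> \<open>The height of \<open>ys n\<close> cancels in the quotient; the remaining factor
    in x is the one that was put into \<open>K'\<close>.\<close>
  have "martinK (ps c) rt x (ys n) = exp (- c * real_of_int (ht x)) * martinK p rt x (ys n)" for n
  proof -
    have "exp (c * real_of_int (ht (ys n) - ht x)) = exp (- c * real_of_int (ht x)) * exp (c * real_of_int (ht (ys n) - ht rt))"
      by (simp add: algebra_simps flip: exp_add)
    then show ?thesis unfolding martinK_def gs by simp
  qed
  then have "(\<lambda>n. exp (c * real_of_int (ht x)) * (exp (- c * real_of_int (ht x)) * martinK p rt x (ys n)))
      \<longlonglongrightarrow> exp (c * real_of_int (ht x)) * K' x \<xi>" using tendsto_mult_left[OF lim] by simp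
  moreover have "exp (c * real_of_int (ht x)) * (exp (- c * real_of_int (ht x)) * a) = a" for a
    by (simp add: exp_minus field_simps)
  ultimately show ?thesis unfolding K'_def by simp
qed

end

theorem theorem4p8:
  fixes q :: nat and pr :: "'v \<Rightarrow> 'v" and rt :: 'v and p :: "'v \<Rightarrow> 'v \<Rightarrow> real"
    and m :: "('v \<Rightarrow> 'v) measure" and \<nu> :: "(int \<Rightarrow> 'v) measure"
    and K :: "'v \<Rightarrow> (int \<Rightarrow> 'v) \<Rightarrow> real" and c0 :: real
  assumes "q \<ge> 2" and "tree_with_end q pr"
    and "stochastic p" and "irreducible_tm p" and "semi_isotropic pr p"
    and "haar_measure pr rt m"
    and "(case_A pr rt p \<and> boundary_kernel_A pr rt p m \<nu> K) \<or>
         (case_B pr rt p c0 \<and> boundary_kernel_B pr rt p c0 m \<nu> K)"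
  shows "\<forall>x. \<forall>\<xi> \<in> ends pr rt. \<forall>ys. conv_to_end pr ys \<xi> \<longrightarrow>
           (\<lambda>n. martinK p rt x (ys n)) \<longlonglongrightarrow> K x \<xi>"
proof -
  interpret walk q pr rt p using assms by unfold_locales auto
  show ?thesis using assms(6,7) martin_limit_case_A martin_limit_case_B by blast
qed

end
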